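(* Let $N\ge1$. (1) Let $K$ be a field of odd characteristic $p$. The Hilbert series $H_{A_N}(t)=\sum_k \dim_K (A_N)_k\,t^k$ of $A_N$ is $$H_{A_N}(t)=\sum_{s=0}^{\lfloor N/2\rfloor}\binom{N}{2s}\,b_s(p)\,t^s(1+t)^{N-2s}.$$ If $P$ is the adjacency matrix of the path graph with vertices $0,1,\dots,p-2$ (with $i$ adjacent to $i+1$), then $$\dim_K A_N=\bigl((2I+P)^N\bigr)_{0,0}=\sum_{j\in\mathbb Z}\left[\binom{2N}{N+2pj}-\binom{2N}{N+2pj+2}\right],$$ where the sum is finite. (2) If $K$ is a field of characteristic zero, the same Hilbert-series formula holds with $b_s(p)$ replaced by $b_s(0)=\mathrm{Cat}_s=\frac1{s+1}\binom{2s}{s}$; in that case $$\dim_K(A_N)_k=\frac1{N+1}\binom{N+1}{k}\binom{N+1}{k+1}\quad(k\ge 0),\qquad \dim_K A_N=\mathrm{Cat}_{N+1}.$$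
   Context: $X=(x_{ij})_{1\le i,j\le N}$ is the generic symmetric matrix: $x_{ji}=x_{ij}$ and the $x_{ij}$, $i\le j$, are algebraically independent over the field $K$. $R=K[x_{ij}:1\le i\le j\le N]$, $S=K[d_{ij}:1\le i\le j\le N]$ (each $d_{ij}$ of degree $1$), $D_N=\det X\in R$. The variable $d_{ij}$ acts on $R$ as the ordinary partial derivative $\partial/\partial x_{ij}$ ($i\le j$); for $f\in S$, $f(\partial)$ denotes the resulting differential operator. $\mathrm{Ann}(D_N)=\{f\in S: f(\partial)D_N=0\}$ and $A_N=S/\mathrm{Ann}(D_N)$, graded by degree. A Dyck path of length $2s$ is a walk on the integers from $0$ to $0$ with $2s$ steps, each $+1$ or $-1$, that never goes below $0$; its height is the maximum value reached. $b_s(p)$ is the number of Dyck paths of length $2s$ whose height is at most $p-2$; $b_0(p)=1$. Binomial coefficients $\binom ab$ are $0$ when $b<0$ or $b>a$ ($a\ge0$). *)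

theory Defs
  imports
    "HOL-Library.Poly_Mapping"
    "HOL-Computational_Algebra.Formal_Power_Series"
    "HOL-Algebra.QuotRing"
    "HOL-Algebra.Embedded_Algebras"
    "Jordan_Normal_Form.Determinant"
begin

section \<open>Polynomials in the variables indexed by the upper triangle\<close>

text \<open>
  A polynomial is a finitely supported function from exponent vectors to coefficients, with the
  convolution product. Rows and columns are numbered from \<open>0\<close> to \<open>N - 1\<close>.
  The polynomial rings \<open>R\<close> (in the \<open>x\<^sub>i\<^sub>j\<close>) and \<open>S\<close> (in the \<open>d\<^sub>i\<^sub>j\<close>) have the same index set, so
  both are represented by the same set of polynomials.
\<close>

type_synonym 'k mpoly = "((nat \<times> nat) \<Rightarrow>\<^sub>0 nat) \<Rightarrow>\<^sub>0 'k"

definition vars :: "nat \<Rightarrow> (nat \<times> nat) set" where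
  "vars N = {(i, j). i \<le> j \<and> j < N}"

definition poly_set :: "nat \<Rightarrow> ('k::field) mpoly set" where
  "poly_set N = {f. \<forall>m \<in> Poly_Mapping.keys f. Poly_Mapping.keys m \<subseteq> vars N}"

definition Var :: "nat \<times> nat \<Rightarrow> ('k::field) mpoly" where
  "Var v = Poly_Mapping.single (Poly_Mapping.single v 1) 1"

definition Const :: "'k::field \<Rightarrow> 'k mpoly" where
  "Const c = Poly_Mapping.single 0 c"

definition mon_deg :: "((nat \<times> nat) \<Rightarrow>\<^sub>0 nat) \<Rightarrow> nat" where
  "mon_deg m = (\<Sum>v \<in> Poly_Mapping.keys m. Poly_Mapping.lookup m v)"

definition homogeneous_part :: "nat \<Rightarrow> nat \<Rightarrow> ('k::field) mpoly set" where
  "homogeneous_part N k = {f \<in> poly_set N. \<forall>m \<in> Poly_Mapping.keys f. mon_deg m = k}"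

definition sym_det :: "nat \<Rightarrow> ('k::field) mpoly" where
  "sym_det N = det (mat N N (\<lambda>(i, j). Var (min i j, max i j)))"


section \<open>Differential operators\<close>

text \<open>
  In \<open>partial v\<close> the exponent \<open>m - single v 1\<close> is truncated when \<open>v\<close> does not occur in \<open>m\<close>; the
  coefficient \<open>of_nat (lookup m v)\<close> is then zero.
\<close>

definition partial :: "nat \<times> nat \<Rightarrow> ('k::field) mpoly \<Rightarrow> 'k mpoly" where
  "partial v f = (\<Sum>m \<in> Poly_Mapping.keys f.
     Poly_Mapping.single (m - Poly_Mapping.single v 1)
       (of_nat (Poly_Mapping.lookup m v) * Poly_Mapping.lookup f m))"

lemma lookup_partial:
  "Poly_Mapping.lookup (partial v f) m =
     of_nat (Suc (Poly_Mapping.lookup m v)) * Poly_Mapping.lookup f (m + Poly_Mapping.single v 1)"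
proof -
  let ?e = "Poly_Mapping.single v (1::nat)"
  have eq: "(of_nat (Poly_Mapping.lookup n v) * Poly_Mapping.lookup f n when n - ?e = m) =
      (of_nat (Poly_Mapping.lookup n v) * Poly_Mapping.lookup f n when n = m + ?e)" for n
  proof (cases "Poly_Mapping.lookup n v = 0")
    case True
    then show ?thesis by (simp add: when_def)
  next
    case False
    have "n - ?e = m \<longleftrightarrow> n = m + ?e"
    proof
      assume *: "n - ?e = m"
      show "n = m + ?e"
        by (rule poly_mapping_eqI)
          (use False * in \<open>auto simp: lookup_minus lookup_add lookup_single when_def\<close>)
    qed simp
    then show ?thesis by simp
  qed
  have "Poly_Mapping.lookup (partial v f) m = (\<Sum>n \<in> Poly_Mapping.keys f.
      of_nat (Poly_Mapping.lookup n v) * Poly_Mapping.lookup f n when n - ?e = m)"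
    by (simp add: partial_def lookup_sum lookup_single)
  also have "\<dots> = (\<Sum>n \<in> Poly_Mapping.keys f.
      of_nat (Poly_Mapping.lookup n v) * Poly_Mapping.lookup f n when n = m + ?e)"
    by (simp only: eq)
  also have "\<dots> = of_nat (Poly_Mapping.lookup (m + ?e) v) * Poly_Mapping.lookup f (m + ?e)"
    by (cases "m + ?e \<in> Poly_Mapping.keys f")
      (auto simp: when_def in_keys_iff intro!: sum.neutral)
  finally show ?thesis by (simp add: lookup_add)
qed

lemma partial_commute: "partial u (partial v f) = partial v (partial u f)"
proof (cases "u = v")
  case False
  then show ?thesis
    by (intro poly_mapping_eqI)
      (simp add: lookup_partial lookup_add lookup_single ac_simps)
qed simp

text \<open>
  The monomial \<open>m\<close> acts by applying each \<open>partial v\<close> as often as \<open>v\<close> occurs in \<open>m\<close>. The order in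
  which the variables are visited by \<open>Finite_Set.fold\<close> is irrelevant:
\<close>

lemma comp_fun_commute_partial_power:
  "comp_fun_commute (\<lambda>v. (partial v :: ('k::field) mpoly \<Rightarrow> _) ^^ e v)"
proof
  fix u v
  have 1: "partial a ((partial b ^^ k) f) = (partial b ^^ k) (partial a f)"
    for a b k and f :: "'k mpoly"
    by (induction k) (auto simp: partial_commute[of a b])
  have "(partial a ^^ l) ((partial b ^^ k) f) = (partial b ^^ k) ((partial a ^^ l) f)"
    for a b k l and f :: "'k mpoly"
    by (induction l) (auto simp: 1)
  then show "partial v ^^ e v \<circ> partial u ^^ e u =
      partial u ^^ e u \<circ> (partial v ^^ e v :: 'k mpoly \<Rightarrow> _)"
    by (auto simp: fun_eq_iff)
qed

definition mon_op :: "((nat \<times> nat) \<Rightarrow>\<^sub>0 nat) \<Rightarrow> ('k::field) mpoly \<Rightarrow> 'k mpoly" where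
  "mon_op m g = Finite_Set.fold (\<lambda>v. partial v ^^ Poly_Mapping.lookup m v) g (Poly_Mapping.keys m)"

definition diff_op :: "('k::field) mpoly \<Rightarrow> 'k mpoly \<Rightarrow> 'k mpoly" where
  "diff_op f g = (\<Sum>m \<in> Poly_Mapping.keys f. Const (Poly_Mapping.lookup f m) * mon_op m g)"


section \<open>The apolar algebra of the determinant\<close>

definition poly_ring :: "nat \<Rightarrow> ('k::field) mpoly ring" where
  "poly_ring N = \<lparr>carrier = poly_set N, mult = (*), one = 1, zero = 0, add = (+)\<rparr>"

definition Ann :: "nat \<Rightarrow> ('k::field) mpoly set" where
  "Ann N = {f \<in> poly_set N. diff_op f (sym_det N) = 0}"

definition apolar_algebra :: "nat \<Rightarrow> ('k::field) mpoly set ring" where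
  "apolar_algebra N = poly_ring N Quot Ann N"

definition proj :: "nat \<Rightarrow> ('k::field) mpoly \<Rightarrow> 'k mpoly set" where
  "proj N f = Ann N +>\<^bsub>poly_ring N\<^esub> f"

text \<open>
  Dimensions are taken in the sense of \<open>HOL-Algebra.Embedded_Algebras\<close>, where the field of scalars
  is a subfield of the ambient ring: here the image of \<open>K\<close> in the quotient. As \<open>ring.dim\<close> is a
  definite description, statements about it are meaningful only together with
  \<open>ring.finite_dimension\<close>.
\<close>

definition apolar_scalars :: "nat \<Rightarrow> ('k::field) mpoly set set" where
  "apolar_scalars N = proj N ` range Const"

definition apolar_part :: "nat \<Rightarrow> nat \<Rightarrow> ('k::field) mpoly set set" where
  "apolar_part N k = proj N ` homogeneous_part N k"

definition apolar_finite_dim :: "'k::field itself \<Rightarrow> nat \<Rightarrow> bool" where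
  "apolar_finite_dim _ N \<longleftrightarrow>
     ring.finite_dimension (apolar_algebra N :: 'k mpoly set ring) (apolar_scalars N)
       (carrier (apolar_algebra N)) \<and>
     (\<forall>k. ring.finite_dimension (apolar_algebra N :: 'k mpoly set ring) (apolar_scalars N)
       (apolar_part N k))"

definition apolar_dim :: "'k::field itself \<Rightarrow> nat \<Rightarrow> nat" where
  "apolar_dim _ N =
     ring.dim (apolar_algebra N :: 'k mpoly set ring) (apolar_scalars N)
       (carrier (apolar_algebra N))"

definition apolar_part_dim :: "'k::field itself \<Rightarrow> nat \<Rightarrow> nat \<Rightarrow> nat" where
  "apolar_part_dim _ N k =
     ring.dim (apolar_algebra N :: 'k mpoly set ring) (apolar_scalars N) (apolar_part N k)"

definition hilbert_series :: "'k::field itself \<Rightarrow> nat \<Rightarrow> rat fps" where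
  "hilbert_series K N = Abs_fps (\<lambda>k. of_nat (apolar_part_dim K N k))"


section \<open>Combinatorial quantities\<close>

text \<open>A Dyck path is the list of its steps; \<open>sum_list (take k w)\<close> is its position after \<open>k\<close> steps.\<close>

definition dyck_paths :: "nat \<Rightarrow> int list set" where
  "dyck_paths s = {w. length w = 2 * s \<and> set w \<subseteq> {1, -1} \<and> sum_list w = 0 \<and>
     (\<forall>k \<le> length w. 0 \<le> sum_list (take k w))}"

definition path_height :: "int list \<Rightarrow> int" where
  "path_height w = Max {sum_list (take k w) | k. k \<le> length w}"

definition dyck_count :: "nat \<Rightarrow> nat \<Rightarrow> nat" where
  "dyck_count p s = card {w \<in> dyck_paths s. path_height w \<le> int p - 2}"

definition catalan :: "nat \<Rightarrow> rat" where
  "catalan s = 1 / of_nat (s + 1) * of_nat ((2 * s) choose s)"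

definition binom :: "nat \<Rightarrow> int \<Rightarrow> int" where
  "binom a b = (if b < 0 then 0 else int (a choose nat b))"

definition path_adj :: "nat \<Rightarrow> int mat" where
  "path_adj n = mat n n (\<lambda>(i, j). if j = i + 1 \<or> i = j + 1 then 1 else 0)"

end

theory Submission
  imports Defs
begin

text \<open>
  Let \<open>a\<^sub>0, b\<^sub>0, \<dots>, a\<^sub>N\<^sub>-\<^sub>1, b\<^sub>N\<^sub>-\<^sub>1\<close> be anticommuting variables and \<open>e\<^sub>i\<^sub>j = a\<^sub>i b\<^sub>j + a\<^sub>j b\<^sub>i\<close>, \<open>e\<^sub>i\<^sub>i = a\<^sub>i b\<^sub>i\<close>. The
  determinant of \<open>X\<close> is the top coefficient of the exponential of the sum of the \<open>x\<^sub>i\<^sub>j e\<^sub>i\<^sub>j\<close>, so the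
  apolar algebra is the subalgebra generated by the \<open>e\<^sub>i\<^sub>j\<close> modulo the radical of the pairing ``top
  coefficient of the product''. The \<open>e\<^sub>i\<^sub>j\<close> are invariant under \<open>sl\<^sub>2\<close> acting on each pair \<open>(a\<^sub>i, b\<^sub>i)\<close>.
  One site contributes two trivial representations (in degrees \<open>0\<close> and \<open>1\<close>) and one doublet, so
  adding sites one at a time produces orthogonal invariants indexed by walks with two kinds of level
  steps. Their norms are products of \<open>h (h + 1)\<close> over the down steps from height \<open>h\<close>; in
  characteristic \<open>p\<close> the walks that reach height \<open>p - 1\<close> fall into the radical, and the remaining ones
  form a basis.
\<close>

section \<open>The Fock space and its form\<close>

text \<open>Representations of sl2 are not semisimple in characteristic p, so the word vectors are
  not claimed to span the invariants. What is proved instead is a Parseval identity: the form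
  between two invariants is computed by the words below the ceiling alone. Read modulo the radical,
  this identity is the spanning statement, while orthogonality with nonzero norms gives
  independence. A second obstacle is factorials. The exponential is written as a product over the
  rows of X, the word vectors are left unnormalised so that they exist over every commutative ring,
  and f(partial) D = 0 is tested on every coefficient, because recovering a coefficient from
  constant terms of further derivatives costs a division by factorials. The bridge between the two
  sides is \<open>Psi\<close>: pairing f(e) 1 with its coefficients reads off, up to sign, the
  coefficients of f(partial) D.\<close>

text \<open>
  A list of \<open>N\<close> sites encodes a monomial basis vector of the exterior algebra on
  \<open>a\<^sub>0, b\<^sub>0, \<dots>, a\<^sub>N\<^sub>-\<^sub>1, b\<^sub>N\<^sub>-\<^sub>1\<close>: a site is empty, carries \<open>a\<close> (\<open>Up\<close>), carries \<open>b\<close> (\<open>Dn\<close>), or carries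
  \<open>a b\<close> (\<open>Fu\<close>). The head of the list is the site of highest index, so that a site of index \<open>i\<close> is
  the one with a tail of length \<open>i\<close>.
\<close>

datatype site = Em | Up | Dn | Fu

type_synonym 'c fock = "site list \<Rightarrow> 'c"

fun parity_sign :: "site \<Rightarrow> 'c::comm_ring_1" where
  "parity_sign Em = 1" | "parity_sign Up = -1" | "parity_sign Dn = -1" | "parity_sign Fu = 1"

text \<open>
  \<open>opU\<close> and \<open>opD\<close> are left multiplication by \<open>a\<^sub>i\<close> and \<open>b\<^sub>i\<close>, with factors of higher index written
  first. \<open>opE\<close>, \<open>opF\<close>, \<open>opH\<close> are the \<open>sl\<^sub>2\<close> triple of derivations with \<open>E b\<^sub>i = a\<^sub>i\<close> and \<open>F a\<^sub>i = b\<^sub>i\<close>,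
  and \<open>weyl\<close> is the automorphism \<open>a\<^sub>i \<mapsto> - b\<^sub>i\<close>, \<open>b\<^sub>i \<mapsto> a\<^sub>i\<close>.
\<close>

fun opU :: "nat \<Rightarrow> nat \<Rightarrow> 'c::comm_ring_1 fock \<Rightarrow> 'c fock" where
  "opU 0 i f l = 0"
| "opU (Suc N) i f [] = 0"
| "opU (Suc N) i f (x # l) =
     (if i = N then (case x of Up \<Rightarrow> f (Em # l) | Fu \<Rightarrow> f (Dn # l) | _ \<Rightarrow> 0)
      else parity_sign x * opU N i (\<lambda>l. f (x # l)) l)"

fun opD :: "nat \<Rightarrow> nat \<Rightarrow> 'c::comm_ring_1 fock \<Rightarrow> 'c fock" where
  "opD 0 i f l = 0"
| "opD (Suc N) i f [] = 0"
| "opD (Suc N) i f (x # l) =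
     (if i = N then (case x of Dn \<Rightarrow> f (Em # l) | Fu \<Rightarrow> - f (Up # l) | _ \<Rightarrow> 0)
      else parity_sign x * opD N i (\<lambda>l. f (x # l)) l)"

fun opE :: "nat \<Rightarrow> 'c::comm_ring_1 fock \<Rightarrow> 'c fock" where
  "opE 0 f l = 0"
| "opE (Suc N) f [] = 0"
| "opE (Suc N) f (x # l) = opE N (\<lambda>l. f (x # l)) l + (if x = Up then f (Dn # l) else 0)"

fun opF :: "nat \<Rightarrow> 'c::comm_ring_1 fock \<Rightarrow> 'c fock" where
  "opF 0 f l = 0"
| "opF (Suc N) f [] = 0"
| "opF (Suc N) f (x # l) = opF N (\<lambda>l. f (x # l)) l + (if x = Dn then f (Up # l) else 0)"

fun opH :: "nat \<Rightarrow> 'c::comm_ring_1 fock \<Rightarrow> 'c fock" where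
  "opH 0 f l = 0"
| "opH (Suc N) f [] = 0"
| "opH (Suc N) f (x # l) = opH N (\<lambda>l. f (x # l)) l +
     (case x of Up \<Rightarrow> f (x # l) | Dn \<Rightarrow> - f (x # l) | _ \<Rightarrow> 0)"

fun weyl :: "nat \<Rightarrow> 'c::comm_ring_1 fock \<Rightarrow> 'c fock" where
  "weyl 0 f l = f l"
| "weyl (Suc N) f [] = 0"
| "weyl (Suc N) f (x # l) = (case x of Up \<Rightarrow> weyl N (\<lambda>l. f (Dn # l)) l
     | Dn \<Rightarrow> - weyl N (\<lambda>l. f (Up # l)) l | _ \<Rightarrow> weyl N (\<lambda>l. f (x # l)) l)"

text \<open>
  The sign of the second term is chosen so that \<open>a\<^sub>i\<close> and \<open>b\<^sub>i\<close> become selfadjoint for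
  \<open>form N f (weyl N g)\<close>, while \<open>E\<close> and \<open>F\<close> are adjoint to each other for \<open>form\<close> itself.
\<close>

fun form :: "nat \<Rightarrow> 'c::comm_ring_1 fock \<Rightarrow> 'c fock \<Rightarrow> 'c" where
  "form 0 f g = f [] * g []"
| "form (Suc N) f g =
     form N (\<lambda>l. f (Em # l)) (\<lambda>l. g (Fu # l)) - form N (\<lambda>l. f (Fu # l)) (\<lambda>l. g (Em # l)) +
     form N (\<lambda>l. f (Up # l)) (\<lambda>l. g (Up # l)) + form N (\<lambda>l. f (Dn # l)) (\<lambda>l. g (Dn # l))"

definition linop :: "('c::comm_ring_1 fock \<Rightarrow> 'c fock) \<Rightarrow> bool" where
  "linop T \<longleftrightarrow> (\<forall>f g l. T (\<lambda>l. f l + g l) l = T f l + T g l) \<and> (\<forall>c f l. T (\<lambda>l. c * f l) l = c * T f l)"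

lemma linopD:
  assumes "linop T"
  shows "T (\<lambda>l. f l + g l) = (\<lambda>l. T f l + T g l)" "T (\<lambda>l. c * f l) = (\<lambda>l. c * T f l)"
    "T (\<lambda>l. 0) = (\<lambda>l. 0)" "T (\<lambda>l. - f l) = (\<lambda>l. - T f l)" "T (\<lambda>l. f l - g l) = (\<lambda>l. T f l - T g l)"
    "T (\<lambda>l. \<Sum>j\<in>A. h j l) = (\<lambda>l. \<Sum>j\<in>A. T (h j) l)"
proof -
  show 1: "T (\<lambda>l. f l + g l) = (\<lambda>l. T f l + T g l)" for f g using assms by (auto simp: linop_def)
  show 2: "T (\<lambda>l. c * f l) = (\<lambda>l. c * T f l)" for c f using assms by (auto simp: linop_def)
  show 3: "T (\<lambda>l. 0) = (\<lambda>l. 0)" using 2[of 0 "\<lambda>l. 0"] by simp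
  show 4: "T (\<lambda>l. - f l) = (\<lambda>l. - T f l)" for f using 2[of "-1" f] by simp
  show "T (\<lambda>l. f l - g l) = (\<lambda>l. T f l - T g l)" using 1[of f "\<lambda>l. - g l"] 4[of g] by simp
  show "T (\<lambda>l. \<Sum>j\<in>A. h j l) = (\<lambda>l. \<Sum>j\<in>A. T (h j) l)"
    by (induction A rule: infinite_finite_induct) (simp_all add: 1 3)
qed

lemma linop_opU: "linop (opU N i)"
proof -
  have "opU N i (\<lambda>l. f l + g l) l = opU N i f l + opU N i g l" for f g :: "'a fock" and l
    by (induction N i f l arbitrary: g rule: opU.induct) (auto split: site.splits simp: ring_distribs)
  moreover have "opU N i (\<lambda>l. c * f l) l = c * opU N i f l" for c and f :: "'a fock" and l
    by (induction N i f l rule: opU.induct) (auto split: site.splits simp: ring_distribs ac_simps)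
  ultimately show ?thesis by (simp add: linop_def)
qed

lemma linop_opD: "linop (opD N i)"
proof -
  have "opD N i (\<lambda>l. f l + g l) l = opD N i f l + opD N i g l" for f g :: "'a fock" and l
    by (induction N i f l arbitrary: g rule: opD.induct) (auto split: site.splits simp: ring_distribs)
  moreover have "opD N i (\<lambda>l. c * f l) l = c * opD N i f l" for c and f :: "'a fock" and l
    by (induction N i f l rule: opD.induct) (auto split: site.splits simp: ring_distribs ac_simps)
  ultimately show ?thesis by (simp add: linop_def)
qed

lemma linop_opE: "linop (opE N)"
proof -
  have "opE N (\<lambda>l. f l + g l) l = opE N f l + opE N g l" for f g :: "'a fock" and l
    by (induction N f l arbitrary: g rule: opE.induct) (auto simp: ring_distribs)
  moreover have "opE N (\<lambda>l. c * f l) l = c * opE N f l" for c and f :: "'a fock" and l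
    by (induction N f l rule: opE.induct) (auto simp: ring_distribs ac_simps)
  ultimately show ?thesis by (simp add: linop_def)
qed

lemma linop_opF: "linop (opF N)"
proof -
  have "opF N (\<lambda>l. f l + g l) l = opF N f l + opF N g l" for f g :: "'a fock" and l
    by (induction N f l arbitrary: g rule: opF.induct) (auto simp: ring_distribs)
  moreover have "opF N (\<lambda>l. c * f l) l = c * opF N f l" for c and f :: "'a fock" and l
    by (induction N f l rule: opF.induct) (auto simp: ring_distribs ac_simps)
  ultimately show ?thesis by (simp add: linop_def)
qed

lemma linop_opH: "linop (opH N)"
proof -
  have "opH N (\<lambda>l. f l + g l) l = opH N f l + opH N g l" for f g :: "'a fock" and l
    by (induction N f l arbitrary: g rule: opH.induct) (auto split: site.splits simp: ring_distribs)
  moreover have "opH N (\<lambda>l. c * f l) l = c * opH N f l" for c and f :: "'a fock" and l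
    by (induction N f l rule: opH.induct) (auto split: site.splits simp: ring_distribs ac_simps)
  ultimately show ?thesis by (simp add: linop_def)
qed

lemma linop_weyl: "linop (weyl N)"
proof -
  have "weyl N (\<lambda>l. f l + g l) l = weyl N f l + weyl N g l" for f g :: "'a fock" and l
    by (induction N f l arbitrary: g rule: weyl.induct) (auto split: site.splits simp: ring_distribs)
  moreover have "weyl N (\<lambda>l. c * f l) l = c * weyl N f l" for c and f :: "'a fock" and l
    by (induction N f l rule: weyl.induct) (auto split: site.splits simp: ring_distribs ac_simps)
  ultimately show ?thesis by (simp add: linop_def)
qed

lemmas linop_simps = linopD[OF linop_opU] linopD[OF linop_opD] linopD[OF linop_opE] linopD[OF linop_opF]
  linopD[OF linop_opH] linopD[OF linop_weyl]

lemma form_add_left: "form N (\<lambda>l. f l + g l) h = form N f h + form N g h"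
  by (induction N arbitrary: f g h) (auto simp: algebra_simps)

lemma form_scale_left: "form N (\<lambda>l. c * f l) h = c * form N f h"
  by (induction N arbitrary: f h) (auto simp: algebra_simps)

lemma form_add_right: "form N h (\<lambda>l. f l + g l) = form N h f + form N h g"
  by (induction N arbitrary: f g h) (auto simp: algebra_simps)

lemma form_scale_right: "form N h (\<lambda>l. c * f l) = c * form N h f"
  by (induction N arbitrary: f h) (auto simp: algebra_simps)

lemma form_simps:
  "form N (\<lambda>l. 0) h = 0" "form N h (\<lambda>l. 0) = 0"
  "form N (\<lambda>l. - f l) h = - form N f h" "form N h (\<lambda>l. - f l) = - form N h f"
  "form N (\<lambda>l. f l - g l) h = form N f h - form N g h"
  "form N h (\<lambda>l. f l - g l) = form N h f - form N h g"
  "form N (\<lambda>l. \<Sum>j\<in>A. k j l) h = (\<Sum>j\<in>A. form N (k j) h)"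
  "form N h (\<lambda>l. \<Sum>j\<in>A. k j l) = (\<Sum>j\<in>A. form N h (k j))"
proof -
  show 1: "form N (\<lambda>l. 0) h = 0" using form_scale_left[of N 0 "\<lambda>_. 0" h] by simp
  show 2: "form N h (\<lambda>l. 0) = 0" using form_scale_right[of N h 0 "\<lambda>_. 0"] by simp
  show 3: "form N (\<lambda>l. - f l) h = - form N f h" for f using form_scale_left[of N "-1" f h] by simp
  show 4: "form N h (\<lambda>l. - f l) = - form N h f" for f using form_scale_right[of N h "-1" f] by simp
  show "form N (\<lambda>l. f l - g l) h = form N f h - form N g h"
    using form_add_left[of N f "\<lambda>l. - g l" h] 3[of g] by simp
  show "form N h (\<lambda>l. f l - g l) = form N h f - form N h g"
    using form_add_right[of N h f "\<lambda>l. - g l"] 4[of g] by simp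
  show "form N (\<lambda>l. \<Sum>j\<in>A. k j l) h = (\<Sum>j\<in>A. form N (k j) h)"
    by (induction A rule: infinite_finite_induct) (simp_all add: 1 form_add_left)
  show "form N h (\<lambda>l. \<Sum>j\<in>A. k j l) = (\<Sum>j\<in>A. form N h (k j))"
    by (induction A rule: infinite_finite_induct) (simp_all add: 2 form_add_right)
qed

lemmas form_lin = form_add_left form_add_right form_scale_left form_scale_right form_simps

section \<open>Anticommutation relations and sl2 relations\<close>

lemma opU_opU: "opU N i (opU N j f) l = - opU N j (opU N i f) l"
proof (induction N arbitrary: f l)
  case (Suc N)
  show ?case
  proof (cases l)
    case (Cons x m)
    then show ?thesis
      by (cases x; cases "i = N"; cases "j = N") (auto simp: linop_simps Suc.IH[of "\<lambda>l. f (_ # l)"])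
  qed auto
qed auto

lemma opD_opD: "opD N i (opD N j f) l = - opD N j (opD N i f) l"
proof (induction N arbitrary: f l)
  case (Suc N)
  show ?case
  proof (cases l)
    case (Cons x m)
    then show ?thesis
      by (cases x; cases "i = N"; cases "j = N") (auto simp: linop_simps Suc.IH[of "\<lambda>l. f (_ # l)"])
  qed auto
qed auto

lemma opU_opD: "opU N i (opD N j f) l = - opD N j (opU N i f) l"
proof (induction N arbitrary: f l)
  case (Suc N)
  show ?case
  proof (cases l)
    case (Cons x m)
    then show ?thesis
      by (cases x; cases "i = N"; cases "j = N") (auto simp: linop_simps Suc.IH[of "\<lambda>l. f (_ # l)"])
  qed auto
qed auto

lemma opU_sq: "opU N i (opU N i f) l = 0"
proof (induction N arbitrary: f l)
  case (Suc N)
  show ?case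
  proof (cases l)
    case (Cons x m)
    then show ?thesis
      by (cases x; cases "i = N") (auto simp: linop_simps Suc.IH[of "\<lambda>l. f (_ # l)"])
  qed auto
qed auto

lemma opD_sq: "opD N i (opD N i f) l = 0"
proof (induction N arbitrary: f l)
  case (Suc N)
  show ?case
  proof (cases l)
    case (Cons x m)
    then show ?thesis
      by (cases x; cases "i = N") (auto simp: linop_simps Suc.IH[of "\<lambda>l. f (_ # l)"])
  qed auto
qed auto

lemma opE_opU: "opE N (opU N i f) l = opU N i (opE N f) l"
proof (induction N arbitrary: f l)
  case (Suc N)
  show ?case
  proof (cases l)
    case (Cons x m)
    then show ?thesis
      by (cases x; cases "i = N") (auto simp: linop_simps Suc.IH[of "\<lambda>l. f (_ # l)"])
  qed auto
qed auto

lemma opE_opD: "opE N (opD N i f) l = opD N i (opE N f) l + opU N i f l"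
proof (induction N arbitrary: f l)
  case (Suc N)
  show ?case
  proof (cases l)
    case (Cons x m)
    then show ?thesis
      by (cases x; cases "i = N") (auto simp: linop_simps Suc.IH[of "\<lambda>l. f (_ # l)"] algebra_simps)
  qed auto
qed auto

lemma opF_opD: "opF N (opD N i f) l = opD N i (opF N f) l"
proof (induction N arbitrary: f l)
  case (Suc N)
  show ?case
  proof (cases l)
    case (Cons x m)
    then show ?thesis
      by (cases x; cases "i = N") (auto simp: linop_simps Suc.IH[of "\<lambda>l. f (_ # l)"])
  qed auto
qed auto

lemma opF_opU: "opF N (opU N i f) l = opU N i (opF N f) l + opD N i f l"
proof (induction N arbitrary: f l)
  case (Suc N)
  show ?case
  proof (cases l)
    case (Cons x m)
    then show ?thesis
      by (cases x; cases "i = N") (auto simp: linop_simps Suc.IH[of "\<lambda>l. f (_ # l)"] algebra_simps)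
  qed auto
qed auto

lemma opE_opF: "opE N (opF N f) l = opF N (opE N f) l + opH N f l"
proof (induction N arbitrary: f l)
  case (Suc N)
  show ?case
  proof (cases l)
    case (Cons x m)
    then show ?thesis
      by (cases x) (auto simp: linop_simps Suc.IH[of "\<lambda>l. f (_ # l)"] algebra_simps)
  qed auto
qed auto

lemma opH_opF: "opH N (opF N f) l = opF N (opH N f) l - 2 * opF N f l"
proof (induction N arbitrary: f l)
  case (Suc N)
  show ?case
  proof (cases l)
    case (Cons x m)
    then show ?thesis
      by (cases x) (auto simp: linop_simps Suc.IH[of "\<lambda>l. f (_ # l)"] algebra_simps)
  qed auto
qed auto

lemma weyl_opU: "weyl N (opU N i f) l = - opD N i (weyl N f) l"
proof (induction N arbitrary: f l)
  case (Suc N)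
  show ?case
  proof (cases l)
    case (Cons x m)
    then show ?thesis
      by (cases x; cases "i = N") (auto simp: linop_simps Suc.IH[of "\<lambda>l. f (_ # l)"])
  qed auto
qed auto

lemma weyl_opD: "weyl N (opD N i f) l = opU N i (weyl N f) l"
proof (induction N arbitrary: f l)
  case (Suc N)
  show ?case
  proof (cases l)
    case (Cons x m)
    then show ?thesis
      by (cases x; cases "i = N") (auto simp: linop_simps Suc.IH[of "\<lambda>l. f (_ # l)"])
  qed auto
qed auto

section \<open>Adjoints for the form\<close>

lemma form_opE: "form N (opE N f) g = form N f (opF N g)"
  by (induction N arbitrary: f g) (auto simp: form_lin algebra_simps)

lemma form_opF: "form N (opF N f) g = form N f (opE N g)"
  by (induction N arbitrary: f g) (auto simp: form_lin algebra_simps)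

lemma form_weyl: "form N (weyl N f) (weyl N g) = form N f g"
  by (induction N arbitrary: f g) (auto simp: form_lin algebra_simps)

lemma form_weyl_opU: "form N (opU N i f) (weyl N g) = form N f (weyl N (opU N i g))"
proof (induction N arbitrary: f g)
  case (Suc N)
  then show ?case
    by (cases "i = N") (simp_all add: form_lin linop_simps)
qed simp

lemma form_weyl_opD: "form N (opD N i f) (weyl N g) = form N f (weyl N (opD N i g))"
proof (induction N arbitrary: f g)
  case (Suc N)
  then show ?case
    by (cases "i = N") (simp_all add: form_lin linop_simps)
qed simp

section \<open>Words and the Parseval identity\<close>

text \<open>
  The letters of a word are reused as steps: \<open>Em\<close> and \<open>Fu\<close> are level, \<open>Up\<close> and \<open>Dn\<close> change the
  height, and the first step of the walk is the last letter. A word of height \<open>h\<close> yields a highest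
  weight vector of weight \<open>h\<close>.
\<close>

fun height :: "site list \<Rightarrow> int" where
  "height [] = 0"
| "height (x # w) = height w + (case x of Up \<Rightarrow> 1 | Dn \<Rightarrow> -1 | _ \<Rightarrow> 0)"

text \<open>For v of weight h, the letter \<open>Dn\<close> stands for a F v - h b v. This is the
  highest weight vector of weight h - 1 in the product with the doublet: E maps a F v to h a v and b
  v to a v. Clearing the denominator h keeps the vector integral.\<close>

fun word_vec :: "site list \<Rightarrow> 'c::comm_ring_1 fock" where
  "word_vec [] l = (if l = [] then 1 else 0)"
| "word_vec (s # w) [] = 0"
| "word_vec (s # w) (x # l) = (if s = Dn
     then (case x of Up \<Rightarrow> opF (length w) (word_vec w) l | Dn \<Rightarrow> - of_int (height w) * word_vec w l | _ \<Rightarrow> 0)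
     else if x = s then word_vec w l else 0)"

text \<open>The value p = 0 means no ceiling. For p at least 2 the whole walk stays at heights up to
  p - 2, the range in which the norm factor h (h + 1) of a down step is invertible.\<close>

fun words :: "nat \<Rightarrow> nat \<Rightarrow> nat \<Rightarrow> site list set" where
  "words p 0 h = (if h = 0 then {[]} else {})"
| "words p (Suc N) h = (if p = 0 \<or> h + 2 \<le> p
     then (#) Em ` words p N h \<union> (#) Fu ` words p N h \<union>
       (case h of 0 \<Rightarrow> {} | Suc k \<Rightarrow> (#) Up ` words p N k) \<union> (#) Dn ` words p N (Suc h)
     else {})"

text \<open>The form couples an empty site with a full one, so the partner of a word under the form
  has its two kinds of level letters interchanged.\<close>

fun dual_site :: "site \<Rightarrow> site" where
  "dual_site Em = Fu" | "dual_site Fu = Em" | "dual_site Up = Up" | "dual_site Dn = Dn"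

abbreviation dual :: "site list \<Rightarrow> site list" where "dual \<equiv> map dual_site"

text \<open>The sign at \<open>Fu\<close> is the one in \<open>form\<close>. At \<open>Dn\<close>
  the two components of a F v - h b v contribute h, by adjointness and E F = h, and h^2, which add
  up to h (h + 1).\<close>

fun word_norm :: "site list \<Rightarrow> 'c::comm_ring_1" where
  "word_norm [] = 1"
| "word_norm (x # w) = (case x of Fu \<Rightarrow> - 1 | Dn \<Rightarrow> of_int (height w * (height w + 1)) | _ \<Rightarrow> 1) * word_norm w"

lemma finite_words [simp]: "finite (words p N h)"
  by (induction N arbitrary: h) (auto split: nat.splits)

lemma words_props:
  assumes "w \<in> words p N h"
  shows "length w = N" "height w = int h"
  using assms by (induction N arbitrary: h w) (force split: nat.splits if_splits)+

lemma words_height: "w \<in> words p N h \<Longrightarrow> p \<noteq> 1 \<Longrightarrow> p = 0 \<or> h + 2 \<le> p"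
  by (cases N) (auto split: if_splits)

lemma dual_words: "w \<in> words p N h \<Longrightarrow> dual w \<in> words p N h"
  by (induction N arbitrary: h w) (auto split: nat.splits if_splits)

lemma height_dual [simp]: "height (dual w) = height w"
proof (induction w)
  case (Cons x w) then show ?case by (cases x) auto
qed simp

lemma sum_words_Suc:
  assumes "p = 0 \<or> h + 2 \<le> p"
  shows "sum g (words p (Suc N) h) = (\<Sum>w\<in>words p N h. g (Em # w)) + (\<Sum>w\<in>words p N h. g (Fu # w)) +
    (case h of 0 \<Rightarrow> 0 | Suc k \<Rightarrow> \<Sum>w\<in>words p N k. g (Up # w)) + (\<Sum>w\<in>words p N (Suc h). g (Dn # w))"
proof -
  have "words p (Suc N) h = (#) Em ` words p N h \<union> (#) Fu ` words p N h \<union>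
       (case h of 0 \<Rightarrow> {} | Suc k \<Rightarrow> (#) Up ` words p N k) \<union> (#) Dn ` words p N (Suc h)"
    using assms by simp
  moreover have "sum g \<dots> = sum g ((#) Em ` words p N h) + sum g ((#) Fu ` words p N h) +
       sum g (case h of 0 \<Rightarrow> {} | Suc k \<Rightarrow> (#) Up ` words p N k) + sum g ((#) Dn ` words p N (Suc h))"
    by (subst sum.union_disjoint, auto split: nat.splits)+
  moreover have "sum g ((#) a ` A) = (\<Sum>w\<in>A. g (a # w))" for a A
    by (subst sum.reindex) auto
  ultimately show ?thesis by (simp split: nat.splits)
qed

text \<open>The equation for \<open>opH\<close> sees h only modulo the characteristic. The
  nilpotency condition on F records the true integer; in the branching step it forces the lower
  component to vanish when h = 0.\<close>

definition highest_weight :: "nat \<Rightarrow> nat \<Rightarrow> 'c::comm_ring_1 fock \<Rightarrow> bool" where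
  "highest_weight N h x \<longleftrightarrow> opE N x = (\<lambda>l. 0) \<and> opH N x = (\<lambda>l. of_nat h * x l) \<and> (opF N ^^ Suc h) x = (\<lambda>l. 0)"

lemma word_vec_highest_weight:
  assumes "w \<in> words p N h"
  shows "opE N (word_vec w :: 'c::comm_ring_1 fock) l = 0"
    and "opH N (word_vec w :: 'c fock) l = of_nat h * word_vec w l"
proof -
  have "opE N (word_vec w :: 'c::comm_ring_1 fock) l = 0 \<and>
        opH N (word_vec w :: 'c fock) l = of_nat h * word_vec w l"
    using assms
  proof (induction N arbitrary: h w l)
    case (Suc N)
    show ?case
    proof (cases l)
      case Nil
      with Suc.prems show ?thesis by (cases w) (auto split: if_splits nat.splits)
    next
      case (Cons x m)
      have IH1: "opE N (word_vec v :: 'c fock) = (\<lambda>l. 0)" if "v \<in> words p N k" for v k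
        using Suc.IH[OF that] by auto
      have IH2: "opH N (word_vec v :: 'c fock) = (\<lambda>l. of_nat k * word_vec v l)" if "v \<in> words p N k" for v k
        using Suc.IH[OF that] by auto
      have IH3: "opE N (opF N (word_vec v :: 'c fock)) l = of_nat k * word_vec v l" if "v \<in> words p N k" for v k l
        by (simp add: opE_opF IH1[OF that] IH2[OF that] linop_simps)
      have IH4: "opH N (opF N (word_vec v :: 'c fock)) l = (of_nat k - 2) * opF N (word_vec v) l" if "v \<in> words p N k" for v k l
        by (simp add: opH_opF IH1[OF that] IH2[OF that] linop_simps algebra_simps)
      from Suc.prems consider (e) v where "w = Em # v" "v \<in> words p N h"
        | (f) v where "w = Fu # v" "v \<in> words p N h"
        | (u) v k where "h = Suc k" "w = Up # v" "v \<in> words p N k"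
        | (d) v where "w = Dn # v" "v \<in> words p N (Suc h)"
        by (auto split: if_splits nat.splits)
      then show ?thesis
      proof cases
        case e
        then show ?thesis using Cons by (cases x) (auto simp: linop_simps IH1 IH2)
      next
        case f
        then show ?thesis using Cons by (cases x) (auto simp: linop_simps IH1 IH2)
      next
        case u
        then show ?thesis using Cons by (cases x) (auto simp: linop_simps IH1 IH2 algebra_simps)
      next
        case d
        then show ?thesis using Cons words_props[OF d(2)]
          by (cases x) (auto simp: linop_simps IH1[OF d(2)] IH2[OF d(2)] IH3[OF d(2)] IH4[OF d(2)] algebra_simps)
      qed
    qed
  qed (auto split: if_splits)
  then show "opE N (word_vec w :: 'c::comm_ring_1 fock) l = 0"
    and "opH N (word_vec w :: 'c fock) l = of_nat h * word_vec w l" by auto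
qed

text \<open>Different first letters are orthogonal: a level letter meets only the complementary
  site, and \<open>Up\<close> against \<open>Dn\<close> gives a pairing of v with F w, which equals
  that of E v = 0 with w. Equal letters reduce to the tails.\<close>

lemma form_word_vec:
  assumes "v \<in> words p N h" "w \<in> words p N h"
  shows "form N (word_vec v) (word_vec (dual w)) = (if v = w then word_norm v else (0::'c::comm_ring_1))"
  using assms
proof (induction N arbitrary: h v w)
  case (Suc N)
  have E: "opE N (word_vec u :: 'c fock) = (\<lambda>l. 0)"  if "u \<in> words p N k" for u k
    using word_vec_highest_weight[OF that] by auto
  have H: "opH N (word_vec u :: 'c fock) = (\<lambda>l. of_nat k * word_vec u l)"  if "u \<in> words p N k" for u k
    using word_vec_highest_weight[OF that] by auto
  have EF: "opE N (opF N (word_vec u :: 'c fock)) = (\<lambda>l. of_nat k * word_vec u l)"  if "u \<in> words p N k" for u k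
    by (rule ext) (simp add: opE_opF E[OF that] H[OF that] linop_simps)
  note dE = E[OF dual_words] and dlen = words_props[OF dual_words]
  have cases: "(\<exists>v. w = Em # v \<and> v \<in> words p N h) \<or> (\<exists>v. w = Fu # v \<and> v \<in> words p N h) \<or>
     (\<exists>v k. h = Suc k \<and> w = Up # v \<and> v \<in> words p N k) \<or> (\<exists>v. w = Dn # v \<and> v \<in> words p N (Suc h))"
    if "w \<in> words p (Suc N) h" for w
    using that by (auto split: if_splits nat.splits)
  show ?case
    using cases[OF Suc.prems(1)] cases[OF Suc.prems(2)]
    by (elim disjE exE conjE; simp)
       (simp_all add: form_lin words_props dlen Suc.IH form_opE[symmetric] form_opF E dE EF algebra_simps)
qed (auto split: if_splits)

text \<open>The tail after a \<open>Dn\<close> ends at some height h + 1, at most p - 2 by the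
  ceiling, so both norm factors h + 1 and h + 2 lie strictly between 0 and p.\<close>

lemma word_norm_nonzero:
  assumes "w \<in> words CHAR('k::field) N h"
  shows "word_norm w \<noteq> (0::'k)"
  using assms
proof (induction N arbitrary: h w)
  case (Suc N)
  have d: "word_norm (Dn # v) \<noteq> (0::'k)" if v: "v \<in> words CHAR('k) N (Suc h)" for v
  proof -
    have b: "CHAR('k) = 0 \<or> Suc h + 2 \<le> CHAR('k)"
      using words_height[OF v] CHAR_not_1' by auto
    have "\<not> CHAR('k) dvd Suc h" "\<not> CHAR('k) dvd h + 2"
      using b by (auto dest: dvd_imp_le)
    then have "of_nat (Suc h) \<noteq> (0::'k)" "of_nat (h + 2) \<noteq> (0::'k)"
      by (simp_all only: of_nat_eq_0_iff_char_dvd) auto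
    moreover have "word_norm (Dn # v) = of_nat (Suc h) * of_nat (h + 2) * (word_norm v :: 'k)"
      using words_props[OF v] by (simp add: algebra_simps)
    ultimately show ?thesis using Suc.IH[OF v] by (simp only: mult_eq_0_iff) simp
  qed
  show ?case using Suc.prems Suc.IH d by (auto split: if_splits nat.splits simp del: word_norm.simps(2)) (auto)
qed (auto split: if_splits)

lemma funpow_opF:
  "(\<lambda>l. (opF (Suc N) ^^ n) x (Em # l)) = (opF N ^^ n) (\<lambda>l. x (Em # l))"
  "(\<lambda>l. (opF (Suc N) ^^ n) x (Fu # l)) = (opF N ^^ n) (\<lambda>l. x (Fu # l))"
  "(\<lambda>l. (opF (Suc N) ^^ n) x (Up # l)) = (opF N ^^ n) (\<lambda>l. x (Up # l))"
  by (induction n) auto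

text \<open>Leibniz rule for F acting on the last site and on the rest. On a single site F squares
  to zero, so only two terms of the binomial expansion survive.\<close>

lemma funpow_opF_Dn:
  "(\<lambda>l. (opF (Suc N) ^^ Suc n) x (Dn # l)) =
    (\<lambda>l. (opF N ^^ Suc n) (\<lambda>l. x (Dn # l)) l + of_nat (Suc n) * (opF N ^^ n) (\<lambda>l. x (Up # l)) l)"
proof (induction n)
  case (Suc n)
  have "(\<lambda>l. (opF (Suc N) ^^ Suc (Suc n)) x (Dn # l)) =
    (\<lambda>l. opF N (\<lambda>l. (opF (Suc N) ^^ Suc n) x (Dn # l)) l + (\<lambda>l. (opF (Suc N) ^^ Suc n) x (Up # l)) l)"
    by simp
  also have "(\<lambda>l. (opF (Suc N) ^^ Suc n) x (Up # l)) = (opF N ^^ Suc n) (\<lambda>l. x (Up # l))"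
    by (rule funpow_opF)
  also have "(\<lambda>l. opF N (\<lambda>l. (opF (Suc N) ^^ Suc n) x (Dn # l)) l + (opF N ^^ Suc n) (\<lambda>l. x (Up # l)) l)
      = (\<lambda>l. (opF N ^^ Suc (Suc n)) (\<lambda>l. x (Dn # l)) l + of_nat (Suc (Suc n)) * (opF N ^^ Suc n) (\<lambda>l. x (Up # l)) l)"
    unfolding Suc.IH by (simp add: linop_simps algebra_simps)
  finally show ?case .
qed simp

lemma linop_funpow: "linop T \<Longrightarrow> linop (T ^^ n)"
proof (induction n)
  case 0 then show ?case by (simp add: linop_def)
next
  case (Suc n)
  then show ?case unfolding linop_def by (simp add: linopD[OF Suc.IH[OF Suc.prems]] linopD[OF Suc.prems])
qed

text \<open>
  The branching rule for one more site. It needs only that \<open>h + 1\<close> is invertible, because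
  \<open>E F = h + 1\<close> on the component of weight \<open>h + 1\<close>.
\<close>

lemma highest_weight_step:
  fixes x :: "'k::field fock"
  assumes "highest_weight (Suc N) h x" and nz: "of_nat (Suc h) \<noteq> (0::'k)"
  defines "xu \<equiv> (\<lambda>l. x (Up # l) + opF N (\<lambda>l. x (Dn # l)) l / of_nat (Suc h))"
  shows "highest_weight N h (\<lambda>l. x (Em # l))" "highest_weight N h (\<lambda>l. x (Fu # l))" "highest_weight N (Suc h) (\<lambda>l. x (Dn # l))"
    "h = 0 \<Longrightarrow> xu = (\<lambda>l. 0)" "h = Suc k \<Longrightarrow> highest_weight N k xu"
    "opE N (\<lambda>l. x (Up # l)) = (\<lambda>l. - x (Dn # l))"
proof -
  have E: "opE (Suc N) x (s # l) = 0" for s l using assms by (simp add: highest_weight_def)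
  have H: "opH (Suc N) x (s # l) = of_nat h * x (s # l)" for s l using assms by (simp add: highest_weight_def)
  have F: "(\<lambda>l. (opF (Suc N) ^^ Suc h) x (s # l)) = (\<lambda>l. 0)" for s using assms by (simp add: highest_weight_def)
  have EEm: "opE N (\<lambda>l. x (Em # l)) = (\<lambda>l. 0)" using E[of Em] by (auto simp: fun_eq_iff)
  have EFu: "opE N (\<lambda>l. x (Fu # l)) = (\<lambda>l. 0)" using E[of Fu] by (auto simp: fun_eq_iff)
  have EDn: "opE N (\<lambda>l. x (Dn # l)) = (\<lambda>l. 0)" using E[of Dn] by (auto simp: fun_eq_iff)
  show EUp: "opE N (\<lambda>l. x (Up # l)) = (\<lambda>l. - x (Dn # l))"
    using E[of Up] by (auto simp: fun_eq_iff eq_neg_iff_add_eq_0)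
  have HEm: "opH N (\<lambda>l. x (Em # l)) = (\<lambda>l. of_nat h * x (Em # l))" using H[of Em] by (auto simp: fun_eq_iff)
  have HFu: "opH N (\<lambda>l. x (Fu # l)) = (\<lambda>l. of_nat h * x (Fu # l))" using H[of Fu] by (auto simp: fun_eq_iff)
  have HDn: "opH N (\<lambda>l. x (Dn # l)) = (\<lambda>l. of_nat (Suc h) * x (Dn # l))"
    using H[of Dn] by (auto simp: fun_eq_iff algebra_simps)
  have HUp: "opH N (\<lambda>l. x (Up # l)) = (\<lambda>l. (of_nat h - 1) * x (Up # l))"
    using H[of Up] by (auto simp: fun_eq_iff algebra_simps eq_diff_eq)
  note F3 = F[of Em, unfolded funpow_opF] F[of Fu, unfolded funpow_opF]
  note FDn = F[of Dn, unfolded funpow_opF_Dn]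
  have FUp: "(opF N ^^ Suc h) (\<lambda>l. x (Up # l)) = (\<lambda>l. 0)" using F[of Up, unfolded funpow_opF] .
  \<comment> \<open>The Leibniz form of F^(h+1) x = 0 is used twice: one further F gives the
    nilpotency of the \<open>Dn\<close> component, and dividing it by h + 1 gives F^h applied to
    \<open>xu\<close> equal to zero.\<close>
  have "(opF N ^^ Suc h) (\<lambda>l. x (Dn # l)) = (\<lambda>l. - of_nat (Suc h) * (opF N ^^ h) (\<lambda>l. x (Up # l)) l)"
    using fun_cong[OF FDn] by (simp only: fun_eq_iff eq_neg_iff_add_eq_0 mult_minus_left) simp
  then have "(opF N ^^ Suc (Suc h)) (\<lambda>l. x (Dn # l)) = opF N (\<lambda>l. - of_nat (Suc h) * (opF N ^^ h) (\<lambda>l. x (Up # l)) l)"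
    by simp
  also have "\<dots> = (\<lambda>l. 0)" using FUp by (simp only: linop_simps) simp
  finally have FDn': "(opF N ^^ Suc (Suc h)) (\<lambda>l. x (Dn # l)) = (\<lambda>l. 0)" .
  show "highest_weight N h (\<lambda>l. x (Em # l))" "highest_weight N h (\<lambda>l. x (Fu # l))" "highest_weight N (Suc h) (\<lambda>l. x (Dn # l))"
    using F3 FDn' by (simp_all add: highest_weight_def EEm EFu EDn HEm HFu HDn)
  \<comment> \<open>E sends the \<open>Up\<close> component to minus the \<open>Dn\<close>
    component, and E F = h + 1 on the latter. The correction with coefficient 1 / (h + 1) is
    therefore the one that makes \<open>xu\<close> a vector killed by E.\<close>
  have xu: "xu = (\<lambda>l. x (Up # l) + inverse (of_nat (Suc h)) * opF N (\<lambda>l. x (Dn # l)) l)"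
    by (simp add: xu_def field_simps)
  have Fxu: "(opF N ^^ h) xu = (\<lambda>l. 0)"
  proof
    fix l
    have "(opF N ^^ h) xu l = (opF N ^^ h) (\<lambda>l. x (Up # l)) l + inverse (of_nat (Suc h)) * (opF N ^^ Suc h) (\<lambda>l. x (Dn # l)) l"
      unfolding xu by (simp only: linopD[OF linop_funpow[OF linop_opF]] funpow_swap1 funpow.simps comp_def)
    also have "\<dots> = 0" using fun_cong[OF FDn, of l] nz
      by (simp add: field_simps del: of_nat_Suc funpow.simps)
    finally show "(opF N ^^ h) xu l = 0" .
  qed
  show "xu = (\<lambda>l. 0)" if "h = 0" using Fxu that by simp
  show "highest_weight N k xu" if k: "h = Suc k"
  proof -
    have "opE N xu l = 0" for l
      unfolding xu using nz by (simp add: linop_simps opE_opF EDn HDn EUp del: of_nat_Suc)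
    moreover have "opH N xu l = of_nat k * xu l" for l
      unfolding xu by (simp add: linop_simps opH_opF HDn HUp k algebra_simps)
    ultimately show ?thesis unfolding highest_weight_def using Fxu k by auto
  qed
qed

text \<open>
  A down step from height \<open>h + 1\<close> contributes \<open>(h + 1) (h + 2)\<close> to the norm. When \<open>h + 2\<close> is the
  characteristic this vanishes, and the words that go higher drop out of the identity.
\<close>

lemma parseval:
  fixes x y :: "'k::field fock"
  assumes "highest_weight N h x" "highest_weight N h y" "CHAR('k) = 0 \<or> h + 2 \<le> CHAR('k)"
  shows "form N x y = (\<Sum>w\<in>words CHAR('k) N h.
    form N x (word_vec (dual w)) * form N (word_vec w) y / word_norm w)"
  using assms
proof (induction N arbitrary: h x y)
  case 0
  show ?case
  proof (cases "h = 0")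
    case False
    have "\<not> CHAR('k) dvd h" using 0(3) False by (auto dest: dvd_imp_le)
    then have "of_nat h \<noteq> (0::'k)" by (simp add: of_nat_eq_0_iff_char_dvd)
    moreover have "of_nat h * x [] = 0" using 0(1) by (auto simp: highest_weight_def fun_eq_iff)
    ultimately show ?thesis using False by simp
  qed simp
next
  case (Suc N)
  let ?c = "of_nat (Suc h) :: 'k"
  have "\<not> CHAR('k) dvd Suc h" using Suc.prems(3) by (auto dest: dvd_imp_le)
  then have nz: "?c \<noteq> 0" by (simp only: of_nat_eq_0_iff_char_dvd) simp
  note sx = highest_weight_step[OF Suc.prems(1) nz] and sy = highest_weight_step[OF Suc.prems(2) nz]
  define x0 xt xa xb where x: "x0 = (\<lambda>l. x (Em # l))" "xt = (\<lambda>l. x (Fu # l))"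
    "xa = (\<lambda>l. x (Up # l))" "xb = (\<lambda>l. x (Dn # l))"
  define y0 yt ya yb where y: "y0 = (\<lambda>l. y (Em # l))" "yt = (\<lambda>l. y (Fu # l))"
    "ya = (\<lambda>l. y (Up # l))" "yb = (\<lambda>l. y (Dn # l))"
  define xu where "xu = (\<lambda>l. xa l + inverse ?c * opF N xb l)"
  define yu where "yu = (\<lambda>l. ya l + inverse ?c * opF N yb l)"
  have xu': "xu = (\<lambda>l. x (Up # l) + opF N (\<lambda>l. x (Dn # l)) l / ?c)"
    by (auto simp: xu_def x field_simps fun_eq_iff)
  have yu': "yu = (\<lambda>l. y (Up # l) + opF N (\<lambda>l. y (Dn # l)) l / ?c)"
    by (auto simp: yu_def y field_simps fun_eq_iff)
  note sx = sx[folded x xu'] and sy = sy[folded y yu']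
  have Exa: "opE N xa = (\<lambda>l. - xb l)" using sx(6) by (simp add: x)
  have Eya: "opE N ya = (\<lambda>l. - yb l)" using sy(6) by (simp add: y)
  have Exb: "opE N xb = (\<lambda>l. 0)" "opH N xb = (\<lambda>l. ?c * xb l)" using sx(3) by (simp_all add: highest_weight_def)
  have Eyb: "opE N yb = (\<lambda>l. 0)" "opH N yb = (\<lambda>l. ?c * yb l)" using sy(3) by (simp_all add: highest_weight_def)
  let ?W = "words CHAR('k)"
  define t where "t w = form (Suc N) x (word_vec (dual w)) * form (Suc N) (word_vec w) y / word_norm w" for w
  define b where "b = form N xb yb"
  have E: "opE N (word_vec u :: 'k fock) = (\<lambda>l. 0)"  if "u \<in> ?W N k" for u k
    using word_vec_highest_weight[OF that] by auto
  have "(\<Sum>w\<in>?W N h. t (Em # w)) = form N x0 yt"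
    unfolding Suc.IH[OF sx(1) sy(2) Suc.prems(3)]
    by (rule sum.cong) (simp_all add: t_def x y form_lin)
  moreover have "(\<Sum>w\<in>?W N h. t (Fu # w)) = - form N xt y0"
    unfolding Suc.IH[OF sx(2) sy(1) Suc.prems(3)] sum_negf[symmetric]
    by (rule sum.cong) (simp_all add: t_def x y form_lin)
  \<comment> \<open>Words starting with \<open>Up\<close> see only the corrected components
    \<open>xu\<close> and \<open>yu\<close>. Their pairing falls short of that of \<open>xa\<close>
    and \<open>ya\<close> by b / (h + 1), which the \<open>Dn\<close> words have to supply in
    addition to b itself.\<close>
  moreover have "(case h of 0 \<Rightarrow> 0 | Suc k \<Rightarrow> \<Sum>w\<in>?W N k. t (Up # w)) = form N xa ya - b / ?c"
  proof -
    have "form N xu yu = form N xa ya + inverse ?c * form N xa (opF N yb) +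
        inverse ?c * form N (opF N xb) ya + inverse ?c * inverse ?c * form N (opF N xb) (opF N yb)"
      unfolding xu_def yu_def form_lin by (simp add: algebra_simps)
    also have "form N xa (opF N yb) = - b"
      by (simp add: form_opE[symmetric] Exa form_lin b_def)
    also have "form N (opF N xb) ya = - b"
      by (simp add: form_opF Eya form_lin b_def)
    also have "form N (opF N xb) (opF N yb) = ?c * b"
      by (simp add: form_opF form_lin b_def opE_opF[abs_def] Eyb linop_simps del: of_nat_Suc)
    finally have u: "form N xu yu = form N xa ya - b / ?c"
    proof -
      assume a: "form N xu yu = form N xa ya + inverse ?c * - b + inverse ?c * - b + inverse ?c * inverse ?c * (?c * b)"
      have "inverse ?c * inverse ?c * (?c * b) = inverse ?c * b" using nz by simp
      then show ?thesis unfolding a by (simp add: divide_inverse)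
    qed
    show ?thesis
    proof (cases h)
      case 0
      then show ?thesis using u sx(4) by (simp add: form_lin)
    next
      case (Suc k)
      have "(\<Sum>w\<in>?W N k. t (Up # w)) = form N xu yu"
        unfolding Suc.IH[OF sx(5)[OF Suc] sy(5)[OF Suc]]
      proof (subst Suc.IH[OF sx(5)[OF Suc] sy(5)[OF Suc]])
        show "CHAR('k) = 0 \<or> k + 2 \<le> CHAR('k)" using Suc.prems(3) Suc by auto
        show "(\<Sum>w\<in>?W N k. t (Up # w)) = (\<Sum>w\<in>?W N k. form N xu (word_vec (dual w)) * form N (word_vec w) yu / word_norm w)"
        proof (rule sum.cong)
          fix w assume w: "w \<in> ?W N k"
          \<comment> \<open>The correction term lies in the image of F, hence is orthogonal to every
            vector killed by E.\<close>
          have "form N xu (word_vec (dual w)) = form N xa (word_vec (dual w))"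
            unfolding xu_def by (simp add: form_lin form_opF E[OF dual_words[OF w]])
          moreover have "form N (word_vec w) yu = form N (word_vec w) ya"
            unfolding yu_def by (simp add: form_lin form_opE[symmetric] E[OF w])
          ultimately show "t (Up # w) = form N xu (word_vec (dual w)) * form N (word_vec w) yu / word_norm w"
            by (simp add: t_def form_lin x y)
        qed simp
      qed
      then show ?thesis using Suc u by simp
    qed
  qed
  moreover have "(\<Sum>w\<in>?W N (Suc h). t (Dn # w)) = b + b / ?c"
  proof -
    \<comment> \<open>With c = h + 1, each of the two pairings produces a factor -(c + 1), one unit
      coming from E applied to the \<open>Up\<close> component and c from the \<open>Dn\<close>
      component; the norm of the letter is c (c + 1).\<close>
    have td: "t (Dn # w) = (?c + 1) / ?c * (form N xb (word_vec (dual w)) * form N (word_vec w) yb / word_norm w)"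
      if w: "w \<in> ?W N (Suc h)" and nz2: "?c + 1 \<noteq> 0" for w
    proof -
      note l = words_props[OF w]
      have 1: "form (Suc N) x (word_vec (dual (Dn # w))) = form N xa (opF N (word_vec (dual w))) + form N xb (\<lambda>l. - ?c * word_vec (dual w) l)"
        using l by (simp add: x form_lin)
      have 1: "form (Suc N) x (word_vec (dual (Dn # w))) = - (?c + 1) * form N xb (word_vec (dual w))"
        unfolding 1 form_opE[symmetric] Exa form_lin by (simp add: algebra_simps)
      have 2: "form (Suc N) (word_vec (Dn # w)) y = form N (opF N (word_vec w)) ya + form N (\<lambda>l. - ?c * word_vec w l) yb"
        using l by (simp add: y form_lin)
      have 2: "form (Suc N) (word_vec (Dn # w)) y = - (?c + 1) * form N (word_vec w) yb"
        unfolding 2 form_opF Eya form_lin by (simp add: algebra_simps)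
      have 3: "word_norm (Dn # w) = ?c * (?c + 1) * word_norm w"
        using l by (simp add: algebra_simps)
      show ?thesis unfolding t_def 1 2 3 using nz nz2 word_norm_nonzero[OF w]
        by (simp add: divide_simps del: of_nat_Suc) (simp add: algebra_simps del: of_nat_Suc)
    qed
    show ?thesis
    proof (cases "CHAR('k) = 0 \<or> Suc h + 2 \<le> CHAR('k)")
      case True
      have "\<not> CHAR('k) dvd Suc (Suc h)" using True by (auto dest: dvd_imp_le)
      then have "of_nat (Suc (Suc h)) \<noteq> (0::'k)" by (simp only: of_nat_eq_0_iff_char_dvd) simp
      then have nz2: "?c + 1 \<noteq> 0" by (simp add: algebra_simps)
      have "(\<Sum>w\<in>?W N (Suc h). t (Dn # w)) = (?c + 1) / ?c * b"
        unfolding b_def Suc.IH[OF sx(3) sy(3) True] sum_distrib_left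
        by (rule sum.cong) (simp_all add: td nz2 del: of_nat_Suc)
      then show ?thesis using nz by (simp add: field_simps del: of_nat_Suc)
    next
      case False
      then have "CHAR('k) = Suc (Suc h)" using Suc.prems(3) by auto
      then have "of_nat (Suc (Suc h)) = (0::'k)" by (metis of_nat_CHAR)
      then have "?c + 1 = 0" by (simp add: algebra_simps)
      then have "?c = -1" by (simp only: eq_neg_iff_add_eq_0)
      then have "b + b / ?c = 0" by (simp only:) simp
      moreover have "?W N (Suc h) = {}" using words_height[of _ "CHAR('k)" N "Suc h"] False CHAR_not_1' by auto
      ultimately show ?thesis by simp
    qed
  qed
  moreover have "form (Suc N) x y = form N x0 yt - form N xt y0 + form N xa ya + b"
    by (simp add: x y b_def)
  ultimately show ?case unfolding t_def[symmetric] sum_words_Suc[OF Suc.prems(3)] by simp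
qed

section \<open>Vectors generated by the quadratic operators\<close>

fun op_e :: "nat \<Rightarrow> nat \<times> nat \<Rightarrow> 'c::comm_ring_1 fock \<Rightarrow> 'c fock" where
  "op_e N (i, j) f = (\<lambda>l. if i = j then opU N i (opD N i f) l else opU N i (opD N j f) l + opU N j (opD N i f) l)"

lemma linop_op_e: "linop (op_e N v)"
  by (cases v) (simp add: linop_def linop_simps algebra_simps)

lemmas linop_e_simps = linop_simps linopD[OF linop_op_e]

lemma op_e_opU: "op_e N v (opU N t f) = opU N t (op_e N v f)"
proof -
  have "opU N i (opD N j (opU N t f)) l = opU N t (opU N i (opD N j f)) l" for i j l
  proof -
    have "opD N j (opU N t f) = (\<lambda>l. - opU N t (opD N j f) l)"
      by (rule ext) (simp add: opU_opD)
    then show ?thesis by (simp add: linop_simps) (metis add.inverse_inverse opU_opU)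
  qed
  then show ?thesis by (cases v) (auto simp: fun_eq_iff linop_simps)
qed

lemma op_e_opD: "op_e N v (opD N t f) = opD N t (op_e N v f)"
proof -
  have "opU N i (opD N j (opD N t f)) l = opD N t (opU N i (opD N j f)) l" for i j l
  proof -
    have "opD N j (opD N t f) = (\<lambda>l. - opD N t (opD N j f) l)"
      by (rule ext) (simp add: opD_opD[of N j t])
    then show ?thesis by (simp add: linop_simps) (metis add.inverse_inverse opU_opD)
  qed
  then show ?thesis by (cases v) (auto simp: fun_eq_iff linop_simps)
qed

text \<open>F turns a_i b_j + a_j b_i into b_i b_j + b_j b_i = 0, so the symmetry in i and j is what
  makes the quadratic element invariant.\<close>

lemma opF_op_e: "opF N (op_e N v f) = op_e N v (opF N f)"
proof -
  obtain i j where v: "v = (i, j)" by (cases v)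
  have 1: "opF N (opU N i (opD N j f)) = (\<lambda>l. opU N i (opD N j (opF N f)) l + opD N i (opD N j f) l)" for i j
    by (rule ext) (simp add: opF_opU opF_opD[abs_def] linop_simps)
  show ?thesis
    by (auto simp: v fun_eq_iff 1 linop_simps opD_sq opD_opD[of N i j])
qed

lemma weyl_op_e: "weyl N (op_e N v f) = op_e N v (weyl N f)"
proof -
  obtain i j where v: "v = (i, j)" by (cases v)
  have 1: "weyl N (opU N i (opD N j f)) = opU N j (opD N i (weyl N f))" for i j
    by (rule ext) (simp add: weyl_opU weyl_opD[abs_def] opU_opD)
  show ?thesis
    by (auto simp: v fun_eq_iff 1 linop_simps)
qed

text \<open>The factors a_i and b_j are selfadjoint for the twisted form, so taking the adjoint
  reverses their order, and anticommutation produces the sign.\<close>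

lemma form_weyl_op_e: "form N (op_e N v f) (weyl N g) = - form N f (weyl N (op_e N v g))"
proof -
  obtain i j where v: "v = (i, j)" by (cases v)
  have 1: "form N (opU N i (opD N j f)) (weyl N g) = - form N f (weyl N (opU N i (opD N j g)))" for i j
  proof -
    have "form N (opU N i (opD N j f)) (weyl N g) = form N f (weyl N (opD N j (opU N i g)))"
      by (simp add: form_weyl_opU form_weyl_opD)
    also have "opD N j (opU N i g) = (\<lambda>l. - opU N i (opD N j g) l)"
      by (rule ext) (simp add: opU_opD)
    finally show ?thesis by (simp add: linop_simps form_lin)
  qed
  show ?thesis
    by (cases "i = j") (simp_all add: v 1 linop_simps form_lin)
qed

definition vac :: "nat \<Rightarrow> 'c::comm_ring_1 fock" where
  "vac N l = (if l = replicate N Em then 1 else 0)"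

lemma vac_Suc: "vac (Suc N) (x # l) = (if x = Em then vac N l else 0)" "vac (Suc N) [] = 0"
  "vac 0 l = (if l = [] then 1 else 0)"
  by (auto simp: vac_def)

lemma opE_vac: "opE N (vac N) = (\<lambda>l. 0)"
proof (rule ext)
  fix l show "opE N (vac N :: 'a fock) l = 0"
  proof (induction N arbitrary: l)
    case (Suc N) 
    have "opE N (\<lambda>l. if P then vac N l else (0::'a)) m = 0" for P m using Suc.IH by (cases P) (auto simp: linop_simps)
    then show ?case by (cases l) (auto simp: vac_Suc)
  qed simp
qed

lemma opF_vac: "opF N (vac N) = (\<lambda>l. 0)"
proof (rule ext)
  fix l show "opF N (vac N :: 'a fock) l = 0"
  proof (induction N arbitrary: l)
    case (Suc N) 
    have "opF N (\<lambda>l. if P then vac N l else (0::'a)) m = 0" for P m using Suc.IH by (cases P) (auto simp: linop_simps)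
    then show ?case by (cases l) (auto simp: vac_Suc)
  qed simp
qed

lemma weyl_vac: "weyl N (vac N) = vac N"
proof (rule ext)
  fix l show "weyl N (vac N :: 'a fock) l = vac N l"
  proof (induction N arbitrary: l)
    case (Suc N) 
    have "weyl N (\<lambda>l. if P then vac N l else (0::'a)) m = (if P then vac N m else 0)" for P m
      using Suc.IH by (cases P) (auto simp: linop_simps)
    moreover have "weyl N (\<lambda>l. vac N l :: 'a) m = vac N m" for m using Suc.IH by simp
    ultimately show ?case by (cases l) (auto simp: vac_Suc linop_simps split: site.splits)
  qed simp
qed

text \<open>The vector \<open>vac\<close> is the unit of the exterior algebra, and pairing with it
  is Berezin integration.\<close>

lemma form_vac: "form N (vac N) f = f (replicate N Fu)"
proof (induction N arbitrary: f)
  case (Suc N)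
  then show ?case by (simp add: vac_Suc form_lin)
qed (simp add: vac_Suc)

text \<open>Linear combinations of products of k elements e_ij and h elements a_i. For h = 0 every
  such vector is the image of a homogeneous polynomial of degree k, which is how word vectors are
  brought back into the algebra.\<close>

inductive gen :: "nat \<Rightarrow> nat \<Rightarrow> nat \<Rightarrow> 'c::comm_ring_1 fock \<Rightarrow> bool" for N where
  gen_vac: "gen N 0 0 (vac N)"
| gen_e: "gen N k h f \<Longrightarrow> v \<in> vars N \<Longrightarrow> gen N (Suc k) h (op_e N v f)"
| gen_U: "gen N k h f \<Longrightarrow> i < N \<Longrightarrow> gen N k (Suc h) (opU N i f)"
| gen_add: "gen N k h f \<Longrightarrow> gen N k h g \<Longrightarrow> gen N k h (\<lambda>l. f l + g l)"
| gen_scale: "gen N k h f \<Longrightarrow> gen N k h (\<lambda>l. c * f l)"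

text \<open>
  The vector of a down step, expressed through operators under which \<open>gen\<close> is closed: on a product
  of \<open>h\<close> generators \<open>a\<^sub>i\<close>, it replaces each \<open>a\<^sub>i\<close> in turn by the quadratic element for \<open>(i, t)\<close>.
\<close>

definition down_op :: "nat \<Rightarrow> nat \<Rightarrow> nat \<Rightarrow> 'c::comm_ring_1 fock \<Rightarrow> 'c fock" where
  "down_op N t h f = (\<lambda>l. opU N t (opF N f) l - of_nat h * opD N t f l)"

text \<open>Induction peels off one factor at a time: an e_ij commutes with the operator, and an a_i
  is either moved out with a sign or absorbed into a quadratic element for i and t. The case h = 0
  records that products of e_ij alone are killed by F, which starts the recursion on the factors
  a_i.\<close>

lemma gen_down:
  fixes f :: "'c::comm_ring_1 fock"
  assumes "gen N k h f" "t < N"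
  shows "if h = 0 then opF N f = (\<lambda>l. 0) else gen N (Suc k) (h - 1) (down_op N t h f)"
  using assms(1)
proof (induction rule: gen.induct)
  case gen_vac
  then show ?case by (simp add: opF_vac)
next
  case (gen_e k h f v)
  have "down_op N t h (op_e N v f) = op_e N v (down_op N t h f)"
    by (simp add: down_op_def opF_op_e op_e_opU[symmetric] op_e_opD[symmetric] linop_e_simps)
  then show ?case using gen_e gen.gen_e[of N "Suc k" "h-1" "down_op N t h f" v]
    by (auto simp: opF_op_e linop_e_simps)
next
  case (gen_U k h g i)
  have ei: "op_e N (min i t, max i t) g = (\<lambda>l. if i = t then opU N t (opD N t g) l else opU N t (opD N i g) l + opU N i (opD N t g) l)"
    by (auto simp: min_def max_def fun_eq_iff)
  have v: "(min i t, max i t) \<in> vars N" using gen_U assms(2) by (auto simp: vars_def)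
  \<comment> \<open>On the diagonal the expression is twice e_tt, because e_tt is a_t b_t and not
    its double; hence a sum of two equal generators.\<close>
  have e: "gen N (Suc k) h (\<lambda>l. opU N t (opD N i g) l + opU N i (opD N t g) l)"
  proof (cases "i = t")
    case True
    have "gen N (Suc k) h (\<lambda>l. op_e N (min i t, max i t) g l + op_e N (min i t, max i t) g l)"
      by (intro gen_add gen.gen_e gen_U v)
    then show ?thesis using True by (simp only: ei) simp
  next
    case False
    have "gen N (Suc k) h (op_e N (min i t, max i t) g)"
      by (intro gen_add gen.gen_e gen_U v)
    then show ?thesis using False by (simp only: ei) simp
  qed
  have 1: "opU N t (opF N (opU N i g)) l = - opU N i (opU N t (opF N g)) l + opU N t (opD N i g) l" for l
    by (simp add: opF_opU[abs_def] linop_simps) (rule opU_opU)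
  have 2: "opD N t (opU N i g) l = - opU N i (opD N t g) l" for l by (simp add: opU_opD)
  have D: "down_op N t (Suc h) (opU N i g) =
     (\<lambda>l. (- 1) * opU N i (down_op N t h g) l + (opU N t (opD N i g) l + opU N i (opD N t g) l))"
    by (rule ext) (simp add: down_op_def 1 2 linop_simps algebra_simps)
  show ?case
  proof (cases "h = 0")
    case True
    then have "opU N i (down_op N t h g) = (\<lambda>l. 0)" using gen_U by (simp add: down_op_def linop_simps)
    then show ?thesis using e D True by simp
  next
    case False
    have "gen N (Suc k) (Suc (h - 1)) (opU N i (down_op N t h g))" using gen_U False by (intro gen.gen_U) auto
    then have "gen N (Suc k) h (opU N i (down_op N t h g))" using False by simp
    then have "gen N (Suc k) h (down_op N t (Suc h) (opU N i g))"
      unfolding D by (intro gen_add gen_scale e)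
    then show ?thesis by simp
  qed
next
  case (gen_add k h f g)
  have "down_op N t h (\<lambda>l. f l + g l) = (\<lambda>l. down_op N t h f l + down_op N t h g l)"
    by (simp add: down_op_def linop_simps algebra_simps)
  then show ?case using gen_add gen.gen_add[of N "Suc k" "h-1"] by (auto simp: linop_simps split: if_splits)
next
  case (gen_scale k h f c)
  have "down_op N t h (\<lambda>l. c * f l) = (\<lambda>l. c * down_op N t h f l)"
    by (simp add: down_op_def linop_simps algebra_simps)
  then show ?case using gen_scale gen.gen_scale[of N "Suc k" "h-1"] by (auto simp: linop_simps split: if_splits)
qed

definition ext_fock :: "'c::comm_ring_1 fock \<Rightarrow> 'c fock" where
  "ext_fock f = (\<lambda>l. case l of [] \<Rightarrow> 0 | x # m \<Rightarrow> if x = Em then f m else 0)"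

lemma ext_fock_simps [simp]: "ext_fock f [] = 0" "ext_fock f (x # m) = (if x = Em then f m else 0)"
  by (simp_all add: ext_fock_def)

lemma ext_fock_eqI: "g [] = 0 \<Longrightarrow> (\<And>x l. g (x # l) = (if x = Em then f l else 0)) \<Longrightarrow> ext_fock f = g"
  by (auto simp: ext_fock_def fun_eq_iff split: list.splits)

lemma op_ext_fock:
  assumes "i < N"
  shows "opU (Suc N) i (ext_fock f) = ext_fock (opU N i f)"
    and "opD (Suc N) i (ext_fock f) = ext_fock (opD N i f)"
proof -
  have P: "opU N i (\<lambda>l. if P then f l else 0) = (\<lambda>l. if P then opU N i f l else 0)"
     "opD N i (\<lambda>l. if P then f l else 0) = (\<lambda>l. if P then opD N i f l else 0)" for P
    by (cases P; simp add: linop_simps)+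
  show "opU (Suc N) i (ext_fock f) = ext_fock (opU N i f)"
    "opD (Suc N) i (ext_fock f) = ext_fock (opD N i f)"
    by (rule ext_fock_eqI[symmetric]; use assms in \<open>auto simp: P\<close>)+
qed

lemma gen_ext: "gen N k h f \<Longrightarrow> gen (Suc N) k h (ext_fock f)"
proof (induction rule: gen.induct)
  case gen_vac
  have "ext_fock (vac N) = vac (Suc N)" by (rule ext_fock_eqI) (auto simp: vac_Suc)
  then show ?case using gen.gen_vac[of "Suc N"] by metis
next
  case (gen_e k h f v)
  have "ext_fock (op_e N v f) = op_e (Suc N) v (ext_fock f)"
    using gen_e.hyps(2) by (cases v; intro ext_fock_eqI) (auto simp: op_ext_fock vars_def)
  moreover have "v \<in> vars (Suc N)" using gen_e.hyps(2) by (auto simp: vars_def)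
  ultimately show ?case using gen.gen_e[OF gen_e.IH] by metis
next
  case (gen_U k h f i)
  then show ?case using gen.gen_U[OF gen_U.IH, of i] by (simp add: op_ext_fock)
next
  case (gen_add k h f g)
  have "ext_fock (\<lambda>l. f l + g l) = (\<lambda>l. ext_fock f l + ext_fock g l)" by (intro ext_fock_eqI) auto
  then show ?case using gen_add gen.gen_add by metis
next
  case (gen_scale k h f c)
  have "ext_fock (\<lambda>l. c * f l) = (\<lambda>l. c * ext_fock f l)" by (intro ext_fock_eqI) auto
  then show ?case using gen_scale gen.gen_scale by metis
qed

fun wdeg :: "site list \<Rightarrow> nat" where
  "wdeg [] = 0"
| "wdeg (x # w) = wdeg w + (if x = Fu \<or> x = Dn then 1 else 0)"

text \<open>Each letter is a closure operation of \<open>gen\<close> on the enlarged system: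
  \<open>Em\<close> adds an empty site, \<open>Fu\<close> multiplies by the diagonal quadratic
  element, \<open>Up\<close> by a generator a, and \<open>Dn\<close> is \<open>down_op\<close>. Only
  \<open>Fu\<close> and \<open>Dn\<close> add a quadratic factor, which is what \<open>wdeg\<close>
  counts.\<close>

lemma gen_word_vec:
  assumes "w \<in> words p N h"
  shows "gen N (wdeg w) h (word_vec w :: 'c::comm_ring_1 fock)"
  using assms
proof (induction N arbitrary: h w)
  case 0
  then have "w = []" "h = 0" by (auto split: if_splits)
  moreover have "word_vec [] = (vac 0 :: 'c fock)" by (auto simp: fun_eq_iff vac_Suc)
  ultimately show ?case using gen_vac[of 0] by simp
next
  case (Suc N)
  from Suc.prems consider (e) v where "w = Em # v" "v \<in> words p N h"
    | (f) v where "w = Fu # v" "v \<in> words p N h"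
    | (u) v k where "h = Suc k" "w = Up # v" "v \<in> words p N k"
    | (d) v where "w = Dn # v" "v \<in> words p N (Suc h)"
    by (auto split: if_splits nat.splits)
  then show ?case
  proof cases
    case e
    have "word_vec w = ext_fock (word_vec v :: 'c fock)" unfolding e by (rule ext_fock_eqI[symmetric]) auto
    then show ?thesis using gen_ext[OF Suc.IH[OF e(2)]] e by simp
  next
    case f
    have "word_vec w = op_e (Suc N) (N, N) (ext_fock (word_vec v :: 'c fock))"
    proof (rule ext)
      fix l show "word_vec w l = op_e (Suc N) (N, N) (ext_fock (word_vec v :: 'c fock)) l"
      unfolding f by (cases l) (auto split: site.splits)
    qed
    moreover have "(N, N) \<in> vars (Suc N)" by (auto simp: vars_def)
    ultimately have "gen (Suc N) (Suc (wdeg v)) h (word_vec w :: 'c fock)"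
      using gen_e[OF gen_ext[OF Suc.IH[OF f(2)]]] by presburger
    then show ?thesis using f by simp
  next
    case u
    have "word_vec w = opU (Suc N) N (ext_fock (word_vec v :: 'c fock))"
    proof (rule ext)
      fix l show "word_vec w l = opU (Suc N) N (ext_fock (word_vec v :: 'c fock)) l"
        unfolding u by (cases l) (auto split: site.splits)
    qed
    then show ?thesis using gen_U[OF gen_ext[OF Suc.IH[OF u(3)]], of N] u by simp
  next
    case d
    have "word_vec w = down_op (Suc N) N (Suc h) (ext_fock (word_vec v :: 'c fock))"
    proof (rule ext)
      fix l show "word_vec w l = down_op (Suc N) N (Suc h) (ext_fock (word_vec v :: 'c fock)) l"
        unfolding d using words_props[OF d(2)] by (cases l) (auto split: site.splits simp: down_op_def linop_simps algebra_simps)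
    qed
    then show ?thesis using gen_down[OF gen_ext[OF Suc.IH[OF d(2)]], of N] d by simp
  qed
qed

section \<open>The grading of the exterior algebra\<close>

fun charge :: "site list \<Rightarrow> nat" where
  "charge [] = 0"
| "charge (x # l) = charge l + (case x of Em \<Rightarrow> 0 | Fu \<Rightarrow> 2 | _ \<Rightarrow> 1)"

text \<open>A set of admissible degrees, and not a single degree, so that the same lemmas give
  homogeneity and also upper bounds such as the one for the lower terms of
  \<open>Psi\<close>.\<close>

definition charged :: "nat set \<Rightarrow> 'c::comm_ring_1 fock \<Rightarrow> bool" where
  "charged C f \<longleftrightarrow> (\<forall>l. f l \<noteq> 0 \<longrightarrow> charge l \<in> C)"

lemma charged_opU: "charged C f \<Longrightarrow> charged (Suc ` C) (opU N i f)"
proof -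
  have "(\<And>l. f l \<noteq> 0 \<Longrightarrow> charge l + d \<in> C) \<Longrightarrow> opU N i f l \<noteq> 0 \<Longrightarrow> charge l + d \<in> Suc ` C" for l and f :: "'a fock" and d
  proof (induction N arbitrary: f l d)
    case (Suc N)
    note IH = Suc.IH[of "\<lambda>l. f (s # l)" "d + (case s of Em \<Rightarrow> 0 | Fu \<Rightarrow> 2 | _ \<Rightarrow> 1)" for s]
    show ?case
    proof (cases l)
      case (Cons x m)
      show ?thesis
      proof (cases "i = N")
        case True
        then show ?thesis using Cons Suc.prems(1)[of "Em # m"] Suc.prems(1)[of "Dn # m"] Suc.prems(2) by (cases x) auto
      next
        case False
        have "\<And>l. f (x # l) \<noteq> 0 \<Longrightarrow> charge l + (d + (case x of Em \<Rightarrow> 0 | Fu \<Rightarrow> 2 | _ \<Rightarrow> 1)) \<in> C"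
          using Suc.prems(1)[of "x # _"] by (simp add: algebra_simps)
        moreover have "opU N i (\<lambda>l. f (x # l)) m \<noteq> 0" using Suc.prems(2) Cons False by auto
        ultimately have "charge m + (d + (case x of Em \<Rightarrow> 0 | Fu \<Rightarrow> 2 | _ \<Rightarrow> 1)) \<in> Suc ` C" by (rule IH)
        then show ?thesis using Cons by (simp add: ac_simps)
      qed
    qed (use Suc.prems in auto)
  qed simp
  from this[of f 0] show "charged C f \<Longrightarrow> charged (Suc ` C) (opU N i f)" by (auto simp: charged_def)
qed

lemma charged_opD: "charged C f \<Longrightarrow> charged (Suc ` C) (opD N i f)"
proof -
  have "(\<And>l. f l \<noteq> 0 \<Longrightarrow> charge l + d \<in> C) \<Longrightarrow> opD N i f l \<noteq> 0 \<Longrightarrow> charge l + d \<in> Suc ` C" for l and f :: "'a fock" and d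
  proof (induction N arbitrary: f l d)
    case (Suc N)
    note IH = Suc.IH[of "\<lambda>l. f (s # l)" "d + (case s of Em \<Rightarrow> 0 | Fu \<Rightarrow> 2 | _ \<Rightarrow> 1)" for s]
    show ?case
    proof (cases l)
      case (Cons x m)
      show ?thesis
      proof (cases "i = N")
        case True
        then show ?thesis using Cons Suc.prems(1)[of "Em # m"] Suc.prems(1)[of "Up # m"] Suc.prems(2) by (cases x) auto
      next
        case False
        have "\<And>l. f (x # l) \<noteq> 0 \<Longrightarrow> charge l + (d + (case x of Em \<Rightarrow> 0 | Fu \<Rightarrow> 2 | _ \<Rightarrow> 1)) \<in> C"
          using Suc.prems(1)[of "x # _"] by (simp add: algebra_simps)
        moreover have "opD N i (\<lambda>l. f (x # l)) m \<noteq> 0" using Suc.prems(2) Cons False by auto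
        ultimately have "charge m + (d + (case x of Em \<Rightarrow> 0 | Fu \<Rightarrow> 2 | _ \<Rightarrow> 1)) \<in> Suc ` C" by (rule IH)
        then show ?thesis using Cons by (simp add: ac_simps)
      qed
    qed (use Suc.prems in auto)
  qed simp
  from this[of f 0] show "charged C f \<Longrightarrow> charged (Suc ` C) (opD N i f)" by (auto simp: charged_def)
qed

lemma charged_op_e: "charged C f \<Longrightarrow> charged (Suc ` Suc ` C) (op_e N v f)"
proof -
  assume "charged C f"
  then have "charged (Suc ` Suc ` C) (opU N i (opD N j f))" for i j by (intro charged_opU charged_opD)
  then show ?thesis unfolding charged_def by (cases v) (auto, metis add.right_neutral)
qed

lemma charge_replicate: "charge (replicate N Em) = 0" by (induction N) auto

lemma gen_charged: "gen N k h f \<Longrightarrow> charged {2 * k + h} f"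
proof (induction rule: gen.induct)
  case gen_vac then show ?case by (auto simp: charged_def vac_def charge_replicate)
next
  case gen_e then show ?case using charged_op_e by fastforce
next
  case gen_U then show ?case using charged_opU by fastforce
next
  case gen_add then show ?case by (auto simp: charged_def) (metis add.right_neutral)
next
  case gen_scale then show ?case unfolding charged_def by (metis mult_zero_right)
qed

lemma form_charged:
  assumes "charged {c} f" "charged {d} g" "c + d \<noteq> 2 * N"
  shows "form N f g = 0"
proof -
  have "(\<And>l. f l \<noteq> 0 \<Longrightarrow> charge l + c' = c) \<Longrightarrow> (\<And>l. g l \<noteq> 0 \<Longrightarrow> charge l + d' = d)
     \<Longrightarrow> c + d \<noteq> 2 * N + c' + d' \<Longrightarrow> form N f g = 0" for c' d'
  proof (induction N arbitrary: f g c' d')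
    case 0
    then have "f [] = 0 \<or> g [] = 0" using "0"(1)[of "[]"] "0"(2)[of "[]"] by auto
    then show ?case by auto
  next
    case (Suc N)
    have f: "f (s # l) \<noteq> 0 \<Longrightarrow> charge l + (c' + (case s of Em \<Rightarrow> 0 | Fu \<Rightarrow> 2 | _ \<Rightarrow> 1)) = c" for s l
      using Suc.prems(1)[of "s # l"] by (simp add: algebra_simps)
    have g: "g (s # l) \<noteq> 0 \<Longrightarrow> charge l + (d' + (case s of Em \<Rightarrow> 0 | Fu \<Rightarrow> 2 | _ \<Rightarrow> 1)) = d" for s l
      using Suc.prems(2)[of "s # l"] by (simp add: algebra_simps)
    have "form N (\<lambda>l. f (s # l)) (\<lambda>l. g (t # l)) = 0"
      if "(case s of Em \<Rightarrow> 0::nat | Fu \<Rightarrow> 2 | _ \<Rightarrow> 1) + (case t of Em \<Rightarrow> 0 | Fu \<Rightarrow> 2 | _ \<Rightarrow> 1) = 2" for s t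
      using f[of s] g[of t] by (rule Suc.IH) (use that Suc.prems(3) in auto)
    then show ?case by simp
  qed
  from this[of 0 0] show ?thesis using assms by (auto simp: charged_def)
qed

text \<open>Counted in the word and its dual together, a level letter has weight 1,
  \<open>Dn\<close> has weight 2 and \<open>Up\<close> weight 0; the number of \<open>Up\<close>
  letters exceeds that of \<open>Dn\<close> letters by h.\<close>

lemma wdeg_dual: "w \<in> words p N h \<Longrightarrow> wdeg w + wdeg (dual w) + h = N"
  by (induction N arbitrary: w h) (force split: if_splits nat.splits)+

section \<open>Differential operators\<close>

abbreviation "lk \<equiv> Poly_Mapping.lookup"
abbreviation "sg \<equiv> Poly_Mapping.single"
abbreviation "ks \<equiv> Poly_Mapping.keys"

lemma lookup_Const_mult: "lk (Const c * f) m = c * lk f m"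
proof -
  have "lk (Const c * f) m = (\<Sum>k. lk (Const c) k * (\<Sum>q. lk f q when m = k + q))"
    by (simp add: lookup_mult)
  also have "\<dots> = (\<Sum>k. (c * (\<Sum>q. lk f q when m = k + q)) when k = 0)"
    by (rule Sum_any.cong) (auto simp: Const_def lookup_single when_def)
  also have "\<dots> = c * (\<Sum>q. lk f q when m = q)" by simp
  also have "\<dots> = c * lk f m" by simp
  finally show ?thesis .
qed

lemma lookup_Var_mult:
  "lk (Var v * f) m = (if lk m v = 0 then 0 else lk f (m - sg v 1))"
proof -
  have "lk (Var v * f) m = (\<Sum>k. lk (Var v) k * (\<Sum>q. lk f q when m = k + q))"
    by (simp add: lookup_mult)
  also have "\<dots> = (\<Sum>k. (\<Sum>q. lk f q when m = k + q) when k = sg v 1)"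
    by (rule Sum_any.cong) (auto simp: Var_def lookup_single when_def)
  also have "\<dots> = (\<Sum>q. lk f q when m = sg v 1 + q)" by simp
  also have "\<dots> = (if lk m v = 0 then 0 else lk f (m - sg v 1))"
  proof (cases "lk m v = 0")
    case True
    then have "m \<noteq> sg v 1 + q" for q by (metis add_is_0 lookup_add lookup_single_eq one_neq_zero)
    then show ?thesis using True by simp
  next
    case False
    have "m = sg v 1 + q \<longleftrightarrow> q = m - sg v 1" for q
    proof
      assume "q = m - sg v 1"
      then show "m = sg v 1 + q" using False
        by (intro poly_mapping_eqI) (auto simp: lookup_add lookup_minus lookup_single when_def)
    qed simp
    then show ?thesis using False by simp
  qed
  finally show ?thesis .
qed

lemma Const_simps: "Const 0 = 0" "Const 1 = 1" "Const (a + b) = Const a + Const b" "Const (a * b) = Const a * Const b"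
  "Const (- a) = - Const a"
proof -
  show "Const 0 = 0" "Const 1 = 1" "Const (a + b) = Const a + Const b" "Const (a * b) = Const a * Const b"
    by (simp_all add: Const_def single_one single_add mult_single)
  show "Const (- a) = - Const a"
    by (rule poly_mapping_eqI) (simp add: Const_def lookup_single when_def)
qed

lemma partial_add: "partial v (f + g) = partial v f + partial v g"
  by (rule poly_mapping_eqI) (simp add: lookup_partial lookup_add distrib_left)

lemma partial_Const_mult: "partial v (Const c * f) = Const c * partial v f"
  by (rule poly_mapping_eqI) (simp add: lookup_partial lookup_Const_mult mult.left_commute)

lemma partial_zero: "partial v 0 = 0"
  by (rule poly_mapping_eqI) (simp add: lookup_partial)

lemma partial_one: "partial v 1 = 0"
proof (rule poly_mapping_eqI)
  fix m :: "(nat \<times> nat) \<Rightarrow>\<^sub>0 nat"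
  have "m + sg v 1 \<noteq> 0" by (metis add_is_0 lookup_add lookup_single_eq lookup_zero one_neq_zero)
  then show "lk (partial v 1) m = lk 0 m" by (simp add: lookup_partial lookup_one)
qed

lemma partial_Var_mult: "partial v (Var u * f) = (if u = v then f else 0) + Var u * partial v f"
proof (rule poly_mapping_eqI)
  fix m
  show "lk (partial v (Var u * f)) m = lk ((if u = v then f else 0) + Var u * partial v f) m"
  proof (cases "u = v")
    case True
    have "m - sg v 1 + sg v 1 = m" if "lk m v \<noteq> 0"
      using that by (intro poly_mapping_eqI) (auto simp: lookup_add lookup_minus lookup_single when_def)
    then show ?thesis using True
      by (cases "lk m v = 0")
         (simp_all add: lookup_partial lookup_Var_mult lookup_add lookup_minus distrib_right del: One_nat_def)
  next
    case False
    have "m + sg v 1 - sg u 1 = m - sg u 1 + sg v 1" if "lk m u \<noteq> 0"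
      using that False by (intro poly_mapping_eqI) (auto simp: lookup_add lookup_minus lookup_single when_def)
    then show ?thesis using False
      by (auto simp: lookup_partial lookup_Var_mult lookup_add lookup_minus lookup_single simp del: One_nat_def)
  qed
qed

lemma poly_mapping_additive_induct [case_names single add]:
  assumes "\<And>k c. P (sg k c)" "\<And>f g. P f \<Longrightarrow> P g \<Longrightarrow> P (f + g)"
  shows "P (f :: 'a \<Rightarrow>\<^sub>0 'b::comm_monoid_add)"
proof (induction f rule: update_induct)
  case const
  show ?case using assms(1)[of undefined 0] by simp
next
  case (update f a b)
  have "Poly_Mapping.update a b f = f + sg a b"
    using update.hyps by (intro poly_mapping_eqI) (auto simp: lookup_update lookup_add lookup_single in_keys_iff)
  then show ?case using assms(2)[OF update.IH assms(1)] by metis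
qed

lemma mon_op_zero: "mon_op 0 g = g"
  by (simp add: mon_op_def)

lemma mon_op_add_single_1: "mon_op (m + sg v 1) g = partial v (mon_op m g)"
proof -
  let ?f = "\<lambda>m v. (partial v :: ('a::field) mpoly \<Rightarrow> _) ^^ lk m v"
  let ?A = "ks m - {v}" and ?n = "m + sg v 1"
  interpret n: comp_fun_commute "?f ?n" by (rule comp_fun_commute_partial_power)
  interpret m: comp_fun_commute "?f m" by (rule comp_fun_commute_partial_power)
  have keys: "ks ?n = insert v ?A"
    by (auto simp: in_keys_iff lookup_add lookup_single when_def split: if_splits)
  have "mon_op ?n g = ?f ?n v (Finite_Set.fold (?f ?n) g ?A)"
    unfolding mon_op_def keys by (rule n.fold_insert) auto
  also have "Finite_Set.fold (?f ?n) g ?A = Finite_Set.fold (?f m) g ?A"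
    by (rule fold_closed_eq[where B = UNIV]) (auto simp: lookup_add lookup_single)
  also have "?f ?n v (Finite_Set.fold (?f m) g ?A) = partial v (?f m v (Finite_Set.fold (?f m) g ?A))"
    by (simp add: lookup_add)
  also have "?f m v (Finite_Set.fold (?f m) g ?A) = mon_op m g"
  proof (cases "v \<in> ks m")
    case True
    then have "mon_op m g = Finite_Set.fold (?f m) g (insert v ?A)"
      unfolding mon_op_def by (simp add: insert_absorb)
    also have "\<dots> = ?f m v (Finite_Set.fold (?f m) g ?A)" by (rule m.fold_insert) auto
    finally show ?thesis by simp
  next
    case False
    then show ?thesis by (simp add: mon_op_def in_keys_iff)
  qed
  finally show ?thesis .
qed

lemma mon_op_add_single: "mon_op (m + sg v k) g = (partial v ^^ k) (mon_op m g)"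
proof (induction k)
  case (Suc k)
  have "m + sg v (Suc k) = (m + sg v k) + sg v 1"
    by (rule poly_mapping_eqI) (simp add: lookup_add lookup_single when_def)
  then show ?case using Suc by (simp only: mon_op_add_single_1) simp
qed simp

lemma mon_op_single: "mon_op (sg v k) g = (partial v ^^ k) g"
  using mon_op_add_single[of 0 v k g] by (simp add: mon_op_zero)

lemma mon_op_add: "mon_op (m + n) g = mon_op m (mon_op n g)"
proof (induction m arbitrary: n g rule: poly_mapping_additive_induct)
  case (single k c)
  then show ?case by (simp add: mon_op_single mon_op_add_single add.commute[of _ n])
next
  case (add a b)
  then show ?case by (metis add.assoc)
qed

lemma mon_op_linear:
  "mon_op m (f + g) = mon_op m f + mon_op m g" "mon_op m (Const c * f) = Const c * mon_op m f"
proof -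
  have "mon_op m (f + g) = mon_op m f + mon_op m g \<and> mon_op m (Const c * f) = Const c * mon_op m f" for f g
  proof (induction m arbitrary: f g rule: poly_mapping_additive_induct)
    case (single v k)
    show ?case by (induction k) (simp_all add: mon_op_single mon_op_zero partial_add partial_Const_mult)
  next
    case (add a b)
    then show ?case by (simp add: mon_op_add)
  qed
  then show "mon_op m (f + g) = mon_op m f + mon_op m g" "mon_op m (Const c * f) = Const c * mon_op m f" by auto
qed

lemma diff_op_superset:
  assumes "finite A" "ks f \<subseteq> A"
  shows "diff_op f g = (\<Sum>m\<in>A. Const (lk f m) * mon_op m g)"
  unfolding diff_op_def using assms
  by (intro sum.mono_neutral_left) (auto simp: in_keys_iff Const_simps)

lemma diff_op_add: "diff_op (f + h) g = diff_op f g + diff_op h g"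
proof -
  let ?A = "ks f \<union> ks h"
  have "ks (f + h) \<subseteq> ?A" by (rule keys_add)
  then show ?thesis
    by (simp add: diff_op_superset[of ?A] lookup_add Const_simps distrib_right sum.distrib)
qed

lemma diff_op_single: "diff_op (sg m c) g = Const c * mon_op m g"
  by (cases "c = 0") (simp_all add: diff_op_def Const_simps)

lemma diff_op_simps:
  "diff_op 0 g = 0" "diff_op 1 g = g" "diff_op (Const c) g = Const c * g" "diff_op (Var v) g = partial v g"
proof -
  show "diff_op (Const c) g = Const c * g" for c by (simp add: diff_op_single Const_def mon_op_zero)
  from this[of 1] this[of 0] show "diff_op 0 g = 0" "diff_op 1 g = g" by (simp_all add: Const_simps)
  show "diff_op (Var v) g = partial v g"
    by (simp add: Var_def diff_op_single mon_op_single Const_simps del: One_nat_def) simp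
qed

lemma diff_op_linear:
  "diff_op f (g + h) = diff_op f g + diff_op f h" "diff_op f (Const c * g) = Const c * diff_op f g"
  by (simp_all add: diff_op_def mon_op_linear distrib_left sum.distrib sum_distrib_left mult.left_commute)

lemma diff_op_mult: "diff_op (f * h) g = diff_op f (diff_op h g)"
proof (induction f arbitrary: h g rule: poly_mapping_additive_induct)
  case (single k c)
  show ?case
  proof (induction h rule: poly_mapping_additive_induct)
    case (single l d)
    then show ?case by (simp add: mult_single diff_op_single mon_op_add mon_op_linear Const_simps ac_simps)
  next
    case (add a b)
    then show ?case by (simp add: distrib_left diff_op_add diff_op_linear)
  qed
next
  case (add a b)
  then show ?case by (simp add: distrib_right diff_op_add)
qed

definition additive :: "('a::comm_ring_1 \<Rightarrow> 'b::comm_ring_1) \<Rightarrow> bool" where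
  "additive T \<longleftrightarrow> (\<forall>x y. T (x + y) = T x + T y)"

lemma additiveD:
  assumes "additive T"
  shows "T (x + y) = T x + T y" "T 0 = 0" "T (- x) = - T x" "T (sum f A) = (\<Sum>i\<in>A. T (f i))"
proof -
  show 1: "T (x + y) = T x + T y" for x y using assms by (simp add: additive_def)
  show 2: "T 0 = 0" using 1[of 0 0] by simp
  show "T (- x) = - T x" using 1[of x "- x"] 2 by (metis add.commute eq_neg_iff_add_eq_0 add.right_inverse)
  show "T (sum f A) = (\<Sum>i\<in>A. T (f i))"
    by (induction A rule: infinite_finite_induct) (simp_all add: 1 2)
qed

text \<open>The operators combine coefficients only by sums and signs, so they commute with any
  additive map of the coefficients. The maps used later, derivatives and coefficient extraction, are
  not multiplicative.\<close>

lemma additive_ops: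
  assumes T: "additive T"
  shows "T (opU N i f l) = opU N i (\<lambda>l. T (f l)) l" "T (opD N i f l) = opD N i (\<lambda>l. T (f l)) l"
    "T (opE N f l) = opE N (\<lambda>l. T (f l)) l" "T (opF N f l) = opF N (\<lambda>l. T (f l)) l"
proof -
  have sgn: "T (parity_sign x * y) = parity_sign x * T y" for x y by (cases x) (simp_all add: additiveD[OF T])
  show "T (opU N i f l) = opU N i (\<lambda>l. T (f l)) l"
    by (induction N i f l rule: opU.induct) (auto simp: additiveD[OF T] sgn split: site.splits)
  show "T (opD N i f l) = opD N i (\<lambda>l. T (f l)) l"
    by (induction N i f l rule: opD.induct) (auto simp: additiveD[OF T] sgn split: site.splits)
  show "T (opE N f l) = opE N (\<lambda>l. T (f l)) l"
    by (induction N f l rule: opE.induct) (auto simp: additiveD[OF T])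
  show "T (opF N f l) = opF N (\<lambda>l. T (f l)) l"
    by (induction N f l rule: opF.induct) (auto simp: additiveD[OF T])
qed

lemma additive_op_e:
  assumes T: "additive T"
  shows "T (op_e N v f l) = op_e N v (\<lambda>l. T (f l)) l"
  by (cases v) (simp add: additiveD[OF T] additive_ops[OF T])

section \<open>The generating vector of the derivatives of the determinant\<close>

definition bilin :: "nat \<Rightarrow> nat \<Rightarrow> nat \<Rightarrow> 'c::comm_ring_1 fock \<Rightarrow> 'c fock" where
  "bilin N i j f = opU N i (opD N j f)"

lemma linop_bilin: "linop (bilin N i j)"
  by (simp add: linop_def bilin_def linop_simps)

lemma opD_opU': "opD N i (opU N j f) = (\<lambda>l. - opU N j (opD N i f) l)"
  by (simp add: fun_eq_iff opU_opD)

lemma opU_bilin: "opU N k (bilin N i j f) = bilin N i j (opU N k f)"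
proof -
  have "opU N k (opU N i g) = (\<lambda>l. - opU N i (opU N k g) l)" for g :: "'a fock"
    by (simp add: fun_eq_iff opU_opU[of N k i])
  then show ?thesis by (simp add: bilin_def opD_opU' linop_simps)
qed

lemma opD_bilin: "opD N k (bilin N i j f) = bilin N i j (opD N k f)"
proof -
  have "opD N k (opD N j g) = (\<lambda>l. - opD N j (opD N k g) l)" for g :: "'a fock"
    by (simp add: fun_eq_iff opD_opD[of N k j])
  then show ?thesis by (simp add: bilin_def opD_opU' linop_simps)
qed

lemma bilin_commute: "bilin N i j (bilin N k m f) = bilin N k m (bilin N i j f)"
  unfolding bilin_def[of N i j] opD_bilin opU_bilin ..

lemma bilin_same: "bilin N i j (bilin N i m f) = (\<lambda>l. 0)"
proof -
  have "bilin N i j (bilin N i m f) = bilin N i m (opU N i (opD N j f))"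
    unfolding bilin_commute[of N i j] by (simp add: bilin_def)
  also have "\<dots> = opU N i (bilin N i m (opD N j f))" by (simp only: opU_bilin)
  also have "\<dots> = (\<lambda>l. 0)" by (simp add: bilin_def fun_eq_iff opU_sq)
  finally show ?thesis .
qed

definition xvar :: "nat \<Rightarrow> nat \<Rightarrow> ('k::field) mpoly" where
  "xvar i j = Var (min i j, max i j)"

lemma xvar_commute: "xvar i j = xvar j i" by (simp add: xvar_def min.commute max.commute)

definition quad :: "nat \<Rightarrow> nat \<Rightarrow> ('k::field) mpoly fock \<Rightarrow> 'k mpoly fock" where
  "quad N k f = (\<lambda>l. \<Sum>m<N. xvar k m * bilin N k m f l)"

lemma linop_quad: "linop (quad N k)"
  by (simp add: linop_def quad_def linopD[OF linop_bilin] distrib_left sum.distrib sum_distrib_left ac_simps)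

text \<open>
  \<open>Psi N s N\<close> is the exponential of \<open>s\<close> times the sum of \<open>x\<^sub>i\<^sub>j e\<^sub>i\<^sub>j\<close> over \<open>i \<le> j\<close>; writing it as a product of
  factors \<open>1 + s a\<^sub>i (\<Sum>\<^sub>m x\<^sub>i\<^sub>m b\<^sub>m)\<close> avoids denominators. Hence \<open>\<partial>\<^sub>i\<^sub>j\<close> acts on it as \<open>s e\<^sub>i\<^sub>j\<close>.
\<close>

fun Psi :: "nat \<Rightarrow> ('k::field) \<Rightarrow> nat \<Rightarrow> 'k mpoly fock" where
  "Psi N s 0 = vac N"
| "Psi N s (Suc k) = (\<lambda>l. Psi N s k l + Const s * quad N k (Psi N s k) l)"

lemmas linop_quad_simps = linop_simps linopD[OF linop_bilin] linopD[OF linop_quad]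

lemma bilin_quad: "bilin N i j (quad N k f) = quad N k (bilin N i j f)"
  by (simp add: quad_def linop_quad_simps bilin_commute[of N i j])

lemma bilin_quad_same: "bilin N i j (quad N i f) = (\<lambda>l. 0)"
  by (simp add: quad_def linop_quad_simps bilin_same)

lemma additive_partial: "additive (partial v)"
  by (simp add: additive_def partial_add)

lemma partial_quad:
  assumes v: "v = (i, j)" "i \<le> j" "j < N" and k: "k < N"
  shows "partial v (quad N k f l) = quad N k (\<lambda>l. partial v (f l)) l +
     (if k = i then bilin N i j f l else if k = j then bilin N j i f l else 0)"
proof -
  have "partial v (xvar k m * bilin N k m f l) = (if (min k m, max k m) = v then bilin N k m f l else 0) +
      xvar k m * bilin N k m (\<lambda>l. partial v (f l)) l" for m
    by (simp add: xvar_def partial_Var_mult bilin_def additive_ops[OF additive_partial])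
  then have "partial v (quad N k f l) = (\<Sum>m<N. if (min k m, max k m) = v then bilin N k m f l else 0) +
      quad N k (\<lambda>l. partial v (f l)) l"
    by (simp add: quad_def additiveD[OF additive_partial] sum.distrib)
  also have "(\<Sum>m<N. if (min k m, max k m) = v then bilin N k m f l else 0) =
      (\<Sum>m<N. if m = (if k = i then j else i) then (if k = i then bilin N i j f l else if k = j then bilin N j i f l else 0) else 0)"
    using v by (intro sum.cong) (auto simp: min_def max_def)
  also have "\<dots> = (if k = i then bilin N i j f l else if k = j then bilin N j i f l else 0)"
    using v by (simp add: sum.delta)
  finally show ?thesis by (simp add: add.commute)
qed

text \<open>For i < j the variable x_ij occurs in the factors of rows i and j, contributing a_i b_j
  and a_j b_i; on the diagonal only one factor is involved. The conditions on k say which of these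
  rows are already present.\<close>

lemma partial_Psi:
  assumes v: "v = (i, j)" "i \<le> j" "j < N" and k: "k \<le> N"
  shows "partial v (Psi N s k l) = Const s * ((if i < k then bilin N i j (Psi N s k) l else 0) +
     (if j < k \<and> i \<noteq> j then bilin N j i (Psi N s k) l else 0))"
  using k
proof (induction k arbitrary: l)
  case 0
  then show ?case by (simp add: vac_def partial_zero partial_one)
next
  case (Suc k)
  let ?P = "Psi N s k"
  define Q where "Q = (\<lambda>f l. (if i < k then bilin N i j f l else 0) +
     (if j < k \<and> i \<noteq> j then bilin N j i f l else (0 :: 'a mpoly)))"
  have Q: "(\<lambda>l. partial v (?P l)) = (\<lambda>l. Const s * Q ?P l)"
    using Suc by (auto simp: Q_def)
  have Qq: "quad N k (Q f) = Q (quad N k f)" for f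
    by (auto simp: Q_def fun_eq_iff linop_quad_simps bilin_quad)
  have Ql: "Q (\<lambda>l. f l + c * g l) l = Q f l + c * Q g l" for f g c l
    by (auto simp: Q_def linop_quad_simps algebra_simps)
  have "partial v (Psi N s (Suc k) l) = Const s * Q (Psi N s (Suc k)) l +
     Const s * (if k = i then bilin N i j ?P l else if k = j then bilin N j i ?P l else 0)"
    using Suc.prems by (simp add: partial_add partial_Const_mult partial_quad[OF v] Q linop_quad_simps Qq Ql fun_cong[OF Q]
        algebra_simps)
  \<comment> \<open>Differentiation removes the factor of row k, but a_k squares to zero, so that
    factor can be put back without changing the value.\<close>
  also have "(if k = i then bilin N i j ?P l else if k = j then bilin N j i ?P l else 0) =
     (if k = i then bilin N i j (Psi N s (Suc k)) l else if k = j then bilin N j i (Psi N s (Suc k)) l else 0)"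
    by (auto simp: linop_quad_simps bilin_quad_same)
  finally show ?case unfolding Q_def using v by (auto simp: algebra_simps less_Suc_eq)
qed

corollary partial_Psi_full:
  assumes "v \<in> vars N"
  shows "partial v (Psi N s N l) = Const s * op_e N v (Psi N s N) l"
proof -
  obtain i j where v: "v = (i, j)" "i \<le> j" "j < N" using assms by (auto simp: vars_def)
  show ?thesis using partial_Psi[OF v order_refl, of s l] v by (auto simp: bilin_def)
qed

section \<open>Invariance of the generating vector under sl2\<close>

lemma antisym_sum:
  fixes A :: "nat \<Rightarrow> nat \<Rightarrow> 'c::comm_ring_1"
  assumes "\<And>i j. A i j = - A j i" "\<And>i. A i i = 0"
  shows "(\<Sum>i<n. \<Sum>j<n. A i j) = 0"
proof (induction n)
  case (Suc n)
  have "(\<Sum>i<n. A i n) + (\<Sum>j<n. A n j) = (\<Sum>i<n. A i n + A n i)" by (simp add: sum.distrib)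
  also have "\<dots> = 0" using assms(1)[of _ n] by (intro sum.neutral) (metis add.right_inverse add.commute)
  finally show ?case using Suc assms(2) by (simp add: sum.distrib add.assoc) (metis add.commute)
qed simp

lemma opE_quad: "opE N (quad N k f) l = quad N k (opE N f) l + (\<Sum>m<N. xvar k m * opU N k (opU N m f) l)"
proof -
  have "opE N (bilin N k m f) l = bilin N k m (opE N f) l + opU N k (opU N m f) l" for m l
    by (simp add: bilin_def opE_opU opE_opD[abs_def] linop_simps)
  then show ?thesis by (simp add: quad_def linop_simps sum.distrib distrib_left)
qed

lemma opF_quad: "opF N (quad N k f) l = quad N k (opF N f) l + (\<Sum>m<N. xvar k m * opD N k (opD N m f) l)"
proof -
  have "opF N (bilin N k m f) l = bilin N k m (opF N f) l + opD N k (opD N m f) l" for m l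
    by (simp add: bilin_def opF_opU opF_opD[abs_def] linop_simps)
  then show ?thesis by (simp add: quad_def linop_simps sum.distrib distrib_left)
qed

text \<open>E replaces b_m by a_m in one row factor at a time. At k = N the symmetric coefficients
  x_im meet the antisymmetric products a_i a_m, and the double sum vanishes.\<close>

lemma opE_Psi:
  fixes s :: "'k::field"
  shows "opE N (Psi N s k) l = Const s * (\<Sum>i<k. \<Sum>m<N. xvar i m * opU N i (opU N m (Psi N s k)) l)"
proof (induction k arbitrary: l)
  case 0 then show ?case by (simp add: opE_vac)
next
  case (Suc k)
  let ?P = "Psi N s k"
  define M where "M = (\<lambda>(f :: 'k mpoly fock) l. \<Sum>i<k. \<Sum>m<N. xvar i m * opU N i (opU N m f) l)"
  have Ml: "M (\<lambda>l. f l + c * g l) l = M f l + c * M g l" for f g c l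
    by (simp add: M_def linop_quad_simps algebra_simps sum.distrib sum_distrib_left)
  have Mq: "quad N k (M f) = M (quad N k f)" for f
  proof -
    have "quad N k (opU N i g) = opU N i (quad N k g)" for i and g :: "'k mpoly fock"
      by (simp add: quad_def linop_quad_simps opU_bilin)
    then show ?thesis by (simp add: M_def linop_quad_simps)
  qed
  have IH: "opE N ?P = (\<lambda>l. Const s * M ?P l)" using Suc by (simp add: M_def fun_eq_iff)
  \<comment> \<open>This restores the factor of row k: it contains a_k, which squares to
    zero.\<close>
  have 0: "opU N k (opU N m (quad N k f)) l = 0" for m f l
  proof -
    have "opU N k (quad N k f) = (\<lambda>l. 0)"
      by (simp add: quad_def linop_quad_simps fun_eq_iff bilin_def opU_sq)
    then have "opU N m (opU N k (quad N k f)) l = 0" by (simp add: linop_simps)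
    then show ?thesis using opU_opU[of N k m "quad N k f" l] by simp
  qed
  have "opE N (Psi N s (Suc k)) l = opE N ?P l + Const s * opE N (quad N k ?P) l"
    by (simp add: linop_quad_simps)
  also have "\<dots> = Const s * (M ?P l + Const s * M (quad N k ?P) l + (\<Sum>m<N. xvar k m * opU N k (opU N m ?P) l))"
    by (simp add: opE_quad IH linop_quad_simps Mq algebra_simps)
  also have "M ?P l + Const s * M (quad N k ?P) l = M (Psi N s (Suc k)) l"
    by (simp add: Ml)
  also have "(\<Sum>m<N. xvar k m * opU N k (opU N m ?P) l) = (\<Sum>m<N. xvar k m * opU N k (opU N m (Psi N s (Suc k))) l)"
    by (simp add: linop_quad_simps 0)
  finally show ?case by (simp add: M_def)
qed

lemma opF_Psi:
  fixes s :: "'k::field"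
  shows "opF N (Psi N s k) l = Const s * (\<Sum>i<k. \<Sum>m<N. xvar i m * opD N i (opD N m (Psi N s k)) l)"
proof (induction k arbitrary: l)
  case 0 then show ?case by (simp add: opF_vac)
next
  case (Suc k)
  let ?P = "Psi N s k"
  define M where "M = (\<lambda>(f :: 'k mpoly fock) l. \<Sum>i<k. \<Sum>m<N. xvar i m * opD N i (opD N m f) l)"
  have Ml: "M (\<lambda>l. f l + c * g l) l = M f l + c * M g l" for f g c l
    by (simp add: M_def linop_quad_simps algebra_simps sum.distrib sum_distrib_left)
  have qD: "quad N k (opD N i g) = opD N i (quad N k g)" for i and g :: "'k mpoly fock"
    by (simp add: quad_def linop_quad_simps opD_bilin)
  have Mq: "quad N k (M f) = M (quad N k f)" for f
    by (simp add: M_def linop_quad_simps qD)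
  have IH: "opF N ?P = (\<lambda>l. Const s * M ?P l)" using Suc by (simp add: M_def fun_eq_iff)
  \<comment> \<open>Unlike for E, the single terms do not vanish. The sum does, because the linear
    form given by the sum of x_km b_m appears in it twice and squares to zero.\<close>
  have 0: "(\<Sum>m<N. xvar k m * opD N k (opD N m (quad N k f)) l) = 0" for f l
  proof -
    have "(\<Sum>m<N. xvar k m * opD N k (opD N m (quad N k f)) l) =
      (\<Sum>m<N. \<Sum>j<N. xvar k m * xvar k j * opD N k (opD N m (bilin N k j f)) l)"
      by (simp add: quad_def linop_quad_simps sum_distrib_left ac_simps)
    also have "\<dots> = 0"
    proof (rule antisym_sum)
      have e: "opD N k (opD N m (bilin N k j f)) l = opD N k (opU N k (opD N j (opD N m f))) l" for m j
        by (simp add: opD_bilin[of N m]) (simp add: bilin_def)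
      have a: "opD N j (opD N m f) = (\<lambda>l. - opD N m (opD N j f) l)" for m j by (simp add: fun_eq_iff opD_opD[of N j m])
      show "xvar k i * xvar k j * opD N k (opD N i (bilin N k j f)) l = - (xvar k j * xvar k i * opD N k (opD N j (bilin N k i f)) l)" for i j
        unfolding e a[of j i] by (simp add: linop_simps)
      have "opD N i (opD N i f) = (\<lambda>l. 0)" for i by (simp add: fun_eq_iff opD_sq)
      then show "xvar k i * xvar k i * opD N k (opD N i (bilin N k i f)) l = 0" for i unfolding e by (simp add: linop_simps)
    qed
    finally show ?thesis .
  qed
  have "opF N (Psi N s (Suc k)) l = opF N ?P l + Const s * opF N (quad N k ?P) l"
    by (simp add: linop_quad_simps)
  also have "\<dots> = Const s * (M ?P l + Const s * M (quad N k ?P) l + (\<Sum>m<N. xvar k m * opD N k (opD N m ?P) l))"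
    by (simp add: opF_quad IH linop_quad_simps Mq algebra_simps)
  also have "M ?P l + Const s * M (quad N k ?P) l = M (Psi N s (Suc k)) l"
    by (simp add: Ml)
  also have "(\<Sum>m<N. xvar k m * opD N k (opD N m ?P) l) = (\<Sum>m<N. xvar k m * opD N k (opD N m (Psi N s (Suc k))) l)"
  proof -
    have "(\<Sum>m<N. xvar k m * opD N k (opD N m (Psi N s (Suc k))) l) = (\<Sum>m<N. xvar k m * opD N k (opD N m ?P) l) +
       Const s * (\<Sum>m<N. xvar k m * opD N k (opD N m (quad N k ?P)) l)"
      by (simp add: linop_quad_simps distrib_left sum.distrib sum_distrib_left ac_simps)
    then show ?thesis by (simp add: 0)
  qed
  finally show ?case by (simp add: M_def)
qed

lemma opE_Psi_full: "opE N (Psi N s N) = (\<lambda>l. 0)"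
proof
  fix l
  have "(\<Sum>i<N. \<Sum>m<N. xvar i m * opU N i (opU N m (Psi N s N)) l) = 0"
  proof (rule antisym_sum)
    show "xvar i j * opU N i (opU N j (Psi N s N)) l = - (xvar j i * opU N j (opU N i (Psi N s N)) l)" for i j
      by (subst opU_opU) (simp add: xvar_commute[of j i])
    show "xvar i i * opU N i (opU N i (Psi N s N)) l = 0" for i by (simp add: opU_sq)
  qed
  then show "opE N (Psi N s N) l = 0" by (simp add: opE_Psi)
qed

lemma opF_Psi_full: "opF N (Psi N s N) = (\<lambda>l. 0)"
proof
  fix l
  have "(\<Sum>i<N. \<Sum>m<N. xvar i m * opD N i (opD N m (Psi N s N)) l) = 0"
  proof (rule antisym_sum)
    show "xvar i j * opD N i (opD N j (Psi N s N)) l = - (xvar j i * opD N j (opD N i (Psi N s N)) l)" for i j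
      by (subst opD_opD) (simp add: xvar_commute[of j i])
    show "xvar i i * opD N i (opD N i (Psi N s N)) l = 0" for i by (simp add: opD_sq)
  qed
  then show "opF N (Psi N s N) l = 0" by (simp add: opF_Psi)
qed

section \<open>The determinant as the top coefficient\<close>

text \<open>
  The entry at the head of a list \<open>js\<close> is the column paired with row \<open>length js - 1\<close>.
\<close>

fun bstr :: "nat \<Rightarrow> nat list \<Rightarrow> 'c::comm_ring_1 fock" where
  "bstr N [] = vac N"
| "bstr N (j # js) = bilin N (length js) j (bstr N js)"

fun xstr :: "nat list \<Rightarrow> ('k::field) mpoly" where
  "xstr [] = 1"
| "xstr (j # js) = xvar (length js) j * xstr js"

text \<open>The term of \<open>Psi\<close> that takes the quadratic summand from every row factor,
  hence its part of exterior degree 2 k. For k = N it is the only part visible in the top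
  coefficient.\<close>

fun Lead :: "nat \<Rightarrow> ('k::field) \<Rightarrow> nat \<Rightarrow> 'k mpoly fock" where
  "Lead N s 0 = vac N"
| "Lead N s (Suc k) = (\<lambda>l. Const s * quad N k (Lead N s k) l)"

lemma charged_bilin: "charged C f \<Longrightarrow> charged (Suc ` Suc ` C) (bilin N i j f)"
  unfolding bilin_def by (intro charged_opU charged_opD)

lemma charged_quad: "charged C f \<Longrightarrow> charged (Suc ` Suc ` C) (\<lambda>l. Const s * quad N k f l)"
proof -
  assume "charged C f"
  then have "bilin N k m f l \<noteq> 0 \<Longrightarrow> charge l \<in> Suc ` Suc ` C" for m l
    using charged_bilin unfolding charged_def by blast
  then show ?thesis unfolding charged_def quad_def by (metis (no_types, lifting) mult_zero_right sum.neutral)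
qed

lemma charged_Psi: "charged {2 * k} (Lead N s k)" "charged {..<2 * k} (\<lambda>l. Psi N s k l - Lead N s k l)"
proof -
  have "charged {2 * k} (Lead N s k) \<and> charged {..<2 * k} (\<lambda>l. Psi N s k l - Lead N s k l)"
  proof (induction k)
    case 0
    then show ?case by (auto simp: charged_def vac_def charge_replicate)
  next
    case (Suc k)
    have 1: "charged {2 * Suc k} (Lead N s (Suc k))"
      using charged_quad[OF conjunct1[OF Suc]] by simp
    have q: "charged (Suc ` Suc ` {..<2 * k}) (\<lambda>l. Const s * quad N k (\<lambda>l. Psi N s k l - Lead N s k l) l)"
      by (rule charged_quad[OF conjunct2[OF Suc]])
    have eq: "Psi N s (Suc k) l - Lead N s (Suc k) l = (Psi N s k l - Lead N s k l) + Lead N s k l +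
       Const s * quad N k (\<lambda>l. Psi N s k l - Lead N s k l) l" for l
      by (simp add: linop_quad_simps algebra_simps)
    have "charge l < 2 * Suc k" if "Psi N s (Suc k) l - Lead N s (Suc k) l \<noteq> 0" for l
    proof -
      have "Psi N s k l - Lead N s k l \<noteq> 0 \<or> Lead N s k l \<noteq> 0 \<or>
        Const s * quad N k (\<lambda>l. Psi N s k l - Lead N s k l) l \<noteq> 0"
        using that unfolding eq by auto
      then show ?thesis
        using Suc q unfolding charged_def by fastforce
    qed
    then show ?case using 1 by (auto simp: charged_def)
  qed
  then show "charged {2 * k} (Lead N s k)" "charged {..<2 * k} (\<lambda>l. Psi N s k l - Lead N s k l)" by auto
qed

lemma Psi_top_Lead: "Psi N s N (replicate N Fu) = Lead N s N (replicate N Fu)"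
proof -
  have "charge (replicate N Fu) = 2 * N" by (induction N) auto
  then show ?thesis using charged_Psi(2)[of N N s] by (auto simp: charged_def)
qed

definition index_lists :: "nat \<Rightarrow> nat \<Rightarrow> nat list set" where
  "index_lists N k = {js. length js = k \<and> set js \<subseteq> {..<N}}"

lemma finite_index_lists: "finite (index_lists N k)"
  using finite_lists_length_eq[of "{..<N}" k] by (simp add: index_lists_def conj_commute)

lemma sum_index_lists_Suc:
  "(\<Sum>js\<in>index_lists N (Suc k). g js) = (\<Sum>j<N. \<Sum>js\<in>index_lists N k. g (j # js))"
proof -
  have "index_lists N (Suc k) = (\<lambda>(j, js). j # js) ` ({..<N} \<times> index_lists N k)"
    by (auto simp: index_lists_def image_iff length_Suc_conv)
  moreover have "inj_on (\<lambda>(j, js). j # js) ({..<N} \<times> index_lists N k)" by (auto simp: inj_on_def)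
  ultimately have "(\<Sum>js\<in>index_lists N (Suc k). g js) = (\<Sum>p\<in>{..<N} \<times> index_lists N k. g (fst p # snd p))"
    by (simp add: sum.reindex split_def)
  then show ?thesis by (simp add: sum.cartesian_product split_def)
qed

lemma Lead_expand: "Lead N s k l = Const (s ^ k) * (\<Sum>js\<in>index_lists N k. xstr js * bstr N js l)"
proof (induction k arbitrary: l)
  case 0
  have "index_lists N 0 = {[]}" by (auto simp: index_lists_def)
  then show ?case by (simp add: Const_simps)
next
  case (Suc k)
  have L: "Lead N s k = (\<lambda>l. Const (s ^ k) * (\<Sum>js\<in>index_lists N k. xstr js * bstr N js l))"
    using Suc by (simp add: fun_eq_iff)
  have "Lead N s (Suc k) l = Const s * (\<Sum>j<N. xvar k j * (Const (s ^ k) * (\<Sum>js\<in>index_lists N k. xstr js * bilin N k j (bstr N js) l)))"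
    by (simp add: quad_def L linop_quad_simps)
  also have "\<dots> = Const (s ^ Suc k) * (\<Sum>j<N. \<Sum>js\<in>index_lists N k. xvar k j * xstr js * bilin N k j (bstr N js) l)"
    by (simp add: Const_simps sum_distrib_left ac_simps)
  also have "(\<Sum>j<N. \<Sum>js\<in>index_lists N k. xvar k j * xstr js * bilin N k j (bstr N js) l) =
      (\<Sum>js\<in>index_lists N (Suc k). xstr js * bstr N js l)"
    unfolding sum_index_lists_Suc by (intro sum.cong refl) (auto simp: index_lists_def)
  finally show ?case .
qed

lemma opD_bstr_member: "j \<in> set js \<Longrightarrow> opD N j (bstr N js) = (\<lambda>l. 0)"
proof (induction js)
  case (Cons i js)
  show ?case
  proof (cases "j = i")
    case True
    have 2: "opD N j (opD N j (bstr N js)) = (\<lambda>l. 0 :: 'a)" by (simp add: fun_eq_iff opD_sq)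
    have "opD N j (opU N (length js) (opD N j (bstr N js))) = (\<lambda>l. 0 :: 'a)"
      unfolding opD_opU' 2 by (simp add: linop_simps)
    then show ?thesis using True by (simp add: bilin_def)
  next
    case False
    then show ?thesis using Cons by (simp add: opD_bilin linop_quad_simps)
  qed
qed simp

lemma bstr_not_distinct: "\<not> distinct js \<Longrightarrow> bstr N js = (\<lambda>l. 0)"
proof (induction js)
  case (Cons j js)
  then show ?case by (auto simp: bilin_def opD_bstr_member linop_simps)
qed simp

abbreviation "tp \<equiv> Transposition.transpose"

lemma map_transpose_id: "a \<notin> set js \<Longrightarrow> b \<notin> set js \<Longrightarrow> map (tp a b) js = js"
  by (induction js) auto

text \<open>The product contains b_b once and b_a not at all. Exchanging the outer b_a with the
  inner b_b costs one sign, since the remaining blocks a_k b_j are even.\<close>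

lemma opD_bstr_swap:
  assumes "distinct js" "b \<in> set js" "a \<notin> set js"
  shows "opD N a (bstr N js) = (\<lambda>l. - opD N b (bstr N (map (tp a b) js)) l)"
  using assms
proof (induction js)
  case (Cons j js)
  show ?case
  proof (cases "j = b")
    case True
    have [simp]: "map (tp a b) js = js" using Cons True by (intro map_transpose_id) auto
    have "opD N a (bilin N k b f) l = - opD N b (bilin N k a f) l" for k and f :: "'a fock" and l
    proof -
      have "opD N a (opD N b f) = (\<lambda>l. - opD N b (opD N a f) l)" by (simp add: fun_eq_iff opD_opD[of N a b])
      then show ?thesis unfolding bilin_def opD_opU' by (simp add: linop_simps)
    qed
    then show ?thesis using True by (auto simp: fun_eq_iff)
  next
    case False
    then have j: "tp a b j = j" using Cons by auto
    show ?thesis using Cons False by (simp add: j opD_bilin linop_quad_simps)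
  qed
qed simp

lemma bstr_swap:
  assumes "distinct js" "a \<in> set js" "b \<in> set js" "a \<noteq> b"
  shows "bstr N (map (tp a b) js) = (\<lambda>l. - bstr N js l)"
  using assms
proof (induction js)
  case (Cons j js)
  consider "j = a" | "j = b" | "j \<noteq> a" "j \<noteq> b" by auto
  then show ?case
  proof cases
    case 1
    then have e: "opD N a (bstr N js) = (\<lambda>l. - opD N b (bstr N (map (tp a b) js)) l :: 'a)"
      using Cons.prems by (intro opD_bstr_swap) auto
    show ?thesis using 1 by (simp add: bilin_def e linop_simps)
  next
    case 2
    then have e: "opD N b (bstr N js) = (\<lambda>l. - opD N a (bstr N (map (tp a b) js)) l :: 'a)"
      using Cons.prems opD_bstr_swap[of js a b N] by (simp add: transpose_commute)
    show ?thesis using 2 by (simp add: bilin_def e linop_simps)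
  next
    case 3
    then have "tp a b j = j" by auto
    then show ?thesis using Cons 3 by (simp add: linop_quad_simps)
  qed
qed simp

lemma bstr_Suc: "set js \<subseteq> {..<N} \<Longrightarrow> length js \<le> N \<Longrightarrow> bstr (Suc N) js = ext_fock (bstr N js)"
proof (induction js)
  case Nil
  show ?case by (simp, rule ext_fock_eqI[symmetric]) (auto simp: vac_Suc)
next
  case (Cons j js)
  show ?case using Cons by (simp add: bilin_def op_ext_fock)
qed

lemma bstr_id_top: "bstr N (rev [0..<N]) (replicate N Fu) = (1 :: 'c::comm_ring_1)"
proof (induction N)
  case 0 then show ?case by (simp add: vac_def)
next
  case (Suc N)
  have "bstr (Suc N) (rev [0..<N]) = (ext_fock (bstr N (rev [0..<N])) :: 'c fock)"
    by (rule bstr_Suc) auto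
  then show ?case using Suc by (simp add: bilin_def)
qed

lemma bstr_perm_top:
  assumes "\<sigma> permutes {0..<N}"
  shows "bstr N (map \<sigma> (rev [0..<N])) (replicate N Fu) = (signof \<sigma> :: 'c::comm_ring_1)"
  using assms finite_atLeastLessThan
proof (induction rule: permutes_induct)
  case id
  then show ?case by (simp add: bstr_id_top)
next
  case (swap a b p)
  let ?js = "map p (rev [0..<N])"
  have "distinct ?js" using permutes_inj_on[OF swap.hyps(4)]
    by (simp add: distinct_map)
  moreover have "set ?js = {0..<N}" using permutes_image[OF swap.hyps(4)] by simp
  ultimately have "bstr N (map (tp a b) ?js) (replicate N Fu) = - (bstr N ?js (replicate N Fu) :: 'c)"
    using swap.hyps by (subst bstr_swap) auto
  moreover have "sign (tp a b \<circ> p) = - sign p"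
    using swap.hyps permutation_permutes[of p]
    by (subst sign_compose) (auto simp: permutation_swap_id sign_swap_id)
  ultimately show ?case using swap.IH by (simp add: comp_def)
qed

lemma xstr_map: "xstr (map \<sigma> (rev [0..<k])) = (\<Prod>i = 0..<k. xvar i (\<sigma> i))"
  by (induction k) (simp_all add: mult.commute)

text \<open>Expanding the top part chooses a column for each row. Repeated columns vanish because
  b_j squares to zero, distinct ones give the sign of the permutation, and the result is the Leibniz
  formula with one factor s per row.\<close>

theorem Psi_top: "Psi N s N (replicate N Fu) = Const (s ^ N) * sym_det N"
proof -
  let ?top = "replicate N Fu"
  let ?L = "{js \<in> index_lists N N. distinct js}"
  let ?p = "\<lambda>\<sigma>. map \<sigma> (rev [0..<N])"
  have "(\<Sum>js\<in>index_lists N N. xstr js * bstr N js ?top) = (\<Sum>js\<in>?L. xstr js * bstr N js ?top :: 'a mpoly)"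
    by (rule sum.mono_neutral_right) (auto simp: finite_index_lists bstr_not_distinct)
  also have "\<dots> = (\<Sum>\<sigma> | \<sigma> permutes {0..<N}. xstr (?p \<sigma>) * bstr N (?p \<sigma>) ?top)"
  proof (rule sum.reindex_bij_betw[symmetric])
    show "bij_betw ?p {\<sigma>. \<sigma> permutes {0..<N}} ?L"
    proof (rule bij_betwI')
      fix \<sigma> \<tau> :: "nat \<Rightarrow> nat" assume st: "\<sigma> \<in> {\<sigma>. \<sigma> permutes {0..<N}}" "\<tau> \<in> {\<sigma>. \<sigma> permutes {0..<N}}"
      show "?p \<sigma> = ?p \<tau> \<longleftrightarrow> \<sigma> = \<tau>"
      proof
        assume "?p \<sigma> = ?p \<tau>"
        then have "\<sigma> i = \<tau> i" if "i < N" for i using that by simp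
        then show "\<sigma> = \<tau>" using st by (auto simp: fun_eq_iff permutes_def) (metis atLeastLessThan_iff le0)
      qed simp
    next
      fix \<sigma> :: "nat \<Rightarrow> nat" assume "\<sigma> \<in> {\<sigma>. \<sigma> permutes {0..<N}}"
      then have s: "\<sigma> permutes {0..<N}" by simp
      show "?p \<sigma> \<in> ?L" using permutes_image[OF s] permutes_inj_on[OF s]
        by (auto simp: index_lists_def distinct_map)
    next
      fix js assume "js \<in> ?L"
      then have js: "length js = N" "set js \<subseteq> {..<N}" "distinct js" by (auto simp: index_lists_def)
      define \<sigma> where "\<sigma> i = (if i < N then rev js ! i else i)" for i
      have e: "?p \<sigma> = js"
      proof -
        have "map \<sigma> [0..<N] = rev js" using js by (intro nth_equalityI) (auto simp: \<sigma>_def)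
        then show ?thesis by (simp add: rev_map[symmetric])
      qed
      have "\<sigma> permutes {0..<N}"
      proof (rule bij_imp_permutes)
        have "inj_on \<sigma> {0..<N}" using js by (auto simp: inj_on_def \<sigma>_def nth_eq_iff_index_eq)
        moreover have "\<sigma> ` {0..<N} = {0..<N}"
        proof (rule card_subset_eq)
          have "\<sigma> ` {0..<N} = set js" by (subst e[symmetric]) auto
          then show "\<sigma> ` {0..<N} \<subseteq> {0..<N}" using js by auto
          show "card (\<sigma> ` {0..<N}) = card {0..<N}" using calculation by (rule card_image)
        qed simp
        ultimately show "bij_betw \<sigma> {0..<N} {0..<N}" by (simp add: bij_betw_def)
      qed (auto simp: \<sigma>_def)
      then show "\<exists>\<sigma>\<in>{\<sigma>. \<sigma> permutes {0..<N}}. js = ?p \<sigma>" using e by auto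
    qed
  qed
  also have "\<dots> = (\<Sum>\<sigma> | \<sigma> permutes {0..<N}. signof \<sigma> * (\<Prod>i = 0..<N. xvar i (\<sigma> i)))"
    by (intro sum.cong refl) (simp add: xstr_map bstr_perm_top mult.commute)
  also have "\<dots> = sym_det N"
    unfolding sym_det_def by (subst det_def') (auto intro!: sum.cong prod.cong simp: xvar_def permutes_in_image)
  finally show ?thesis by (simp add: Psi_top_Lead Lead_expand)
qed

section \<open>A basis of the apolar algebra\<close>

lemma poly_set_simps:
  "0 \<in> poly_set N" "1 \<in> poly_set N" "Const c \<in> poly_set N" "v \<in> vars N \<Longrightarrow> Var v \<in> poly_set N"
  "f \<in> poly_set N \<Longrightarrow> g \<in> poly_set N \<Longrightarrow> f + g \<in> poly_set N"
  "f \<in> poly_set N \<Longrightarrow> g \<in> poly_set N \<Longrightarrow> f * g \<in> poly_set N"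
  "f \<in> poly_set N \<Longrightarrow> - f \<in> poly_set N"
  "f \<in> poly_set N \<Longrightarrow> g \<in> poly_set N \<Longrightarrow> f - g \<in> poly_set N"
  "(\<And>x. x \<in> A \<Longrightarrow> h x \<in> poly_set N) \<Longrightarrow> sum h A \<in> poly_set N"
proof -
  show c: "Const c \<in> poly_set N" for c by (auto simp: poly_set_def Const_def)
  from c[of 0] c[of 1] show z: "0 \<in> poly_set N" and "1 \<in> poly_set N" by (simp_all add: Const_simps)
  show "v \<in> vars N \<Longrightarrow> Var v \<in> poly_set N" by (auto simp: poly_set_def Var_def)
  show a: "f \<in> poly_set N \<Longrightarrow> g \<in> poly_set N \<Longrightarrow> f + g \<in> poly_set N" for f g
    using keys_add[of f g] by (auto simp: poly_set_def)
  show "f * g \<in> poly_set N" if "f \<in> poly_set N" "g \<in> poly_set N"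
  proof -
    have "ks m \<subseteq> vars N" if m: "m \<in> ks (f * g)" for m
    proof -
      obtain a b where ab: "m = a + b" "a \<in> ks f" "b \<in> ks g" using keys_mult[of f g] m by auto
      then show ?thesis using keys_add[of a b] \<open>f \<in> poly_set N\<close> \<open>g \<in> poly_set N\<close>
        by (auto simp: poly_set_def)
    qed
    then show ?thesis by (auto simp: poly_set_def)
  qed
  show u: "f \<in> poly_set N \<Longrightarrow> - f \<in> poly_set N" for f by (simp add: poly_set_def)
  show "f \<in> poly_set N \<Longrightarrow> g \<in> poly_set N \<Longrightarrow> f - g \<in> poly_set N"
    using a[of f "- g"] u[of g] by simp
  show "(\<And>x. x \<in> A \<Longrightarrow> h x \<in> poly_set N) \<Longrightarrow> sum h A \<in> poly_set N"
    by (induction A rule: infinite_finite_induct) (auto simp: z a)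
qed

lemma homogeneous_part_poly_set: "f \<in> homogeneous_part N k \<Longrightarrow> f \<in> poly_set N"
  by (simp add: homogeneous_part_def)

lemma mon_deg_superset: "finite A \<Longrightarrow> ks m \<subseteq> A \<Longrightarrow> mon_deg m = (\<Sum>v\<in>A. lk m v)"
  unfolding mon_deg_def by (rule sum.mono_neutral_left) (auto simp: in_keys_iff)

lemma mon_deg_add: "mon_deg (m + n) = mon_deg m + mon_deg n"
proof -
  let ?A = "ks m \<union> ks n"
  have "ks (m + n) \<subseteq> ?A" by (rule keys_add)
  then show ?thesis by (simp add: mon_deg_superset[of ?A] lookup_add sum.distrib)
qed

lemma homogeneous_part_simps:
  "0 \<in> homogeneous_part N k" "Const c \<in> homogeneous_part N 0"
  "f \<in> homogeneous_part N k \<Longrightarrow> g \<in> homogeneous_part N k \<Longrightarrow> f + g \<in> homogeneous_part N k"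
  "f \<in> homogeneous_part N k \<Longrightarrow> Const c * f \<in> homogeneous_part N k"
  "f \<in> homogeneous_part N k \<Longrightarrow> v \<in> vars N \<Longrightarrow> Var v * f \<in> homogeneous_part N (Suc k)"
  "(\<And>x. x \<in> A \<Longrightarrow> h x \<in> homogeneous_part N k) \<Longrightarrow> sum h A \<in> homogeneous_part N k"
proof -
  show z: "0 \<in> homogeneous_part N k" for k by (simp add: homogeneous_part_def poly_set_simps)
  show "Const c \<in> homogeneous_part N 0"
    by (auto simp: homogeneous_part_def poly_set_simps) (auto simp: Const_def mon_deg_def split: if_splits)
  show a: "f \<in> homogeneous_part N k \<Longrightarrow> g \<in> homogeneous_part N k \<Longrightarrow> f + g \<in> homogeneous_part N k" for f g
    using keys_add[of f g] by (auto simp: homogeneous_part_def poly_set_simps)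
  show "Const c * f \<in> homogeneous_part N k" if "f \<in> homogeneous_part N k"
    using that by (auto simp: homogeneous_part_def poly_set_simps) (auto simp: in_keys_iff lookup_Const_mult)
  show "Var v * f \<in> homogeneous_part N (Suc k)" if f: "f \<in> homogeneous_part N k" and v: "v \<in> vars N"
  proof -
    have "mon_deg m = Suc k" if "m \<in> ks (Var v * f)" for m
    proof -
      have "lk m v \<noteq> 0" "m - sg v 1 \<in> ks f" using that
        by (auto simp: in_keys_iff lookup_Var_mult split: if_splits)
      moreover from this(1) have "m = (m - sg v 1) + sg v 1"
        by (intro poly_mapping_eqI) (auto simp: lookup_add lookup_minus lookup_single when_def)
      moreover have "mon_deg (sg v 1) = 1" by (simp add: mon_deg_def)
      ultimately show ?thesis using f mon_deg_add[of "m - sg v 1" "sg v 1"] by (auto simp: homogeneous_part_def)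
    qed
    then show ?thesis using f v by (auto simp: homogeneous_part_def poly_set_simps)
  qed
  show "(\<And>x. x \<in> A \<Longrightarrow> h x \<in> homogeneous_part N k) \<Longrightarrow> sum h A \<in> homogeneous_part N k"
    by (induction A rule: infinite_finite_induct) (auto simp: z a)
qed

lemma sum_single: "f = (\<Sum>m\<in>ks f. sg m (lk f m))"
proof (rule poly_mapping_eqI)
  fix n show "lk f n = lk (\<Sum>m\<in>ks f. sg m (lk f m)) n"
    by (simp add: lookup_sum lookup_single when_def sum.delta' in_keys_iff)
qed

lemma monomial_induct:
  fixes P :: "nat \<Rightarrow> ('k::field) mpoly \<Rightarrow> bool"
  assumes "ks m \<subseteq> vars N" "\<And>c. P 0 (Const c)"
    and step: "\<And>k f v. v \<in> vars N \<Longrightarrow> f \<in> poly_set N \<Longrightarrow> P k f \<Longrightarrow> P (Suc k) (Var v * f)"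
  shows "P (mon_deg m) (sg m c)"
  using assms(1)
proof (induction "mon_deg m" arbitrary: m)
  case 0
  have "lk m v = 0" for v
  proof (cases "v \<in> ks m")
    case True then show ?thesis using 0 by (simp add: mon_deg_def)
  qed (simp add: in_keys_iff)
  then have "m = 0" by (intro poly_mapping_eqI) simp
  then show ?case using assms(2)[of c] 0 by (simp add: Const_def)
next
  case (Suc k)
  then obtain v where v: "v \<in> ks m" unfolding mon_deg_def by (metis Zero_not_Suc sum.empty ex_in_conv)
  define m' where "m' = m - sg v 1"
  have m: "m = m' + sg v 1"
    using v unfolding m'_def by (intro poly_mapping_eqI) (auto simp: lookup_add lookup_minus lookup_single when_def in_keys_iff)
  have "ks m' \<subseteq> ks m" by (auto simp: m'_def in_keys_iff lookup_minus)
  then have km: "ks m' \<subseteq> vars N" using Suc by auto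
  have d: "k = mon_deg m'" using Suc(2) by (simp add: m mon_deg_add) (simp add: mon_deg_def)
  have "P (Suc k) (Var v * sg m' c)"
    using Suc.hyps(1)[OF d km] d v Suc.prems km by (intro step) (auto simp: poly_set_def split: if_splits)
  moreover have "Var v * sg m' c = sg m c" by (simp add: Var_def mult_single m add.commute)
  ultimately show ?case using Suc(2) by simp
qed

lemma poly_set_induct [consumes 1, case_names Const Var add]:
  assumes f: "f \<in> poly_set N" and P: "\<And>c. P (Const c)"
    "\<And>f v. v \<in> vars N \<Longrightarrow> f \<in> poly_set N \<Longrightarrow> P f \<Longrightarrow> P (Var v * f)"
    "\<And>f g. P f \<Longrightarrow> P g \<Longrightarrow> P (f + g)"
  shows "P f"
proof -
  have 0: "P 0" using P(1)[of 0] by (simp add: Const_simps)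
  have m: "P (sg m c)" if "m \<in> ks f" for m c
    using that f by (intro monomial_induct[of m N "\<lambda>_. P"]) (auto simp: P poly_set_def)
  have "P (\<Sum>m\<in>A. sg m (lk f m))" if "A \<subseteq> ks f" for A
    using finite_subset[OF that finite_keys] that by (induction A) (auto simp: 0 m P)
  then have "P (\<Sum>m\<in>ks f. sg m (lk f m))" by blast
  then show ?thesis by (simp only: sum_single[symmetric])
qed

lemma homogeneous_part_induct [consumes 1, case_names Const zero Var add]:
  assumes f: "f \<in> homogeneous_part N k" and P: "\<And>c. P 0 (Const c)" "\<And>k. P k 0"
    "\<And>k f v. v \<in> vars N \<Longrightarrow> P k f \<Longrightarrow> P (Suc k) (Var v * f)"
    "\<And>k f g. P k f \<Longrightarrow> P k g \<Longrightarrow> P k (f + g)"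
  shows "P k f"
proof -
  have m: "P k (sg m c)" if "m \<in> ks f" for m c
  proof -
    have "P (mon_deg m) (sg m c)"
      using that f by (intro monomial_induct[of m N P]) (auto simp: P poly_set_def homogeneous_part_def)
    then show ?thesis using that f by (auto simp: homogeneous_part_def)
  qed
  have "P k (\<Sum>m\<in>A. sg m (lk f m))" if "A \<subseteq> ks f" for A
    using finite_subset[OF that finite_keys] that by (induction A) (auto simp: m P)
  then have "P k (\<Sum>m\<in>ks f. sg m (lk f m))" by blast
  then show ?thesis by (simp only: sum_single[symmetric])
qed

text \<open>
  For \<open>m = 0\<close> this sends \<open>f\<close> to \<open>f(s e)\<close> applied to the vacuum.
\<close>

definition phi :: "nat \<Rightarrow> 'k::field \<Rightarrow> ((nat \<times> nat) \<Rightarrow>\<^sub>0 nat) \<Rightarrow> 'k mpoly \<Rightarrow> 'k fock" where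
  "phi N s m f = (\<lambda>l. lk (diff_op f (Psi N s N l)) m)"

lemma phi_add: "phi N s m (f + g) = (\<lambda>l. phi N s m f l + phi N s m g l)"
  by (simp add: phi_def diff_op_add lookup_add)

lemma phi_Const_mult: "phi N s m (Const c * f) = (\<lambda>l. c * phi N s m f l)"
  by (simp add: phi_def diff_op_mult diff_op_simps lookup_Const_mult)

lemma phi_sum: "phi N s m (sum h A) = (\<lambda>l. \<Sum>x\<in>A. phi N s m (h x) l)"
  by (induction A rule: infinite_finite_induct) (simp_all add: phi_add, simp_all add: phi_def diff_op_simps)

lemma phi_zero: "phi N s m 0 = (\<lambda>l. 0)"
  by (simp add: phi_def diff_op_simps)

lemma phi_diff: "phi N s m (f - g) = (\<lambda>l. phi N s m f l - phi N s m g l)"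
  using phi_add[of N s m f "Const (-1) * g"] unfolding phi_Const_mult by (simp add: Const_simps)

lemma additive_diff_op: "additive (\<lambda>g. lk (diff_op f g) m)"
  by (simp add: additive_def diff_op_linear lookup_add)

lemma phi_Var_mult:
  assumes "v \<in> vars N"
  shows "phi N s m (Var v * f) = (\<lambda>l. s * op_e N v (phi N s m f) l)"
proof
  fix l
  have "phi N s m (Var v * f) l = lk (diff_op f (partial v (Psi N s N l))) m"
    by (simp add: phi_def mult.commute[of "Var v"] diff_op_mult diff_op_simps)
  also have "\<dots> = s * lk (diff_op f (op_e N v (Psi N s N) l)) m"
    by (simp add: partial_Psi_full[OF assms] diff_op_linear lookup_Const_mult)
  also have "lk (diff_op f (op_e N v (Psi N s N) l)) m = op_e N v (phi N s m f) l"
    unfolding phi_def by (rule additive_op_e[OF additive_diff_op])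
  finally show "phi N s m (Var v * f) l = s * op_e N v (phi N s m f) l" .
qed

lemma Psi_constant: "lk (Psi N s k l) 0 = vac N l"
proof (induction k)
  case 0 then show ?case by (simp add: vac_def lookup_one)
next
  case (Suc k)
  then show ?case
    by (simp add: lookup_add lookup_Const_mult quad_def lookup_sum xvar_def lookup_Var_mult)
qed

lemma phi_Const: "phi N s 0 (Const c) = (\<lambda>l. c * vac N l)"
  by (simp add: phi_def diff_op_simps lookup_Const_mult Psi_constant)

text \<open>E and F kill \<open>Psi\<close> and commute with the additive coefficient map defining
  \<open>phi\<close>; H follows as their commutator. Every m is covered, as the Parseval identity is
  applied with arbitrary m.\<close>

lemma highest_weight_phi: "highest_weight N 0 (phi N s m f)"
proof -
  have "opE N (phi N s m f) l = 0" for l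
    using additive_ops(3)[OF additive_diff_op[of f m], of N "Psi N s N" l] additiveD(2)[OF additive_diff_op[of f m]]
    by (simp add: phi_def opE_Psi_full)
  then have E: "opE N (phi N s m f) = (\<lambda>l. 0)" by auto
  have "opF N (phi N s m f) l = 0" for l
    using additive_ops(4)[OF additive_diff_op[of f m], of N "Psi N s N" l] additiveD(2)[OF additive_diff_op[of f m]]
    by (simp add: phi_def opF_Psi_full)
  then have F: "opF N (phi N s m f) = (\<lambda>l. 0)" by auto
  have "opH N (phi N s m f) l = 0" for l
    using opE_opF[of N "phi N s m f" l] by (simp add: E F linop_simps)
  then show ?thesis by (auto simp: highest_weight_def E F)
qed

lemma weyl_phi: "f \<in> poly_set N \<Longrightarrow> weyl N (phi N s 0 f) = phi N s 0 f"
proof (induction rule: poly_set_induct)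
  case (Const c) then show ?case by (simp add: phi_Const linop_simps weyl_vac)
next
  case (Var f v) then show ?case by (simp add: phi_Var_mult linop_simps weyl_op_e)
next
  case (add f g) then show ?case by (simp add: phi_add linop_simps)
qed

text \<open>
  The elements \<open>e\<^sub>i\<^sub>j\<close> are anti-selfadjoint, which is why the second argument uses \<open>s = - 1\<close>.
\<close>

lemma form_phi:
  assumes "f \<in> poly_set N"
  shows "form N (phi N 1 0 f) (phi N (-1) m g) = (-1) ^ N * lk (diff_op (f * g) (sym_det N)) m"
proof -
  have "form N (phi N 1 0 f) (weyl N (phi N (-1) m g)) = (-1) ^ N * lk (diff_op (f * g) (sym_det N)) m"
    using assms
  proof (induction arbitrary: g rule: poly_set_induct)
    case (Const c)
    have "form N (vac N) (weyl N (phi N (-1) m g)) = phi N (-1) m g (replicate N Fu)"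
      by (metis form_vac form_weyl weyl_vac)
    also have "\<dots> = (-1) ^ N * lk (diff_op g (sym_det N)) m"
      by (simp add: phi_def Psi_top diff_op_linear lookup_Const_mult)
    finally show ?case
      by (simp add: phi_Const form_lin diff_op_mult diff_op_simps diff_op_linear lookup_Const_mult ac_simps)
  next
    case (Var f v)
    have "form N (phi N 1 0 (Var v * f)) (weyl N (phi N (-1) m g)) =
       form N (phi N 1 0 f) (weyl N (phi N (-1) m (Var v * g)))"
      by (simp add: phi_Var_mult[OF Var(1)] form_weyl_op_e form_lin linop_simps)
    then show ?case using Var.IH[of "Var v * g"] by (simp add: ac_simps)
  next
    case (add f g h)
    then show ?case by (simp add: phi_add form_lin distrib_right diff_op_add lookup_add distrib_left)
  qed
  moreover have "form N (phi N 1 0 f) (phi N (-1) m g) = form N (phi N 1 0 f) (weyl N (phi N (-1) m g))"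
    using form_weyl[of N "phi N 1 0 f"] by (simp add: weyl_phi[OF assms])
  ultimately show ?thesis by simp
qed

lemma form_Ann:
  assumes "f \<in> Ann N"
  shows "form N (phi N 1 0 f) (phi N (-1) 0 g) = 0"
proof -
  have "diff_op (g * f) (sym_det N) = 0"
    using assms by (simp add: Ann_def diff_op_mult) (simp add: diff_op_def mon_op_linear(2)[of _ 0 0, simplified Const_simps, simplified])
  then show ?thesis using assms by (simp add: Ann_def form_phi mult.commute)
qed

text \<open>Taking g = 1 and letting m vary tests all coefficients of f(partial) D directly, so no
  division by factorials occurs.\<close>

lemma Ann_form:
  assumes "f \<in> poly_set N" "\<And>m. form N (phi N 1 0 f) (phi N (-1) m 1) = 0"
  shows "f \<in> Ann N"
proof -
  have "diff_op f (sym_det N) = 0"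
    using assms(2) by (intro poly_mapping_eqI) (simp add: form_phi[OF assms(1)])
  then show ?thesis using assms by (simp add: Ann_def)
qed

text \<open>No rule of \<open>gen\<close> lowers h, so a derivation ending at h = 0 multiplies only
  by quadratic elements, and each of these is a variable up to the scalar s.\<close>

lemma gen_phi:
  assumes "gen N k h x" "h = 0" "s \<noteq> 0"
  shows "\<exists>f\<in>homogeneous_part N k. phi N s 0 f = x"
  using assms(1,2)
proof (induction rule: gen.induct)
  case gen_vac
  show ?case by (rule bexI[of _ "Const 1"]) (simp_all add: phi_Const homogeneous_part_simps)
next
  case (gen_e k h x v)
  then obtain f where f: "f \<in> homogeneous_part N k" "phi N s 0 f = x" by auto
  have e: "inverse s * (s * y) = y" for y using assms(3) by (simp flip: mult.assoc)
  have "phi N s 0 (Const (inverse s) * (Var v * f)) = op_e N v x"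
    unfolding phi_Const_mult phi_Var_mult[OF gen_e.hyps(2)] f(2) e ..
  moreover have "Const (inverse s) * (Var v * f) \<in> homogeneous_part N (Suc k)"
    using f gen_e.hyps(2) by (intro homogeneous_part_simps)
  ultimately show ?case by auto
next
  case (gen_add k h x y)
  then obtain f g where "f \<in> homogeneous_part N k" "phi N s 0 f = x" "g \<in> homogeneous_part N k" "phi N s 0 g = y" by auto
  then show ?case by (intro bexI[of _ "f + g"]) (auto simp: phi_add homogeneous_part_simps)
next
  case (gen_scale k h x c)
  then obtain f where "f \<in> homogeneous_part N k" "phi N s 0 f = x" by auto
  then show ?case by (intro bexI[of _ "Const c * f"]) (auto simp: phi_Const_mult homogeneous_part_simps)
qed simp

lemma charged_phi: "f \<in> homogeneous_part N k \<Longrightarrow> charged {2 * k} (phi N 1 0 f)"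
proof (induction rule: homogeneous_part_induct)
  case (Const c)
  then show ?case by (auto simp: charged_def phi_Const vac_def charge_replicate split: if_splits)
next
  case (zero k)
  then show ?case by (simp add: charged_def phi_zero)
next
  case (Var k f v)
  then show ?case using charged_op_e[of "{2 * k}" "phi N 1 0 f" N v] by (simp add: phi_Var_mult)
next
  case (add k f g)
  then show ?case unfolding charged_def phi_add by (metis add.right_neutral)
qed

definition word_rep :: "nat \<Rightarrow> site list \<Rightarrow> ('k::field) mpoly" where
  "word_rep N w = (SOME f. f \<in> homogeneous_part N (wdeg w) \<and> phi N 1 0 f = word_vec w)"

lemma word_rep:
  assumes "w \<in> words p N 0"
  shows "(word_rep N w :: ('k::field) mpoly) \<in> homogeneous_part N (wdeg w)" "phi N 1 0 (word_rep N w :: ('k::field) mpoly) = word_vec w"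
proof -
  have "\<exists>f\<in>homogeneous_part N (wdeg w). phi N (1::'k) 0 f = word_vec w"
    using gen_phi[OF gen_word_vec[OF assms], where s = 1] by simp
  then have "\<exists>f. f \<in> homogeneous_part N (wdeg w) \<and> phi N (1::'k) 0 f = word_vec w" by auto
  from someI_ex[OF this]
  show "(word_rep N w :: 'k mpoly) \<in> homogeneous_part N (wdeg w)" "phi N 1 0 (word_rep N w :: 'k mpoly) = word_vec w"
    unfolding word_rep_def by auto
qed

text \<open>Some polynomial has the dual word vector as its image for s = -1. Pairing with it kills
  the annihilator, while orthogonality isolates the coefficient of w times a nonzero norm.\<close>

lemma word_rep_independent:
  fixes c :: "site list \<Rightarrow> 'k::field"
  assumes S: "S \<subseteq> words CHAR('k) N 0" and A: "(\<Sum>w\<in>S. Const (c w) * word_rep N w) \<in> Ann N" and w: "w \<in> S"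
  shows "c w = 0"
proof -
  let ?W = "words CHAR('k) N 0"
  have wW: "w \<in> ?W" using S w by auto
  obtain g where g: "phi N (-1) 0 g = (word_vec (dual w) :: 'k fock)"
    using gen_phi[OF gen_word_vec[OF dual_words[OF wW]], where s = "-1"] by auto
  have "0 = form N (phi N 1 0 (\<Sum>w\<in>S. Const (c w) * word_rep N w)) (phi N (-1) 0 g)"
    using form_Ann[OF A] by simp
  also have "\<dots> = (\<Sum>v\<in>S. c v * form N (phi N 1 0 (word_rep N v)) (word_vec (dual w)))"
    by (simp add: phi_sum phi_Const_mult form_lin g)
  also have "\<dots> = (\<Sum>v\<in>S. if v = w then c v * word_norm v else 0)"
  proof (rule sum.cong)
    fix v assume "v \<in> S"
    then have v: "v \<in> ?W" using S by auto
    show "c v * form N (phi N 1 0 (word_rep N v)) (word_vec (dual w)) = (if v = w then c v * word_norm v else 0)"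
      by (simp add: word_rep[OF v] form_word_vec[OF v wW])
  qed simp
  also have "\<dots> = c w * word_norm w" using w finite_subset[OF S] by (simp add: sum.delta')
  finally show ?thesis using word_norm_nonzero[OF wW] by simp
qed

text \<open>The coefficients are those of the Parseval identity, so f and its expansion have the
  same pairing with every coefficient of \<open>Psi\<close>. If f has degree k, its image has
  exterior degree 2 k, and only dual words of the complementary degree pair with it.\<close>

lemma word_rep_span:
  fixes f :: "'k::field mpoly"
  assumes f: "f \<in> poly_set N"
  defines "c \<equiv> \<lambda>w. form N (phi N 1 0 f) (word_vec (dual w)) / word_norm w"
  shows "f - (\<Sum>w\<in>words CHAR('k) N 0. Const (c w) * word_rep N w) \<in> Ann N"
    and "f \<in> homogeneous_part N k \<Longrightarrow> w \<in> words CHAR('k) N 0 \<Longrightarrow> wdeg w \<noteq> k \<Longrightarrow> c w = 0"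
proof -
  let ?W = "words CHAR('k) N 0"
  show "f - (\<Sum>w\<in>?W. Const (c w) * word_rep N w) \<in> Ann N"
  proof (rule Ann_form)
    show "f - (\<Sum>w\<in>?W. Const (c w) * word_rep N w) \<in> poly_set N"
      using f by (intro poly_set_simps homogeneous_part_poly_set[OF word_rep(1)])
    fix m
    have "CHAR('k) \<noteq> 1" by simp
    then have p: "CHAR('k) = 0 \<or> 0 + 2 \<le> CHAR('k)" by linarith
    have "form N (phi N 1 0 f) (phi N (-1) m 1) = (\<Sum>w\<in>?W. c w * form N (word_vec w) (phi N (-1) m 1))"
      unfolding c_def by (subst parseval[OF highest_weight_phi highest_weight_phi p]) simp
    then show "form N (phi N 1 0 (f - (\<Sum>w\<in>?W. Const (c w) * word_rep N w))) (phi N (-1) m 1) = 0"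
      by (simp add: phi_diff phi_sum phi_Const_mult form_lin word_rep)
  qed
  show "c w = 0" if fk: "f \<in> homogeneous_part N k" and w: "w \<in> ?W" and "wdeg w \<noteq> k"
  proof -
    have "charged {2 * wdeg (dual w)} (word_vec (dual w) :: 'k fock)"
      using gen_charged[OF gen_word_vec[OF dual_words[OF w]]] by simp
    then have "form N (phi N 1 0 f) (word_vec (dual w)) = 0"
      using that wdeg_dual[OF w] by (intro form_charged[OF charged_phi[OF fk]]) auto
    then show ?thesis by (simp add: c_def)
  qed
qed

section \<open>Dimensions\<close>

lemma poly_ring_sel [simp]:
  "carrier (poly_ring N) = poly_set N" "x \<otimes>\<^bsub>poly_ring N\<^esub> y = x * y" "x \<oplus>\<^bsub>poly_ring N\<^esub> y = x + y"
  "\<one>\<^bsub>poly_ring N\<^esub> = 1" "\<zero>\<^bsub>poly_ring N\<^esub> = 0"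
  by (simp_all add: poly_ring_def)

lemma cring_poly_ring: "cring (poly_ring N)"
proof (rule cringI)
  show "abelian_group (poly_ring N)"
    by (rule abelian_groupI) (auto simp: poly_set_simps algebra_simps intro!: bexI[of _ "- _"])
  show "comm_monoid (poly_ring N)"
    by (rule comm_monoidI) (auto simp: poly_set_simps algebra_simps)
qed (auto simp: algebra_simps)

lemma poly_ring_minus: "x \<in> poly_set N \<Longrightarrow> y \<in> poly_set N \<Longrightarrow> x \<ominus>\<^bsub>poly_ring N\<^esub> y = x - y"
proof -
  interpret cring "poly_ring N" by (rule cring_poly_ring)
  assume "x \<in> poly_set N" "y \<in> poly_set N"
  then have "\<ominus>\<^bsub>poly_ring N\<^esub> y = - y" by (intro minus_equality) (auto simp: poly_set_simps)
  then show ?thesis by (simp add: a_minus_def)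
qed

lemma diff_op_zero: "diff_op f 0 = 0"
  using diff_op_linear(2)[of f 0 0] by (simp add: Const_simps)

lemma ideal_Ann: "ideal (Ann N) (poly_ring N :: ('a::field) mpoly ring)"
proof (rule idealI)
  show "ring (poly_ring N :: 'a mpoly ring)" using cring_poly_ring by (rule cring.axioms)
  interpret cring "poly_ring N :: 'a mpoly ring" by (rule cring_poly_ring)
  have m: "\<ominus>\<^bsub>poly_ring N\<^esub> y = - y" if "y \<in> poly_set N" for y :: "'a mpoly"
    using that by (intro minus_equality) (auto simp: poly_set_simps)
  have n: "diff_op (- y) g = - diff_op y g" for y g :: "'a mpoly"
    using diff_op_add[of y "- y" g] by (simp add: diff_op_simps eq_neg_iff_add_eq_0 add.commute)
  show "subgroup (Ann N) (add_monoid (poly_ring N :: 'a mpoly ring))"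
  proof (rule subgroup.intro)
    fix x :: "'a mpoly" assume "x \<in> Ann N"
    then have x: "x \<in> poly_set N" "diff_op x (sym_det N) = 0" by (simp_all add: Ann_def)
    show "inv\<^bsub>add_monoid (poly_ring N)\<^esub> x \<in> Ann N"
      unfolding m[OF x(1), unfolded a_inv_def] using x by (simp add: Ann_def poly_set_simps n)
  qed (auto simp: Ann_def poly_set_simps diff_op_add diff_op_simps)
next
  fix a x :: "'a mpoly"
  assume "a \<in> Ann N" "x \<in> carrier (poly_ring N)"
  then have "x * a \<in> Ann N"
    by (simp add: Ann_def poly_set_simps diff_op_mult diff_op_zero)
  then show "x \<otimes>\<^bsub>poly_ring N\<^esub> a \<in> Ann N" "a \<otimes>\<^bsub>poly_ring N\<^esub> x \<in> Ann N"
    by (simp_all add: mult.commute)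
qed

lemma proj_eq_iff:
  assumes "f \<in> poly_set N" "g \<in> poly_set N"
  shows "proj N f = proj N g \<longleftrightarrow> f - g \<in> Ann N"
proof -
  interpret cring "poly_ring N" by (rule cring_poly_ring)
  show ?thesis
    using quotient_eq_iff_same_a_r_cos[OF ideal_Ann, of f g] assms
    by (simp add: poly_ring_minus proj_def)
qed

lemma proj_hom: "ring_hom_ring (poly_ring N) (apolar_algebra N) (proj N :: ('k::field) mpoly \<Rightarrow> _)"
proof -
  have "(proj N :: 'k mpoly \<Rightarrow> _) = a_r_coset (poly_ring N) (Ann N)" by (auto simp: proj_def)
  then show ?thesis
    unfolding apolar_algebra_def using ideal.rcos_ring_hom_ring[OF ideal_Ann, of N] by simp
qed

lemma carrier_apolar: "carrier (apolar_algebra N) = proj N ` poly_set N"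
  by (auto simp: apolar_algebra_def FactRing_def A_RCOSETS_def' proj_def)

lemma replicate_words: "p \<noteq> 1 \<Longrightarrow> replicate N Em \<in> words p N 0"
  by (induction N) auto

text \<open>Otherwise the quotient would be zero, contradicting the independence of the all-empty
  word. This is what embeds the field of scalars in the quotient.\<close>

lemma one_notin_Ann: "1 \<notin> (Ann N :: ('k::field) mpoly set)"
proof
  assume 1: "1 \<in> (Ann N :: 'k mpoly set)"
  have "CHAR('k) \<noteq> 1" by simp
  then have w: "replicate N Em \<in> words CHAR('k) N 0" by (rule replicate_words)
  have "word_rep N (replicate N Em) * 1 \<in> (Ann N :: 'k mpoly set)"
    using ideal.I_l_closed[OF ideal_Ann 1] homogeneous_part_poly_set[OF word_rep(1)[OF w]] by fastforce
  then show False
    using word_rep_independent[of "{replicate N Em}" N "\<lambda>_. 1 :: 'k"] w by (simp add: Const_simps)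
qed

lemma subfield_Const: "subfield (range Const) (poly_ring N :: ('k::field) mpoly ring)"
proof -
  interpret cring "poly_ring N :: 'k mpoly ring" by (rule cring_poly_ring)
  let ?K = "(poly_ring N :: 'k mpoly ring)\<lparr>carrier := range Const\<rparr>"
  have sel: "carrier ?K = range Const" "x \<otimes>\<^bsub>?K\<^esub> y = x * y" "x \<oplus>\<^bsub>?K\<^esub> y = x + y" "\<one>\<^bsub>?K\<^esub> = 1" "\<zero>\<^bsub>?K\<^esub> = 0" for x y
    by (simp_all add: poly_ring_def)
  have C: "Const a + Const b \<in> range Const" "Const a * Const b \<in> range Const" "(0 :: 'k mpoly) \<in> range Const"
    "(1 :: 'k mpoly) \<in> range Const" "- Const a \<in> range Const" for a b :: 'k
    by (metis rangeI Const_simps)+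
  have "cring ?K"
  proof (rule cringI)
    show "abelian_group ?K"
    proof (rule abelian_groupI)
      fix x assume "x \<in> carrier ?K"
      then obtain c where "x = Const c" by (auto simp: sel)
      then show "\<exists>y\<in>carrier ?K. y \<oplus>\<^bsub>?K\<^esub> x = \<zero>\<^bsub>?K\<^esub>"
        by (intro bexI[of _ "Const (- c)"]) (simp_all only: sel rangeI, simp add: Const_simps)
    qed (auto simp: sel C algebra_simps)
    show "comm_monoid ?K"
      by (rule comm_monoidI) (auto simp: sel C algebra_simps)
  qed (auto simp: sel algebra_simps)
  then have "field ?K"
  proof (rule cring.cring_fieldI2)
    show "\<zero>\<^bsub>?K\<^esub> \<noteq> \<one>\<^bsub>?K\<^esub>" by (simp add: sel)
    fix a assume "a \<in> carrier ?K" "a \<noteq> \<zero>\<^bsub>?K\<^esub>"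
    then obtain c where c: "a = Const c" "c \<noteq> 0" using Const_simps(1) by (auto simp: sel)
    have "Const c * Const (inverse c) = Const (c * inverse c)" by (simp only: Const_simps)
    also have "\<dots> = 1" using c by (simp add: Const_simps)
    finally show "\<exists>b\<in>carrier ?K. a \<otimes>\<^bsub>?K\<^esub> b = \<one>\<^bsub>?K\<^esub>"
      using c by (intro bexI[of _ "Const (inverse c)"]) (auto simp: sel)
  qed
  then show ?thesis by (rule subfield_iff) (auto simp: poly_set_simps)
qed

lemma subfield_scalars: "subfield (apolar_scalars N) (apolar_algebra N :: ('k::field) mpoly set ring)"
proof -
  interpret ring_hom_ring "poly_ring N :: 'k mpoly ring" "apolar_algebra N" "proj N" by (rule proj_hom)
  have "proj N (1 :: 'k mpoly) \<noteq> proj N 0"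
    using one_notin_Ann[of N] by (subst proj_eq_iff) (auto simp: poly_set_simps)
  then have "\<one>\<^bsub>(apolar_algebra N :: 'k mpoly set ring)\<^esub> \<noteq> \<zero>\<^bsub>apolar_algebra N\<^esub>"
    using hom_one hom_zero by simp
  then show ?thesis unfolding apolar_scalars_def
    by (rule img_is_subfield(2)[OF subfield_Const])
qed

lemma combine_proj:
  fixes c :: "site list \<Rightarrow> 'k::field"
  assumes "distinct ws" "set ws \<subseteq> words p N 0"
  shows "ring.combine (apolar_algebra N) (map (\<lambda>w. proj N (Const (c w))) ws) (map (\<lambda>w. proj N (word_rep N w)) ws)
    = proj N (\<Sum>w\<in>set ws. Const (c w) * word_rep N w)"
proof -
  interpret ring_hom_ring "poly_ring N :: 'k mpoly ring" "apolar_algebra N" "proj N" by (rule proj_hom)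
  show ?thesis using assms
  proof (induction ws)
    case Nil then show ?case using hom_zero by simp
  next
    case (Cons w ws)
    have r: "(word_rep N v :: 'k mpoly) \<in> poly_set N" if "v \<in> insert w (set ws)" for v
      using Cons.prems that homogeneous_part_poly_set[OF word_rep(1), of v p N] by auto
    have s: "(\<Sum>w\<in>set ws. Const (c w) * word_rep N w) \<in> poly_set N" "Const (c w) * word_rep N w \<in> poly_set N"
      using r by (auto intro!: poly_set_simps)
    have "proj N (Const (c w) * word_rep N w) = proj N (Const (c w)) \<otimes>\<^bsub>apolar_algebra N\<^esub> proj N (word_rep N w)"
      using hom_mult[of "Const (c w)" "word_rep N w"] r by (simp add: poly_set_simps)
    moreover have "proj N (Const (c w) * word_rep N w + (\<Sum>w\<in>set ws. Const (c w) * word_rep N w)) =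
        proj N (Const (c w) * word_rep N w) \<oplus>\<^bsub>apolar_algebra N\<^esub> proj N (\<Sum>w\<in>set ws. Const (c w) * word_rep N w)"
      using hom_add s by simp
    ultimately show ?case using Cons by simp
  qed
qed

lemma list_as_map:
  assumes "distinct ws" "length cs = length ws"
  obtains c where "cs = map c ws"
proof
  show "cs = map (the \<circ> map_of (zip ws cs)) ws"
    using assms by (intro nth_equalityI) (auto simp: map_of_zip_nth)
qed

lemma Span_rep:
  fixes N :: nat
  assumes "distinct ws" "set ws \<subseteq> words p N 0"
  shows "ring.Span (apolar_algebra N) (apolar_scalars N) (map (\<lambda>w. proj N (word_rep N w :: ('k::field) mpoly)) ws) =
    {proj N (\<Sum>w\<in>set ws. Const (c w) * word_rep N w) | c. True}" (is "?S = ?T")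
proof -
  interpret ring_hom_ring "poly_ring N :: 'k mpoly ring" "apolar_algebra N" "proj N" by (rule proj_hom)
  have "set (map (\<lambda>w. proj N (word_rep N w :: 'k mpoly)) ws) \<subseteq> carrier (apolar_algebra N)"
    using assms(2) homogeneous_part_poly_set[OF word_rep(1)] by (fastforce simp: carrier_apolar)
  then have S: "?S = {S.combine Ks (map (\<lambda>w. proj N (word_rep N w)) ws) |Ks.
      length Ks = length ws \<and> set Ks \<subseteq> apolar_scalars N}"
    using S.Span_eq_combine_set_length_version[OF subfield_scalars] by simp
  show ?thesis
  proof
    show "?S \<subseteq> ?T"
    proof
      fix x assume "x \<in> ?S"
      then obtain Ks where Ks: "length Ks = length ws" "set Ks \<subseteq> apolar_scalars N"
        "x = S.combine Ks (map (\<lambda>w. proj N (word_rep N w)) ws)" unfolding S by auto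
      have "\<exists>cs. Ks = map (\<lambda>c. proj N (Const c)) cs"
        using Ks(2) by (induction Ks) (auto simp: apolar_scalars_def Cons_eq_map_conv)
      then obtain cs where cs: "Ks = map (\<lambda>c. proj N (Const c)) cs" by auto
      then obtain c where "cs = map c ws" using list_as_map[OF assms(1), of cs] Ks(1) by auto
      then have "Ks = map (\<lambda>w. proj N (Const (c w))) ws" using cs by simp
      then show "x \<in> ?T" using combine_proj[OF assms, of c] Ks(3) by auto
    qed
    show "?T \<subseteq> ?S"
    proof
      fix x assume "x \<in> ?T"
      then obtain c where "x = proj N (\<Sum>w\<in>set ws. Const (c w) * word_rep N w)" by auto
      then have "x = S.combine (map (\<lambda>w. proj N (Const (c w))) ws) (map (\<lambda>w. proj N (word_rep N w)) ws)"
        using combine_proj[OF assms, of c] by simp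
      then show "x \<in> ?S" unfolding S
        by (intro CollectI exI[of _ "map (\<lambda>w. proj N (Const (c w))) ws"]) (auto simp: apolar_scalars_def)
    qed
  qed
qed

lemma independent_rep:
  assumes "distinct ws" "set ws \<subseteq> words CHAR('k::field) N 0"
  shows "ring.independent (apolar_algebra N) (apolar_scalars N) (map (\<lambda>w. proj N (word_rep N w :: 'k mpoly)) ws)"
proof -
  interpret ring_hom_ring "poly_ring N :: 'k mpoly ring" "apolar_algebra N" "proj N" by (rule proj_hom)
  show ?thesis using assms
  proof (induction ws)
    case Nil then show ?case by simp
  next
    case (Cons w ws)
    have r: "(word_rep N v :: 'k mpoly) \<in> poly_set N" if "v \<in> insert w (set ws)" for v
      using Cons.prems that homogeneous_part_poly_set[OF word_rep(1), of v "CHAR('k)" N] by auto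
    have "proj N (word_rep N w) \<notin> S.Span (apolar_scalars N) (map (\<lambda>w. proj N (word_rep N w :: 'k mpoly)) ws)"
    proof
      assume "proj N (word_rep N w) \<in> S.Span (apolar_scalars N) (map (\<lambda>w. proj N (word_rep N w :: 'k mpoly)) ws)"
      then obtain c :: "site list \<Rightarrow> 'k" where "proj N (word_rep N w) = proj N (\<Sum>v\<in>set ws. Const (c v) * word_rep N v)"
        using Span_rep[of ws "CHAR('k)" N, where 'k = 'k] Cons.prems by (auto simp del: S.Span.simps)
      then have "word_rep N w - (\<Sum>v\<in>set ws. Const (c v) * word_rep N v) \<in> Ann N"
        using r by (subst (asm) proj_eq_iff) (auto intro!: poly_set_simps)
      also have "word_rep N w - (\<Sum>v\<in>set ws. Const (c v) * word_rep N v) =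
          (\<Sum>v\<in>insert w (set ws). Const (if v = w then 1 else - c v) * word_rep N v)"
      proof -
        have "(\<Sum>v\<in>set ws. Const (if v = w then 1 else - c v) * word_rep N v) = (\<Sum>v\<in>set ws. - (Const (c v) * word_rep N v))"
          using Cons.prems by (intro sum.cong) (auto simp: Const_simps)
        then show ?thesis using Cons.prems by (simp add: Const_simps sum_negf)
      qed
      finally show False
        using word_rep_independent[of "insert w (set ws)" N "\<lambda>v. if v = w then 1 else - c v" w] Cons.prems by simp
    qed
    moreover have "proj N (word_rep N w :: 'k mpoly) \<in> carrier (apolar_algebra N)" using r by (simp add: carrier_apolar)
    ultimately show ?case using Cons by (simp del: S.Span.simps) (rule S.independent.intros(2))
  qed
qed

text \<open>V is left arbitrary because the lemma is applied both to all polynomials with all words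
  and to the degree k part with the words of that degree.\<close>

lemma dimension_rep:
  assumes S: "S \<subseteq> words CHAR('k::field) N 0" and V: "V \<subseteq> poly_set N"
    and sub: "\<And>c. (\<Sum>w\<in>S. Const (c w) * word_rep N w) \<in> V"
    and span: "\<And>f. f \<in> V \<Longrightarrow> \<exists>c. f - (\<Sum>w\<in>S. Const (c w) * word_rep N w) \<in> Ann N"
  shows "ring.finite_dimension (apolar_algebra N :: 'k mpoly set ring) (apolar_scalars N) (proj N ` V)"
    and "ring.dim (apolar_algebra N :: 'k mpoly set ring) (apolar_scalars N) (proj N ` V) = card S"
proof -
  interpret ring_hom_ring "poly_ring N :: 'k mpoly ring" "apolar_algebra N" "proj N" by (rule proj_hom)
  have "finite S" using S finite_words finite_subset by blast
  then obtain ws where ws: "distinct ws" "set ws = S" using finite_distinct_list by auto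
  have "S.Span (apolar_scalars N) (map (\<lambda>w. proj N (word_rep N w :: 'k mpoly)) ws) =
      {proj N (\<Sum>w\<in>S. Const (c w) * word_rep N w) | c. True}"
    using Span_rep[of ws "CHAR('k)" N] ws S by (simp del: S.Span.simps)
  also have "\<dots> = proj N ` V"
  proof
    show "{proj N (\<Sum>w\<in>S. Const (c w) * word_rep N w) | c. True} \<subseteq> proj N ` V" using sub by auto
    show "proj N ` V \<subseteq> {proj N (\<Sum>w\<in>S. Const (c w) * word_rep N w) | c. True}"
    proof
      fix x assume "x \<in> proj N ` V"
      then obtain f where f: "f \<in> V" "x = proj N f" by auto
      then obtain c where "f - (\<Sum>w\<in>S. Const (c w) * word_rep N w) \<in> Ann N" using span by auto
      then have "proj N f = proj N (\<Sum>w\<in>S. Const (c w) * word_rep N w)"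
        using f V sub[of c] by (subst proj_eq_iff) auto
      then show "x \<in> {proj N (\<Sum>w\<in>S. Const (c w) * word_rep N w) | c. True}" using f by auto
    qed
  qed
  finally have "S.dimension (card S) (apolar_scalars N) (proj N ` V)"
    using S.dimension_independent[OF independent_rep[of ws N, where 'k = 'k]] ws S
    by (simp add: distinct_card[symmetric] del: S.Span.simps)
  then show "S.finite_dimension (apolar_scalars N) (proj N ` V)"
    "S.dim (apolar_scalars N) (proj N ` V) = card S"
    using S.finite_dimensionI S.dimI[OF subfield_scalars] by (auto simp: over_def)
qed

theorem apolar_dims:
  shows "apolar_finite_dim TYPE('k::field) N"
    and "apolar_dim TYPE('k) N = card (words CHAR('k) N 0)"
    and "apolar_part_dim TYPE('k) N k = card {w \<in> words CHAR('k) N 0. wdeg w = k}"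
proof -
  let ?W = "words CHAR('k) N 0"
  have r: "(word_rep N v :: 'k mpoly) \<in> poly_set N" if "v \<in> ?W" for v
    using that homogeneous_part_poly_set[OF word_rep(1)] by blast
  have sub: "(\<Sum>w\<in>?W. Const (c w) * word_rep N w) \<in> poly_set N" for c :: "site list \<Rightarrow> 'k"
    using r by (auto intro!: poly_set_simps)
  have span: "\<exists>c. f - (\<Sum>w\<in>?W. Const (c w) * word_rep N w) \<in> Ann N" if "f \<in> poly_set N" for f :: "'k mpoly"
    by (rule exI) (rule word_rep_span(1)[OF that])
  note total = dimension_rep[OF subset_refl subset_refl sub span, folded carrier_apolar]
  let ?Wk = "\<lambda>k. {w \<in> ?W. wdeg w = k}"
  have subk: "(\<Sum>w\<in>?Wk k. Const (c w) * word_rep N w) \<in> homogeneous_part N k" for c :: "site list \<Rightarrow> 'k" and k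
    using word_rep(1) by (auto intro!: homogeneous_part_simps)
  have spank: "\<exists>c. f - (\<Sum>w\<in>?Wk k. Const (c w) * word_rep N w) \<in> Ann N" if "f \<in> homogeneous_part N k" for f :: "'k mpoly" and k
  proof -
    define c where "c = (\<lambda>w. form N (phi N 1 0 f) (word_vec (dual w)) / word_norm w)"
    have 1: "f - (\<Sum>w\<in>?W. Const (c w) * word_rep N w) \<in> Ann N"
      unfolding c_def by (rule word_rep_span(1)[OF homogeneous_part_poly_set[OF that]])
    have 2: "c w = 0" if "w \<in> ?W" "wdeg w \<noteq> k" for w
      unfolding c_def by (rule word_rep_span(2)[OF homogeneous_part_poly_set \<open>f \<in> _\<close> that]) fact
    have "(\<Sum>w\<in>?Wk k. Const (c w) * word_rep N w) = (\<Sum>w\<in>?W. Const (c w) * word_rep N w)"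
      using 2 by (intro sum.mono_neutral_left) (auto simp: Const_simps)
    then have "f - (\<Sum>w\<in>?Wk k. Const (c w) * word_rep N w) \<in> Ann N" using 1 by simp
    then show ?thesis by (rule exI[of _ c])
  qed
  have V: "homogeneous_part N k \<subseteq> poly_set N" for k using homogeneous_part_poly_set by blast
  have Wk: "?Wk k \<subseteq> ?W" for k by auto
  note part = dimension_rep[OF Wk V subk spank, folded apolar_part_def]
  show "apolar_finite_dim TYPE('k) N"
    unfolding apolar_finite_dim_def using total(1) part(1) by blast
  show "apolar_dim TYPE('k) N = card ?W" unfolding apolar_dim_def by (rule total(2))
  show "apolar_part_dim TYPE('k) N k = card (?Wk k)" unfolding apolar_part_dim_def by (rule part(2))
qed

section \<open>Counting words\<close>

definition word_sum :: "nat \<Rightarrow> 'c::comm_ring_1 \<Rightarrow> nat \<Rightarrow> nat \<Rightarrow> 'c" where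
  "word_sum p x N h = (\<Sum>w\<in>words p N h. x ^ wdeg w)"

lemma word_sum_0: "word_sum p x 0 h = (if h = 0 then 1 else 0)"
  by (simp add: word_sum_def)

lemma word_sum_Suc:
  assumes "p = 0 \<or> h + 2 \<le> p"
  shows "word_sum p x (Suc N) h = (1 + x) * word_sum p x N h +
    (case h of 0 \<Rightarrow> 0 | Suc k \<Rightarrow> word_sum p x N k) + x * word_sum p x N (Suc h)"
  unfolding word_sum_def sum_words_Suc[OF assms]
  by (simp add: sum_distrib_left sum.distrib algebra_simps split: nat.splits)

lemma word_sum_outside: "p \<noteq> 1 \<Longrightarrow> \<not> (p = 0 \<or> h + 2 \<le> p) \<Longrightarrow> word_sum p x N h = 0"
  using words_height[of _ p N h] by (auto simp: word_sum_def intro!: sum.neutral)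

lemma word_sum_1: "word_sum p 1 N h = of_nat (card (words p N h))"
  by (simp add: word_sum_def)

lemma word_sum_fps: "fps_nth (word_sum p fps_X N h) k = of_nat (card {w \<in> words p N h. wdeg w = k})"
proof -
  have "fps_nth (word_sum p fps_X N h) k = (\<Sum>w\<in>words p N h. if wdeg w = k then 1 else 0)"
    unfolding word_sum_def fps_sum_nth by (intro sum.cong) auto
  then show ?thesis by (simp add: sum.If_cases Int_def)
qed

text \<open>The walks left after deleting the level letters of words, with the same ceiling p - 2
  and the same convention for p = 0.\<close>

fun walks :: "nat \<Rightarrow> nat \<Rightarrow> nat \<Rightarrow> nat" where
  "walks p 0 h = (if h = 0 then 1 else 0)"
| "walks p (Suc n) h = (if p = 0 \<or> h + 2 \<le> p
     then (case h of 0 \<Rightarrow> 0 | Suc k \<Rightarrow> walks p n k) + walks p n (Suc h) else 0)"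

lemma walks_support: "walks p n h \<noteq> 0 \<Longrightarrow> h \<le> n \<and> even (n - h)"
proof (induction n arbitrary: h)
  case (Suc n)
  then consider k where "h = Suc k" "walks p n k \<noteq> 0" | "walks p n (Suc h) \<noteq> 0"
    by (auto split: if_splits nat.splits)
  then show ?case
  proof cases
    case 1 then show ?thesis using Suc.IH[of k] by auto
  next
    case 2 then show ?thesis using Suc.IH[of "Suc h"] by (auto simp: Suc_diff_le)
  qed
qed (auto split: if_splits)

lemma walks_outside: "p \<noteq> 1 \<Longrightarrow> \<not> (p = 0 \<or> h + 2 \<le> p) \<Longrightarrow> walks p n h = 0"
  by (cases n) auto

lemma binomial_shift:
  fixes a :: "'c::comm_ring_1"
  shows "(\<Sum>n\<le>Suc N. of_nat (Suc N choose n) * a ^ (Suc N - n) * g n) =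
    a * (\<Sum>n\<le>N. of_nat (N choose n) * a ^ (N - n) * g n) + (\<Sum>n\<le>N. of_nat (N choose n) * a ^ (N - n) * g (Suc n))"
proof -
  have "(\<Sum>n\<le>Suc N. of_nat (Suc N choose n) * a ^ (Suc N - n) * g n) =
    a ^ Suc N * g 0 + (\<Sum>n\<le>N. of_nat (N choose Suc n) * a ^ (N - n) * g (Suc n)) +
    (\<Sum>n\<le>N. of_nat (N choose n) * a ^ (N - n) * g (Suc n))"
    by (subst sum.atMost_Suc_shift) (simp add: algebra_simps sum.distrib)
  also have "a ^ Suc N * g 0 + (\<Sum>n\<le>N. of_nat (N choose Suc n) * a ^ (N - n) * g (Suc n)) =
    (\<Sum>n\<le>Suc N. of_nat (N choose n) * a ^ (Suc N - n) * g n)"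
    by (subst sum.atMost_Suc_shift) simp
  also have "\<dots> = a * (\<Sum>n\<le>N. of_nat (N choose n) * a ^ (N - n) * g n)"
    by (simp add: sum_distrib_left Suc_diff_le ac_simps binomial_eq_0)
  finally show ?thesis .
qed

text \<open>Choose the n positions of the letters that change the height. Each of the other N - n
  positions has two level letters of total weight 1 + x, and (n - h) / 2 of the chosen letters are
  down steps, each of weight x.\<close>

lemma word_sum_walks:
  assumes "p \<noteq> 1"
  shows "word_sum p x N h = (\<Sum>n\<le>N. of_nat (N choose n) * (1 + x) ^ (N - n) * (of_nat (walks p n h) * x ^ ((n - h) div 2)))"
proof (induction N arbitrary: h)
  case 0 then show ?case by (simp add: word_sum_0)
next
  case (Suc N)
  show ?case
  proof (cases "p = 0 \<or> h + 2 \<le> p")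
    case True
    let ?g = "\<lambda>h n. of_nat (walks p n h) * x ^ ((n - h) div 2)"
    have g: "?g h (Suc n) = (case h of 0 \<Rightarrow> 0 | Suc k \<Rightarrow> ?g k n) + x * ?g (Suc h) n" for n
    proof -
      have "of_nat (walks p n (Suc h)) * x ^ ((Suc n - h) div 2) = x * ?g (Suc h) n"
      proof (cases "walks p n (Suc h) = 0")
        case False
        then have "Suc h \<le> n" using walks_support by blast
        then have "Suc n - h = Suc (Suc (n - Suc h))" by simp
        then show ?thesis by (simp add: ac_simps)
      qed simp
      then show ?thesis using True by (cases h) (auto simp: algebra_simps)
    qed
    show ?thesis
      unfolding binomial_shift g word_sum_Suc[OF True] Suc.IH
      by (cases h) (simp_all add: sum_distrib_left sum.distrib algebra_simps)
  next
    case False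
    then show ?thesis using assms by (simp add: word_sum_outside walks_outside del: walks.simps)
  qed
qed

lemma word_sum_closed:
  assumes "p \<noteq> 1"
  shows "word_sum p x N 0 = (\<Sum>s = 0..N div 2. of_nat (N choose (2 * s)) * of_nat (walks p (2 * s) 0) * x ^ s * (1 + x) ^ (N - 2 * s))"
proof -
  let ?f = "\<lambda>n. of_nat (N choose n) * (1 + x) ^ (N - n) * (of_nat (walks p n 0) * x ^ (n div 2))"
  have "word_sum p x N 0 = (\<Sum>n\<le>N. ?f n)" by (simp add: word_sum_walks[OF assms])
  also have "\<dots> = (\<Sum>n\<in>(\<lambda>s. 2 * s) ` {0..N div 2}. ?f n)"
  proof (rule sum.mono_neutral_right)
    show "\<forall>n\<in>{..N} - (\<lambda>s. 2 * s) ` {0..N div 2}. ?f n = 0"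
    proof
      fix n assume n: "n \<in> {..N} - (\<lambda>s. 2 * s) ` {0..N div 2}"
      have "odd n"
      proof
        assume "even n"
        then have "n = 2 * (n div 2)" "n div 2 \<in> {0..N div 2}" using n by (auto simp: div_le_mono)
        then show False using n by blast
      qed
      then have "walks p n 0 = 0" using walks_support[of p n 0] by auto
      then show "?f n = 0" by simp
    qed
  qed auto
  also have "\<dots> = (\<Sum>s = 0..N div 2. ?f (2 * s))"
    by (subst sum.reindex) (auto simp: inj_on_def)
  finally show ?thesis by (simp add: ac_simps)
qed

text \<open>The final height is an integer so that the predecessor of height 0 is the genuinely
  empty set at -1.\<close>

definition walk_set :: "nat \<Rightarrow> nat \<Rightarrow> int \<Rightarrow> int list set" where
  "walk_set p n h = {w. length w = n \<and> set w \<subseteq> {1, -1} \<and> sum_list w = h \<and>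
     (\<forall>k \<le> n. 0 \<le> sum_list (take k w) \<and> sum_list (take k w) \<le> int p - 2)}"

lemma walk_set_Suc:
  assumes "0 \<le> h" "h \<le> int p - 2"
  shows "walk_set p (Suc n) h = (\<lambda>w. w @ [1]) ` walk_set p n (h - 1) \<union> (\<lambda>w. w @ [-1]) ` walk_set p n (h + 1)"
proof -
  have app: "w @ [x] \<in> walk_set p (Suc n) h \<longleftrightarrow> (x = 1 \<or> x = -1) \<and> w \<in> walk_set p n (h - x)" for w x
    using assms by (auto simp: walk_set_def le_Suc_eq all_conj_distrib) 
  show ?thesis
  proof (intro equalityI subsetI)
    fix v assume v: "v \<in> walk_set p (Suc n) h"
    then obtain w x where "v = w @ [x]" by (cases v rule: rev_cases) (auto simp: walk_set_def)
    then show "v \<in> (\<lambda>w. w @ [1]) ` walk_set p n (h - 1) \<union> (\<lambda>w. w @ [-1]) ` walk_set p n (h + 1)"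
      using v app by auto
  qed (use app in auto)
qed

lemma finite_walk_set: "finite (walk_set p n h)"
proof (rule finite_subset)
  show "walk_set p n h \<subseteq> {w. set w \<subseteq> {1, -1} \<and> length w = n}" by (auto simp: walk_set_def)
  show "finite {w :: int list. set w \<subseteq> {1, -1} \<and> length w = n}" by (rule finite_lists_length_eq) simp
qed

lemma card_walk_set:
  assumes "p \<ge> 2"
  shows "card (walk_set p n (int h)) = walks p n h"
proof (induction n arbitrary: h)
  case 0
  have "walk_set p 0 (int h) = (if h = 0 then {[]} else {})" using assms by (auto simp: walk_set_def)
  then show ?case by simp
next
  case (Suc n)
  show ?case
  proof (cases "h + 2 \<le> p")
    case True
    have e: "walk_set p n (- 1) = {}" by (auto simp: walk_set_def)
    have "card (walk_set p (Suc n) (int h)) = card (walk_set p n (int h - 1)) + card (walk_set p n (int h + 1))"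
    proof -
      have d: "(\<lambda>w. w @ [1]) ` A \<inter> (\<lambda>w. w @ [-1]) ` B = {}" for A B :: "int list set" by auto
      show ?thesis using True
        by (simp add: walk_set_Suc card_Un_disjoint d finite_walk_set card_image inj_on_def)
    qed
    also have "card (walk_set p n (int h - 1)) = (case h of 0 \<Rightarrow> 0 | Suc k \<Rightarrow> walks p n k)"
      using Suc.IH by (cases h) (auto simp: e)
    also have "card (walk_set p n (int h + 1)) = walks p n (Suc h)"
      using Suc.IH[of "Suc h"] by (simp add: add.commute)
    finally show ?thesis using True by simp
  next
    case False
    then have "walk_set p (Suc n) (int h) = {}" by (auto simp: walk_set_def)
    then show ?thesis using False assms by simp
  qed
qed

lemma dyck_count_walks:
  assumes "p \<ge> 2"
  shows "dyck_count p s = walks p (2 * s) 0"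
proof -
  have "path_height w \<le> int p - 2 \<longleftrightarrow> (\<forall>k \<le> length w. sum_list (take k w) \<le> int p - 2)" for w
  proof -
    have "{sum_list (take k w) | k. k \<le> length w} = (\<lambda>k. sum_list (take k w)) ` {..length w}" by auto
    then show ?thesis by (auto simp: path_height_def)
  qed
  then have "{w \<in> dyck_paths s. path_height w \<le> int p - 2} = walk_set p (2 * s) 0"
    by (auto simp: dyck_paths_def walk_set_def)
  then show ?thesis using card_walk_set[OF assms, of "2 * s" 0] by (simp add: dyck_count_def)
qed

text \<open>The matrix is the transfer matrix of the words: its states are the heights 0, ..., p -
  2, and the diagonal entry 2 counts the two level letters.\<close>

lemma matrix_power_walks:
  assumes "p \<ge> 2" "h < p - 1"
  shows "((2 \<cdot>\<^sub>m 1\<^sub>m (p - 1) + path_adj (p - 1)) ^\<^sub>m N) $$ (0, h) = (word_sum p 1 N h :: int)"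
  using assms(2)
proof (induction N arbitrary: h)
  case 0
  then show ?case using assms(1) by (simp add: word_sum_0 path_adj_def)
next
  case (Suc N)
  let ?m = "p - 1"
  let ?A = "2 \<cdot>\<^sub>m 1\<^sub>m ?m + path_adj ?m :: int mat"
  have A: "?A \<in> carrier_mat ?m ?m" by (simp add: path_adj_def)
  then have P: "?A ^\<^sub>m N \<in> carrier_mat ?m ?m" by (rule pow_carrier_mat)
  have "(?A ^\<^sub>m Suc N) $$ (0, h) = (\<Sum>i = 0..<?m. (?A ^\<^sub>m N) $$ (0, i) * ?A $$ (i, h))"
    using P A Suc.prems by (simp add: scalar_prod_def path_adj_def)
  also have "\<dots> = (\<Sum>i = 0..<?m. word_sum p 1 N i * ((if i = h then 2 else 0) + (if i = Suc h then 1 else 0) + (if Suc i = h then 1 else 0)))"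
    using Suc by (intro sum.cong) (auto simp: path_adj_def)
  also have "\<dots> = (\<Sum>i = 0..<?m. (if i = h then 2 * word_sum p 1 N i else 0)) +
     (\<Sum>i = 0..<?m. (if i = Suc h then word_sum p 1 N i else 0)) + (\<Sum>i = 0..<?m. (if Suc i = h then word_sum p 1 N i else 0))"
    unfolding sum.distrib[symmetric] by (intro sum.cong) (auto simp: algebra_simps)
  also have "(\<Sum>i = 0..<?m. (if i = h then 2 * word_sum p 1 N i else 0)) = (2 * word_sum p 1 N h :: int)"
    using Suc.prems by (simp add: sum.delta)
  also have "(\<Sum>i = 0..<?m. (if i = Suc h then word_sum p 1 N i else 0)) = (word_sum p 1 N (Suc h) :: int)"
  proof (cases "Suc h < ?m")
    case False
    then have "word_sum p (1::int) N (Suc h) = 0" using assms Suc.prems by (intro word_sum_outside) auto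
    then show ?thesis using False by (simp add: sum.delta)
  qed (simp add: sum.delta)
  also have "(\<Sum>i = 0..<?m. (if Suc i = h then word_sum p 1 N i else 0)) = (case h of 0 \<Rightarrow> 0 | Suc k \<Rightarrow> (word_sum p 1 N k :: int))"
    using Suc.prems by (cases h) (auto simp: sum.delta)
  finally show ?case using Suc.prems by (subst word_sum_Suc) auto
qed

text \<open>The number of unrestricted words of N letters ending at height m: one letter amounts to
  two half steps, with multiplicities 1, 2, 1 for its height changes.\<close>

definition cbinom :: "nat \<Rightarrow> int \<Rightarrow> int" where
  "cbinom N m = binom (2 * N) (int N + m)"

lemma binom_Suc: "binom (Suc n) b = binom n (b - 1) + binom n b"
proof (cases "b \<le> 0")
  case True then show ?thesis by (cases "b = 0") (auto simp: binom_def)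
next
  case False
  then obtain c where c: "b = int (Suc c)" using zero_less_imp_eq_int[of b] by (metis gr0_implies_Suc linorder_not_le of_nat_0_less_iff)
  have "nat (int (Suc c) - 1) = c" "nat (int (Suc c)) = Suc c" by simp_all
  then show ?thesis unfolding binom_def c by (simp del: of_nat_Suc)
qed

lemma cbinom_Suc: "cbinom (Suc N) m = cbinom N (m - 1) + 2 * cbinom N m + cbinom N (m + 1)"
  by (simp add: cbinom_def binom_Suc algebra_simps)

lemma cbinom_zero: "cbinom 0 m = (if m = 0 then 1 else 0)"
  by (auto simp: cbinom_def binom_def)

lemma cbinom_minus: "cbinom N (- m) = cbinom N m"
  by (induction N arbitrary: m) (auto simp: cbinom_zero cbinom_Suc, metis (no_types) add.commute minus_diff_eq uminus_add_conv_diff minus_add_distrib diff_minus_eq_add)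

lemma cbinom_outside: "\<bar>m\<bar> > int N \<Longrightarrow> cbinom N m = 0"
  by (induction N arbitrary: m) (auto simp: cbinom_zero cbinom_Suc)

lemma antisymmetric_sum:
  fixes f :: "int \<Rightarrow> int"
  assumes "\<And>j. f (c - j) = - f j"
  shows "(\<Sum>j = a..c - a. f j) = 0"
proof -
  have "(\<Sum>j = a..c - a. f j) = (\<Sum>j = a..c - a. f (c - j))"
    by (rule sum.reindex_bij_witness[of _ "\<lambda>j. c - j" "\<lambda>j. c - j"]) auto
  also have "\<dots> = - (\<Sum>j = a..c - a. f j)" by (simp add: assms sum_negf)
  finally show ?thesis by simp
qed

text \<open>Reflections about the heights -1 and p - 1 generate the translations by 2 p. The
  subtracted term is the mirror image -h - 2 of a translate, rewritten by the evenness of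
  \<open>cbinom\<close>.\<close>

definition refl_term :: "nat \<Rightarrow> nat \<Rightarrow> int \<Rightarrow> int \<Rightarrow> int" where
  "refl_term p N h j = cbinom N (h + 2 * int p * j) - cbinom N (h + 2 * int p * j + 2)"

lemma refl_term_outside:
  assumes p: "p \<ge> 2" and h: "-1 \<le> h" "h \<le> int p - 1" and j: "\<bar>j\<bar> \<ge> int N + 2"
  shows "refl_term p N h j = 0"
proof -
  have m: "int p * (int N + 2) \<le> int p * \<bar>j\<bar>" using j by (intro mult_left_mono) auto
  have q: "2 * int N \<le> int p * int N" using p by (intro mult_right_mono) auto
  have "\<bar>2 * int p * j\<bar> = 2 * (int p * \<bar>j\<bar>)" by (simp add: abs_mult)
  then have b: "\<bar>2 * int p * j\<bar> \<ge> 4 * int N + 4 * int p" using m q by (simp add: algebra_simps)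
  have "cbinom N (h + 2 * int p * j) = 0" "cbinom N (h + 2 * int p * j + 2) = 0"
    using b h p by (intro cbinom_outside; linarith)+
  then show ?thesis by (simp add: refl_term_def)
qed

text \<open>
  Both sides satisfy the same recursion, and the right-hand side is antisymmetric about the
  heights \<open>-1\<close> and \<open>p - 1\<close>.
\<close>

lemma word_sum_reflection:
  assumes p: "p \<ge> 3" and "N \<le> M" "h \<le> p - 2"
  shows "word_sum p 1 N h = (\<Sum>j = - int M - 2..int M + 2. refl_term p N (int h) j)"
  using assms(2,3)
proof (induction N arbitrary: h)
  case 0
  have "refl_term p 0 (int h) j = (if j = 0 then (if h = 0 then 1 else 0) else 0)" for j
  proof -
    consider "j = 0" | "j \<ge> 1" | "j \<le> -1" by linarith
    then show ?thesis
    proof cases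
      case 2
      then have "2 * int p * j \<ge> 2 * int p * 1" by (intro mult_left_mono) auto
      then have "int h + 2 * int p * j \<noteq> 0" "int h + 2 * int p * j + 2 \<noteq> 0"
        using p by linarith+
      then show ?thesis using 2 by (simp add: refl_term_def cbinom_zero)
    next
      case 3
      then have "2 * int p * j \<le> 2 * int p * (-1)" by (intro mult_left_mono) auto
      then have "int h + 2 * int p * j \<noteq> 0" "int h + 2 * int p * j + 2 \<noteq> 0"
        using p \<open>h \<le> p - 2\<close> by linarith+
      then show ?thesis using 3 by (simp add: refl_term_def cbinom_zero)
    qed (simp add: refl_term_def cbinom_zero)
  qed
  then show ?case by (simp add: word_sum_0 sum.delta)
next
  case (Suc N)
  \<comment> \<open>The summation range depends on the fixed M and not on N, so all sums in the
    recursion can be combined term by term.\<close>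
  let ?S = "\<lambda>h. \<Sum>j = - int M - 2..int M + 2. refl_term p N h j"
  have b: "p = 0 \<or> h + 2 \<le> p" using Suc.prems p by auto
  have low: "(case h of 0 \<Rightarrow> 0 | Suc k \<Rightarrow> word_sum p 1 N k) = ?S (int h - 1)"
  proof (cases h)
    case 0
    \<comment> \<open>At height -1 the terms for j and -j cancel, and the range is symmetric about
      0.\<close>
    have "(\<Sum>j = - int M - 2..0 - (- int M - 2). refl_term p N (-1) j) = 0"
    proof (rule antisymmetric_sum)
      fix j
      show "refl_term p N (- 1) (0 - j) = - refl_term p N (- 1) j"
        using cbinom_minus[of N "-1 + 2 * int p * j"] cbinom_minus[of N "1 + 2 * int p * j"]
        by (simp add: refl_term_def algebra_simps)
    qed
    then show ?thesis using 0 by (simp add: add.commute)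
  next
    case (Suc k)
    then show ?thesis using Suc.IH[of k] Suc.prems by simp
  qed
  have high: "word_sum p 1 N (Suc h) = ?S (int h + 1)"
  proof (cases "h + 3 \<le> p")
    case True
    then show ?thesis using Suc.IH[of "Suc h"] Suc.prems by (simp add: add.commute)
  next
    case False
    then have h: "int h + 1 = int p - 1" using Suc.prems p by auto
    \<comment> \<open>At height p - 1 the reflection exchanges j and -1 - j, so the range is
      enlarged by one index to be symmetric about -1/2. The added term is out of reach for N letters
      and vanishes.\<close>
    have "(\<Sum>j = - int M - 3..-1 - (- int M - 3). refl_term p N (int p - 1) j) = 0"
    proof (rule antisymmetric_sum)
      fix j
      show "refl_term p N (int p - 1) (- 1 - j) = - refl_term p N (int p - 1) j"
        using cbinom_minus[of N "int p - 1 + 2 * int p * j"] cbinom_minus[of N "int p + 1 + 2 * int p * j"]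
        by (simp add: refl_term_def algebra_simps)
    qed
    also have "- 1 - (- int M - 3) = int M + 2" by simp
    also have "{- int M - 3..int M + 2} = insert (- int M - 3) {- int M - 2..int M + 2}" by auto
    finally have "refl_term p N (int p - 1) (- int M - 3) + ?S (int p - 1) = 0" by simp
    moreover have "refl_term p N (int p - 1) (- int M - 3) = 0"
      using p Suc.prems by (intro refl_term_outside) auto
    moreover have "word_sum p (1::int) N (Suc h) = 0"
      using False p by (intro word_sum_outside) auto
    ultimately show ?thesis unfolding h by simp
  qed
  have "refl_term p (Suc N) (int h) j = refl_term p N (int h - 1) j + 2 * refl_term p N (int h) j + refl_term p N (int h + 1) j" for j
    by (simp add: refl_term_def cbinom_Suc algebra_simps)
  then have "(\<Sum>j = - int M - 2..int M + 2. refl_term p (Suc N) (int h) j) = ?S (int h - 1) + 2 * ?S (int h) + ?S (int h + 1)"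
    by (simp add: sum.distrib sum_distrib_left)
  then show ?case using word_sum_Suc[OF b, of "1::int" N] low high Suc.IH[of h] Suc.prems by simp
qed

lemma refl_term_finite:
  assumes "p \<ge> 3"
  shows "{j. refl_term p N 0 j \<noteq> 0} \<subseteq> {- int N - 2..int N + 2}"
proof
  fix j assume "j \<in> {j. refl_term p N 0 j \<noteq> 0}"
  then have "\<not> \<bar>j\<bar> \<ge> int N + 2" using refl_term_outside[of p 0 N j] assms by auto
  then show "j \<in> {- int N - 2..int N + 2}" by auto
qed

corollary word_sum_Sum_any:
  assumes "p \<ge> 3"
  shows "word_sum p 1 N 0 = Sum_any (refl_term p N 0)"
  using word_sum_reflection[OF assms order_refl, of 0 N] refl_term_finite[OF assms, of N]
  by (subst Sum_any.expand_superset[of "{- int N - 2..int N + 2}"]) auto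

text \<open>Without a ceiling a single reflection, about the height -1, remains.\<close>

lemma word_sum_char0: "word_sum 0 1 N h = cbinom N (int h) - cbinom N (int h + 2)"
proof (induction N arbitrary: h)
  case 0 then show ?case by (simp add: word_sum_0 cbinom_zero)
next
  case (Suc N)
  have low: "(case h of 0 \<Rightarrow> 0 | Suc k \<Rightarrow> word_sum 0 1 N k) = cbinom N (int h - 1) - cbinom N (int h + 1)"
    using Suc.IH cbinom_minus[of N 1] by (cases h) (auto simp: algebra_simps)
  show ?case
    unfolding word_sum_Suc[of 0 h, simplified] low Suc.IH by (simp add: cbinom_Suc algebra_simps)
qed

section \<open>Catalan, ballot and Narayana numbers\<close>

lemma binomial_Suc_rat: "of_nat (n choose Suc k) * (of_nat (Suc k) :: rat) = of_nat (n choose k) * (of_nat n - of_nat k)"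
proof (cases "k \<le> n")
  case True
  have "(n choose Suc k) * Suc k = (n choose k) * (n - k)"
    using binomial_absorb_comp[of n k] binomial_absorption[of k n] by (simp add: mult.commute)
  then have "of_nat ((n choose Suc k) * Suc k) = (of_nat ((n choose k) * (n - k)) :: rat)" by (rule arg_cong)
  then show ?thesis using True by (simp only: of_nat_mult of_nat_diff)
qed (simp add: binomial_eq_0)

lemma catalan_diff: "of_nat ((2 * s) choose s) - of_nat ((2 * s) choose Suc s) = catalan s"
proof -
  let ?b = "of_nat ((2 * s) choose s) :: rat"
  have "of_nat ((2 * s) choose Suc s) * (of_nat (Suc s) :: rat) = ?b * of_nat s"
    using binomial_Suc_rat[of "2 * s" s] by simp
  then have "of_nat ((2 * s) choose Suc s) = ?b * of_nat s / (of_nat (Suc s) :: rat)"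
    by (simp add: field_simps del: of_nat_Suc)
  then show ?thesis by (simp add: catalan_def field_simps)
qed

lemma catalan_Suc_diff: "of_nat ((2 * N) choose N) - of_nat ((2 * N) choose (N + 2)) = catalan (N + 1)"
proof -
  let ?b = "of_nat ((2 * N) choose N) :: rat" and ?n = "of_nat N :: rat"
  have 1: "of_nat ((2 * N) choose Suc N) * (?n + 1) = ?b * ?n"
    using binomial_Suc_rat[of "2 * N" N] by (simp add: algebra_simps)
  have 2: "of_nat ((2 * N) choose (N + 2)) * (?n + 2) = of_nat ((2 * N) choose Suc N) * (?n - 1)"
    using binomial_Suc_rat[of "2 * N" "Suc N"] by (simp add: algebra_simps)
  have "(2 * (N + 1)) choose (N + 1) = 2 * ((2 * N) choose N) + 2 * ((2 * N) choose Suc N)"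
  proof -
    have "(2 * N) choose (N - 1) = (2 * N) choose Suc N" if "N > 0"
      using binomial_symmetric[of "N - 1" "2 * N"] that by (simp add: Suc_diff_le[symmetric])
    then show ?thesis by (cases N) (auto simp: algebra_simps)
  qed
  then have 3: "of_nat ((2 * (N + 1)) choose (N + 1)) = 2 * ?b + 2 * (of_nat ((2 * N) choose Suc N) :: rat)"
    by (simp only: of_nat_add of_nat_mult of_nat_numeral)
  have nz: "?n + 1 \<noteq> 0" "?n + 2 \<noteq> 0" using of_nat_0_le_iff[of N, where 'a = rat] by linarith+
  have c1: "of_nat ((2 * N) choose Suc N) = ?b * ?n / (?n + 1)" using 1 nz by (simp add: field_simps)
  have c2: "of_nat ((2 * N) choose (N + 2)) = ?b * ?n / (?n + 1) * (?n - 1) / (?n + 2)"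
    by (rule eq_divide_imp[OF nz(2) 2[unfolded c1]])
  have "catalan (N + 1) = 1 / (?n + 2) * (2 * ?b + 2 * (?b * ?n / (?n + 1)))"
    unfolding catalan_def 3 c1 by (simp add: algebra_simps)
  then show ?thesis unfolding c2 using nz by (simp add: divide_simps) (simp add: algebra_simps)
qed

lemma word_sum_catalan: "of_int (word_sum 0 1 N 0) = catalan (N + 1)"
proof -
  have "word_sum 0 1 N 0 = int ((2 * N) choose N) - int ((2 * N) choose (N + 2))"
    by (simp add: word_sum_char0 cbinom_def binom_def nat_add_distrib)
  then show ?thesis using catalan_Suc_diff[of N] by simp
qed

text \<open>Ballot numbers: (n + h) / 2 is the number of up steps, and the subtracted binomial
  counts the walks reflected about -1.\<close>

lemma walks_char0:
  "int (walks 0 n h) = (if even (n + h) then int (n choose ((n + h) div 2)) - int (n choose Suc ((n + h) div 2)) else 0)"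
proof (induction n arbitrary: h)
  case 0
  then show ?case by (auto elim!: evenE)
next
  case (Suc n)
  show ?case
  proof (cases "even (Suc n + h)")
    case False
    then show ?thesis using Suc.IH[of "Suc h"] Suc.IH[of "h - 1"] by (cases h) auto
  next
    case True
    then obtain m where m: "Suc n + h = 2 * m" by (rule evenE)
    then obtain k where k: "m = Suc k" by (cases m) auto
    have high: "int (walks 0 n (Suc h)) = int (n choose m) - int (n choose Suc m)"
    proof -
      have "n + Suc h = 2 * m" using m by simp
      then show ?thesis using Suc.IH[of "Suc h"] by simp
    qed
    have low: "int (case h of 0 \<Rightarrow> 0 | Suc k \<Rightarrow> walks 0 n k) = int (n choose k) - int (n choose m)"
    \<comment> \<open>For h = 0 there is no lower neighbour; the two binomials agree by symmetry
      because n = k + m.\<close>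
    proof (cases h)
      case 0
      then have "n = k + m" using m k by simp
      then have "n choose k = n choose m" using binomial_symmetric[of k n] by simp
      then show ?thesis using 0 by simp
    next
      case (Suc i)
      then have "n + i = 2 * k" using m k by simp
      then show ?thesis using Suc.IH[of i] Suc k by simp
    qed
    have "int (walks 0 (Suc n) h) = int (n choose k) - int (n choose m) + (int (n choose m) - int (n choose Suc m))"
      using low high by (simp split: nat.splits)
    also have "\<dots> = int (Suc n choose m) - int (Suc n choose Suc m)" by (simp add: k)
    finally show ?thesis using True m by simp
  qed
qed

lemma walks_catalan: "of_nat (walks 0 (2 * s) 0) = catalan s"
proof -
  have "int (walks 0 (2 * s) 0) = int ((2 * s) choose s) - int ((2 * s) choose Suc s)"
    using walks_char0[of "2 * s" 0] by simp
  then have "of_int (int (walks 0 (2 * s) 0)) = (of_int (int ((2 * s) choose s) - int ((2 * s) choose Suc s)) :: rat)"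
    by (rule arg_cong)
  then show ?thesis using catalan_diff[of s] by simp
qed

text \<open>A letter is a pair of bits, whether a and whether b is present. Degree k and height h
  mean k sites with b and k + h with a, giving the first product. Reflection about -1 turns the
  counts into k + h + 1 and k - 1, giving the second. The proof itself only checks the recursion by
  Pascal's rule.\<close>

lemma word_sum_narayana:
  "fps_nth (word_sum 0 (fps_X :: rat fps) N h) k =
    of_nat (N choose k) * of_nat (N choose (k + h)) -
    of_nat (N choose (k + h + 1)) * (case k of 0 \<Rightarrow> 0 | Suc j \<Rightarrow> of_nat (N choose j))"
proof (induction N arbitrary: h k)
  case 0
  then show ?case by (cases k) (auto simp: word_sum_0)
next
  case (Suc N)
  have r: "fps_nth (word_sum 0 (fps_X :: rat fps) (Suc N) h) k =
     fps_nth (word_sum 0 fps_X N h) k + (case k of 0 \<Rightarrow> 0 | Suc j \<Rightarrow> fps_nth (word_sum 0 fps_X N h) j) +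
     (case h of 0 \<Rightarrow> 0 | Suc i \<Rightarrow> fps_nth (word_sum 0 fps_X N i) k) +
     (case k of 0 \<Rightarrow> 0 | Suc j \<Rightarrow> fps_nth (word_sum 0 fps_X N (Suc h)) j)"
    unfolding word_sum_Suc[of 0 h, simplified]
    by (cases k; cases h) (simp_all add: distrib_right)
  show ?case unfolding r Suc.IH
    by (cases k; cases h) (auto simp: algebra_simps split: nat.splits)
qed

lemma narayana:
  "of_nat (N choose k) * of_nat (N choose k) - of_nat (N choose (k + 1)) * (case k of 0 \<Rightarrow> 0 | Suc j \<Rightarrow> of_nat (N choose j)) =
   1 / of_nat (N + 1) * of_nat ((N + 1) choose k) * (of_nat ((N + 1) choose (k + 1)) :: rat)"
proof (cases k)
  case 0
  have "of_nat (N + 1) \<noteq> (0::rat)" unfolding of_nat_eq_0_iff by simp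
  then show ?thesis using 0 by simp
next
  case (Suc j)
  let ?n = "of_nat N :: rat" and ?j = "of_nat j :: rat"
  let ?a = "of_nat (N choose j) :: rat" and ?b = "of_nat (N choose Suc j) :: rat" and ?c = "of_nat (N choose Suc (Suc j)) :: rat"
  have 1: "?b * (?j + 1) = ?a * (?n - ?j)" using binomial_Suc_rat[of N j] by (simp add: algebra_simps)
  have 2: "?c * (?j + 2) = ?b * (?n - ?j - 1)" using binomial_Suc_rat[of N "Suc j"] by (simp add: algebra_simps)
  have nz: "?j + 1 \<noteq> 0" "?j + 2 \<noteq> 0" "?n + 1 \<noteq> 0"
    using of_nat_0_le_iff[of j, where 'a = rat] of_nat_0_le_iff[of N, where 'a = rat] by linarith+
  have b: "?b = ?a * (?n - ?j) / (?j + 1)" using 1 nz by (simp add: field_simps)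
  have c: "?c = ?a * (?n - ?j) / (?j + 1) * (?n - ?j - 1) / (?j + 2)" by (rule eq_divide_imp[OF nz(2) 2[unfolded b]])
  have "?b * ?b - ?c * ?a = 1 / (?n + 1) * (?a + ?b) * (?b + ?c)"
    unfolding b c using nz by (simp add: divide_simps) (simp add: algebra_simps)
  then show ?thesis using Suc by (simp add: add.commute)
qed

theorem theorem1p2:
  fixes N p :: nat
  assumes "N \<ge> 1"
    and "CHAR('k::field) = p"
  shows
    "(odd p \<longrightarrow>
        apolar_finite_dim TYPE('k) N \<and>
        hilbert_series TYPE('k) N =
          (\<Sum>s = 0..N div 2. of_nat (N choose (2 * s)) * of_nat (dyck_count p s) *
             fps_X ^ s * (1 + fps_X) ^ (N - 2 * s)) \<and>
        int (apolar_dim TYPE('k) N) =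
          ((2 \<cdot>\<^sub>m 1\<^sub>m (p - 1) + path_adj (p - 1)) ^\<^sub>m N) $$ (0, 0) \<and>
        finite {j :: int. binom (2 * N) (int N + 2 * int p * j)
                          - binom (2 * N) (int N + 2 * int p * j + 2) \<noteq> 0} \<and>
        int (apolar_dim TYPE('k) N) =
          Sum_any (\<lambda>j :: int. binom (2 * N) (int N + 2 * int p * j)
                             - binom (2 * N) (int N + 2 * int p * j + 2)))
     \<and>
     (p = 0 \<longrightarrow>
        apolar_finite_dim TYPE('k) N \<and>
        hilbert_series TYPE('k) N =
          (\<Sum>s = 0..N div 2. of_nat (N choose (2 * s)) * fps_const (catalan s) *
             fps_X ^ s * (1 + fps_X) ^ (N - 2 * s)) \<and>
        (\<forall>k. of_nat (apolar_part_dim TYPE('k) N k) =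
          (1 / of_nat (N + 1) * of_nat ((N + 1) choose k) * of_nat ((N + 1) choose (k + 1)) :: rat)) \<and>
        of_nat (apolar_dim TYPE('k) N) = catalan (N + 1))"
proof -
  have p1: "p \<noteq> 1" using assms(2) CHAR_not_1' by auto
  have fd: "apolar_finite_dim TYPE('k) N" by (rule apolar_dims)
  have part: "fps_nth (word_sum p (fps_X :: rat fps) N 0) k = of_nat (apolar_part_dim TYPE('k) N k)" for k
    using apolar_dims(3)[where 'k = 'k, of N k] assms(2) by (simp add: word_sum_fps)
  have hs: "hilbert_series TYPE('k) N = word_sum p fps_X N 0"
    by (rule fps_ext) (simp add: hilbert_series_def part)
  have dim: "int (apolar_dim TYPE('k) N) = word_sum p 1 N 0"
    using apolar_dims(2)[where 'k = 'k, of N] assms(2) by (simp add: word_sum_1)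
  show ?thesis
  proof (intro conjI impI allI)
    show "apolar_finite_dim TYPE('k) N" "apolar_finite_dim TYPE('k) N" by (fact fd)+
  next
    assume "odd p"
    then have p: "p \<ge> 3" using p1 by (cases p) (auto elim!: oddE)
    show "hilbert_series TYPE('k) N =
          (\<Sum>s = 0..N div 2. of_nat (N choose (2 * s)) * of_nat (dyck_count p s) *
             fps_X ^ s * (1 + fps_X) ^ (N - 2 * s))"
      using p by (simp add: hs word_sum_closed[OF p1] dyck_count_walks)
    show "int (apolar_dim TYPE('k) N) =
          ((2 \<cdot>\<^sub>m 1\<^sub>m (p - 1) + path_adj (p - 1)) ^\<^sub>m N) $$ (0, 0)"
      unfolding dim using p by (intro matrix_power_walks[symmetric]) auto
    have t: "refl_term p N 0 = (\<lambda>j. binom (2 * N) (int N + 2 * int p * j)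
        - binom (2 * N) (int N + 2 * int p * j + 2))"
      by (simp add: fun_eq_iff refl_term_def cbinom_def add.assoc)
    show "finite {j :: int. binom (2 * N) (int N + 2 * int p * j)
                          - binom (2 * N) (int N + 2 * int p * j + 2) \<noteq> 0}"
      using finite_subset[OF refl_term_finite[OF p, of N]] unfolding t by blast
    show "int (apolar_dim TYPE('k) N) =
          Sum_any (\<lambda>j :: int. binom (2 * N) (int N + 2 * int p * j)
                             - binom (2 * N) (int N + 2 * int p * j + 2))"
      unfolding dim word_sum_Sum_any[OF p] t ..
  next
    assume p: "p = 0"
    show "hilbert_series TYPE('k) N =
          (\<Sum>s = 0..N div 2. of_nat (N choose (2 * s)) * fps_const (catalan s) *
             fps_X ^ s * (1 + fps_X) ^ (N - 2 * s))"
      unfolding hs word_sum_closed[OF p1] unfolding p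
      by (simp add: fps_of_nat flip: walks_catalan)
    show "of_nat (apolar_part_dim TYPE('k) N k) =
          (1 / of_nat (N + 1) * of_nat ((N + 1) choose k) * of_nat ((N + 1) choose (k + 1)) :: rat)" for k
      unfolding part[symmetric] p word_sum_narayana narayana[symmetric] by simp
    show "of_nat (apolar_dim TYPE('k) N) = catalan (N + 1)"
      using word_sum_catalan[of N] dim unfolding p by (metis of_int_of_nat_eq)
  qed
qed

end
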